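(* Let $H$ be a weak Hopf algebra with bijective antipode over a commutative ring $k$. The monoidal category of left-left Yetter-Drinfeld modules over $H$ that are finitely generated and projective as $k$-modules has left duality.
   Context: $\otimes=\otimes_k$. A weak $k$-bialgebra is a $k$-module $H$ with a unital associative algebra structure and a coassociative counital coalgebra structure $(\Delta,\varepsilon)$, $\Delta(h)=h_{(1)}\otimes h_{(2)}$, such that $\Delta(hk)=\Delta(h)\Delta(k)$, $(\Delta\otimes H)\Delta(1)=1_{(1)}\otimes 1_{(2)}1_{(1')}\otimes 1_{(2')}=1_{(1)}\otimes 1_{(1')}1_{(2)}\otimes 1_{(2')}$, $\varepsilon(hkl)=\varepsilon(hk_{(1)})\varepsilon(k_{(2)}l)=\varepsilon(hk_{(2)})\varepsilon(k_{(1)}l)$. Put $\varepsilon_t(h)=\varepsilon(1_{(1)}h)1_{(2)}$, $\varepsilon_s(h)=1_{(1)}\varepsilon(h1_{(2)})$, $\overline{\varepsilon}_s(h)=\varepsilon(1_{(2)}h)1_{(1)}$, $H_t=\mathrm{Im}(\varepsilon_t)$. A weak Hopf algebra is a weak bialgebra with a $k$-linear antipode $S$ such that $S(h_{(1)})h_{(2)}=\varepsilon_s(h)$, $h_{(1)}S(h_{(2)})=\varepsilon_t(h)$, $S(h_{(1)})h_{(2)}S(h_{(3)})=S(h)$. For left $H$-modules, $M\otimes_tN=\Delta(1)(M\otimes N)\subset M\otimes N$ with diagonal action. A left-left Yetter-Drinfeld module is a $k$-module $M$ with a left $H$-action and a (coassociative, counital) left $H$-coaction $\lambda(m)=m_{[-1]}\otimes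 m_{[0]}$ such that $\lambda(m)\in H\otimes_tM$ and $h_{(1)}m_{[-1]}\otimes h_{(2)}m_{[0]}=(h_{(1)}m)_{[-1]}h_{(2)}\otimes(h_{(1)}m)_{[0]}$ for all $h\in H$, $m\in M$; morphisms are left $H$-linear left $H$-colinear maps. The monoidal structure: tensor product $M\otimes_tN$ with coaction $\lambda(1_{(1)}m\otimes 1_{(2)}n)=m_{[-1]}n_{[-1]}\otimes m_{[0]}\otimes n_{[0]}$; unit object $H_t$ with action $h\rightharpoonup z=\varepsilon_t(hz)$ and coaction $\Delta$; natural associativity; unit constraints $l_M(1_{(1)}\rightharpoonup z\otimes 1_{(2)}m)=zm$, $r_M(1_{(1)}m\otimes 1_{(2)}\rightharpoonup z)=\overline{\varepsilon}_s(z)m$. A monoidal category with unit $I$ has left duality if for every object $M$ there are an object $M^*$ and morphisms $\mathrm{ev}_M:M^*\otimes M\to I$, $\mathrm{coev}_M:I\to M\otimes M^*$ such that (suppressing constraints) $(M\otimes\mathrm{ev}_M)(\mathrm{coev}_M\otimes M)=\mathrm{id}_M$ and $(\mathrm{ev}_M\otimes M^* )(M^*\otimes\mathrm{coev}_M)=\mathrm{id}_{M^*}$. *)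

theory Defs
  imports "HOL-Algebra.Module" "HOL-Algebra.AbelCoset"
begin

section \<open>Modules over a commutative ring\<close>

text \<open>The record type of modules extends that of rings; for objects that are only modules the
  fields for multiplication and its unit are irrelevant and left undefined.\<close>

definition linear_maps ::
  "('k, 'z) ring_scheme \<Rightarrow> ('k, 'm, 'u) module_scheme \<Rightarrow> ('k, 'n, 'v) module_scheme \<Rightarrow> ('m \<Rightarrow> 'n) set"
  where "linear_maps R M N =
    {f \<in> carrier M \<rightarrow> carrier N.
       (\<forall>x \<in> carrier M. \<forall>y \<in> carrier M. f (x \<oplus>\<^bsub>M\<^esub> y) = f x \<oplus>\<^bsub>N\<^esub> f y) \<and>
       (\<forall>r \<in> carrier R. \<forall>x \<in> carrier M. f (r \<odot>\<^bsub>M\<^esub> x) = r \<odot>\<^bsub>N\<^esub> f x)}"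

definition regular_module :: "('k, 'z) ring_scheme \<Rightarrow> ('k, 'k) module"
  where "regular_module R =
    \<lparr>carrier = carrier R, monoid.mult = monoid.mult R, one = one R,
     zero = zero R, add = add R, smult = monoid.mult R\<rparr>"

text \<open>The free module on a set \<open>X\<close>: finitely supported functions.\<close>

definition free_module :: "('k, 'z) ring_scheme \<Rightarrow> 'x set \<Rightarrow> ('k, 'x \<Rightarrow> 'k) module"
  where "free_module R X =
    \<lparr>carrier = {f. range f \<subseteq> carrier R \<and> finite {x. f x \<noteq> \<zero>\<^bsub>R\<^esub>} \<and> {x. f x \<noteq> \<zero>\<^bsub>R\<^esub>} \<subseteq> X},
     monoid.mult = undefined, one = undefined,
     zero = (\<lambda>x. \<zero>\<^bsub>R\<^esub>), add = (\<lambda>f g x. f x \<oplus>\<^bsub>R\<^esub> g x), smult = (\<lambda>r f x. r \<otimes>\<^bsub>R\<^esub> f x)\<rparr>"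

definition free_basis :: "('k, 'z) ring_scheme \<Rightarrow> 'x \<Rightarrow> 'x \<Rightarrow> 'k"
  where "free_basis R x = (\<lambda>y. if y = x then \<one>\<^bsub>R\<^esub> else \<zero>\<^bsub>R\<^esub>)"

definition quotient_module :: "('k, 'm, 'u) module_scheme \<Rightarrow> 'm set \<Rightarrow> ('k, 'm set) module"
  where "quotient_module M K =
    \<lparr>carrier = a_rcosets\<^bsub>M\<^esub> K, monoid.mult = undefined, one = undefined,
     zero = K, add = set_add M, smult = (\<lambda>r X. \<Union>x \<in> X. K +>\<^bsub>M\<^esub> (r \<odot>\<^bsub>M\<^esub> x))\<rparr>"

definition finitely_generated :: "('k, 'z) ring_scheme \<Rightarrow> ('k, 'm, 'u) module_scheme \<Rightarrow> bool"
  where "finitely_generated R M \<longleftrightarrow>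
    (\<exists>A. finite A \<and> A \<subseteq> carrier M \<and>
      (\<forall>m \<in> carrier M. \<exists>c \<in> A \<rightarrow> carrier R. m = (\<Oplus>\<^bsub>M\<^esub>a\<in>A. c a \<odot>\<^bsub>M\<^esub> a)))"

text \<open>Projective means: a direct summand (retract) of a free module. Letting the basis range over
  the sets of elements of the carrier type of \<open>M\<close> is no restriction: if \<open>M\<close> is a retract of any
  free module, it is a retract of the free module on \<open>carrier M\<close>.\<close>

definition projective :: "('k, 'z) ring_scheme \<Rightarrow> ('k, 'm, 'u) module_scheme \<Rightarrow> bool"
  where "projective R M \<longleftrightarrow>
    (\<exists>X :: 'm set. \<exists>i \<in> linear_maps R M (free_module R X). \<exists>p \<in> linear_maps R (free_module R X) M.
       \<forall>m \<in> carrier M. p (i m) = m)"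


section \<open>Tensor products\<close>

text \<open>\<open>M \<otimes> N\<close> is the free module on \<open>carrier M \<times> carrier N\<close> modulo the submodule generated by
  the bilinearity relations, so an element of it is a coset of finitely supported functions.\<close>

type_synonym ('k, 'm, 'n) tensor = "('m \<times> 'n \<Rightarrow> 'k) set"

definition bilinear_relations ::
  "('k, 'z) ring_scheme \<Rightarrow> ('k, 'm, 'u) module_scheme \<Rightarrow> ('k, 'n, 'v) module_scheme \<Rightarrow> ('m \<times> 'n \<Rightarrow> 'k) set"
  where "bilinear_relations R M N =
    (let F = free_module R (carrier M \<times> carrier N); d = free_basis R in
      {d (m \<oplus>\<^bsub>M\<^esub> m', n) \<ominus>\<^bsub>F\<^esub> (d (m, n) \<oplus>\<^bsub>F\<^esub> d (m', n)) | m m' n.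
         m \<in> carrier M \<and> m' \<in> carrier M \<and> n \<in> carrier N} \<union>
      {d (m, n \<oplus>\<^bsub>N\<^esub> n') \<ominus>\<^bsub>F\<^esub> (d (m, n) \<oplus>\<^bsub>F\<^esub> d (m, n')) | m n n'.
         m \<in> carrier M \<and> n \<in> carrier N \<and> n' \<in> carrier N} \<union>
      {d (r \<odot>\<^bsub>M\<^esub> m, n) \<ominus>\<^bsub>F\<^esub> r \<odot>\<^bsub>F\<^esub> d (m, n) | r m n.
         r \<in> carrier R \<and> m \<in> carrier M \<and> n \<in> carrier N} \<union>
      {d (m, r \<odot>\<^bsub>N\<^esub> n) \<ominus>\<^bsub>F\<^esub> r \<odot>\<^bsub>F\<^esub> d (m, n) | r m n.
         r \<in> carrier R \<and> m \<in> carrier M \<and> n \<in> carrier N})"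

definition tensor_kernel ::
  "('k, 'z) ring_scheme \<Rightarrow> ('k, 'm, 'u) module_scheme \<Rightarrow> ('k, 'n, 'v) module_scheme \<Rightarrow> ('m \<times> 'n \<Rightarrow> 'k) set"
  where "tensor_kernel R M N =
    \<Inter> {K. submodule K R (free_module R (carrier M \<times> carrier N)) \<and> bilinear_relations R M N \<subseteq> K}"

definition tensor_module ::
  "('k, 'z) ring_scheme \<Rightarrow> ('k, 'm, 'u) module_scheme \<Rightarrow> ('k, 'n, 'v) module_scheme
     \<Rightarrow> ('k, ('k, 'm, 'n) tensor) module"
  where "tensor_module R M N =
    quotient_module (free_module R (carrier M \<times> carrier N)) (tensor_kernel R M N)"

definition pure_tensor ::
  "('k, 'z) ring_scheme \<Rightarrow> ('k, 'm, 'u) module_scheme \<Rightarrow> ('k, 'n, 'v) module_scheme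
     \<Rightarrow> 'm \<Rightarrow> 'n \<Rightarrow> ('k, 'm, 'n) tensor"
  where "pure_tensor R M N m n =
    tensor_kernel R M N +>\<^bsub>free_module R (carrier M \<times> carrier N)\<^esub> free_basis R (m, n)"

text \<open>For a bilinear map \<open>b\<close> from \<open>M\<close> and \<open>N\<close> to \<open>P\<close>, \<open>tensor_lift R P b\<close> is the induced linear map
  \<open>M \<otimes> N \<rightarrow> P\<close>, computed on a representative of the coset (the value does not depend on
  the representative). It also serves to express Sweedler notation: \<open>b(h\<^sub>(\<^sub>1\<^sub>), h\<^sub>(\<^sub>2\<^sub>))\<close> is
  \<open>tensor_lift R P b (\<Delta> h)\<close>, i.e. the sum of \<open>b x y\<close> over the pure tensors making up \<open>\<Delta> h\<close>.\<close>

definition tensor_lift ::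
  "('k, 'z) ring_scheme \<Rightarrow> ('k, 'p, 'u) module_scheme \<Rightarrow> ('m \<Rightarrow> 'n \<Rightarrow> 'p) \<Rightarrow> ('k, 'm, 'n) tensor \<Rightarrow> 'p"
  where "tensor_lift R P b X =
    (let x = (SOME x. x \<in> X) in
      (\<Oplus>\<^bsub>P\<^esub>p\<in>{p. x p \<noteq> \<zero>\<^bsub>R\<^esub>}. x p \<odot>\<^bsub>P\<^esub> b (fst p) (snd p)))"

definition tensor_map ::
  "('k, 'z) ring_scheme \<Rightarrow> ('k, 'm2, 'u) module_scheme \<Rightarrow> ('k, 'n2, 'v) module_scheme
     \<Rightarrow> ('m \<Rightarrow> 'm2) \<Rightarrow> ('n \<Rightarrow> 'n2) \<Rightarrow> ('k, 'm, 'n) tensor \<Rightarrow> ('k, 'm2, 'n2) tensor"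
  where "tensor_map R M' N' f g =
    tensor_lift R (tensor_module R M' N') (\<lambda>m n. pure_tensor R M' N' (f m) (g n))"

text \<open>The componentwise action \<open>(a \<otimes> b)(m \<otimes> n) = am \<otimes> bn\<close> of an element of \<open>H \<otimes> H\<close> on
  \<open>M \<otimes> N\<close>, for actions \<open>\<alpha>\<close>, \<open>\<beta>\<close> of \<open>H\<close> on \<open>M\<close>, \<open>N\<close>.\<close>

definition tensor_act ::
  "('k, 'z) ring_scheme \<Rightarrow> ('k, 'm, 'u) module_scheme \<Rightarrow> ('k, 'n, 'v) module_scheme
     \<Rightarrow> ('h \<Rightarrow> 'm \<Rightarrow> 'm) \<Rightarrow> ('h \<Rightarrow> 'n \<Rightarrow> 'n)
     \<Rightarrow> ('k, 'h, 'h) tensor \<Rightarrow> ('k, 'm, 'n) tensor \<Rightarrow> ('k, 'm, 'n) tensor"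
  where "tensor_act R M N \<alpha> \<beta> X Y =
    tensor_lift R (tensor_module R M N) (\<lambda>a b. tensor_map R M N (\<alpha> a) (\<beta> b) Y) X"


section \<open>Weak bialgebras and weak Hopf algebras\<close>

record ('k, 'h) weak_bialg = "('k, 'h) module" +
  comult :: "'h \<Rightarrow> ('k, 'h, 'h) tensor"
  counit :: "'h \<Rightarrow> 'k"

record ('k, 'h) weak_hopf = "('k, 'h) weak_bialg" +
  antipode :: "'h \<Rightarrow> 'h"

text \<open>The library's locale \<open>algebra\<close> is restricted to commutative algebras. Iterated tensor
  products are bracketed to the left, \<open>(H \<otimes> H) \<otimes> H\<close>.\<close>

locale weak_bialgebra = module R H + H?: ring H
  for R :: "('k, 'z) ring_scheme" and H :: "('k, 'h, 'y) weak_bialg_scheme" +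
  assumes smult_mult_left: "\<lbrakk>r \<in> carrier R; g \<in> carrier H; h \<in> carrier H\<rbrakk>
      \<Longrightarrow> (r \<odot>\<^bsub>H\<^esub> g) \<otimes>\<^bsub>H\<^esub> h = r \<odot>\<^bsub>H\<^esub> (g \<otimes>\<^bsub>H\<^esub> h)"
    and smult_mult_right: "\<lbrakk>r \<in> carrier R; g \<in> carrier H; h \<in> carrier H\<rbrakk>
      \<Longrightarrow> g \<otimes>\<^bsub>H\<^esub> (r \<odot>\<^bsub>H\<^esub> h) = r \<odot>\<^bsub>H\<^esub> (g \<otimes>\<^bsub>H\<^esub> h)"
    and comult_linear: "comult H \<in> linear_maps R H (tensor_module R H H)"
    and counit_linear: "counit H \<in> linear_maps R H (regular_module R)"
    and coassoc: "h \<in> carrier H \<Longrightarrow>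
      tensor_lift R (tensor_module R (tensor_module R H H) H)
        (\<lambda>a b. pure_tensor R (tensor_module R H H) H (comult H a) b) (comult H h) =
      tensor_lift R (tensor_module R (tensor_module R H H) H)
        (\<lambda>a b. tensor_lift R (tensor_module R (tensor_module R H H) H)
          (\<lambda>c d. pure_tensor R (tensor_module R H H) H (pure_tensor R H H a c) d) (comult H b))
        (comult H h)"
    and counit_left: "h \<in> carrier H \<Longrightarrow>
      tensor_lift R H (\<lambda>a b. counit H a \<odot>\<^bsub>H\<^esub> b) (comult H h) = h"
    and counit_right: "h \<in> carrier H \<Longrightarrow>
      tensor_lift R H (\<lambda>a b. counit H b \<odot>\<^bsub>H\<^esub> a) (comult H h) = h"
    and comult_mult: "\<lbrakk>g \<in> carrier H; h \<in> carrier H\<rbrakk> \<Longrightarrow>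
      comult H (g \<otimes>\<^bsub>H\<^esub> h) =
      tensor_act R H H (monoid.mult H) (monoid.mult H) (comult H g) (comult H h)"
    and comult_one_left:
      "tensor_lift R (tensor_module R (tensor_module R H H) H)
        (\<lambda>a b. pure_tensor R (tensor_module R H H) H (comult H a) b) (comult H \<one>\<^bsub>H\<^esub>) =
       tensor_lift R (tensor_module R (tensor_module R H H) H)
        (\<lambda>a b. tensor_lift R (tensor_module R (tensor_module R H H) H)
          (\<lambda>c d. pure_tensor R (tensor_module R H H) H (pure_tensor R H H a (b \<otimes>\<^bsub>H\<^esub> c)) d)
          (comult H \<one>\<^bsub>H\<^esub>)) (comult H \<one>\<^bsub>H\<^esub>)"
    and comult_one_right:
      "tensor_lift R (tensor_module R (tensor_module R H H) H)
        (\<lambda>a b. pure_tensor R (tensor_module R H H) H (comult H a) b) (comult H \<one>\<^bsub>H\<^esub>) =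
       tensor_lift R (tensor_module R (tensor_module R H H) H)
        (\<lambda>a b. tensor_lift R (tensor_module R (tensor_module R H H) H)
          (\<lambda>c d. pure_tensor R (tensor_module R H H) H (pure_tensor R H H a (c \<otimes>\<^bsub>H\<^esub> b)) d)
          (comult H \<one>\<^bsub>H\<^esub>)) (comult H \<one>\<^bsub>H\<^esub>)"
    and counit_mult: "\<lbrakk>g \<in> carrier H; h \<in> carrier H; l \<in> carrier H\<rbrakk> \<Longrightarrow>
      counit H (g \<otimes>\<^bsub>H\<^esub> h \<otimes>\<^bsub>H\<^esub> l) =
      tensor_lift R (regular_module R)
        (\<lambda>a b. counit H (g \<otimes>\<^bsub>H\<^esub> a) \<otimes>\<^bsub>R\<^esub> counit H (b \<otimes>\<^bsub>H\<^esub> l)) (comult H h)"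
    and counit_mult_op: "\<lbrakk>g \<in> carrier H; h \<in> carrier H; l \<in> carrier H\<rbrakk> \<Longrightarrow>
      counit H (g \<otimes>\<^bsub>H\<^esub> h \<otimes>\<^bsub>H\<^esub> l) =
      tensor_lift R (regular_module R)
        (\<lambda>a b. counit H (g \<otimes>\<^bsub>H\<^esub> b) \<otimes>\<^bsub>R\<^esub> counit H (a \<otimes>\<^bsub>H\<^esub> l)) (comult H h)"

definition eps_t :: "('k, 'z) ring_scheme \<Rightarrow> ('k, 'h, 'y) weak_bialg_scheme \<Rightarrow> 'h \<Rightarrow> 'h"
  where "eps_t R H h =
    tensor_lift R H (\<lambda>a b. counit H (a \<otimes>\<^bsub>H\<^esub> h) \<odot>\<^bsub>H\<^esub> b) (comult H \<one>\<^bsub>H\<^esub>)"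

definition eps_s :: "('k, 'z) ring_scheme \<Rightarrow> ('k, 'h, 'y) weak_bialg_scheme \<Rightarrow> 'h \<Rightarrow> 'h"
  where "eps_s R H h =
    tensor_lift R H (\<lambda>a b. counit H (h \<otimes>\<^bsub>H\<^esub> b) \<odot>\<^bsub>H\<^esub> a) (comult H \<one>\<^bsub>H\<^esub>)"

definition eps_s_bar :: "('k, 'z) ring_scheme \<Rightarrow> ('k, 'h, 'y) weak_bialg_scheme \<Rightarrow> 'h \<Rightarrow> 'h"
  where "eps_s_bar R H h =
    tensor_lift R H (\<lambda>a b. counit H (b \<otimes>\<^bsub>H\<^esub> h) \<odot>\<^bsub>H\<^esub> a) (comult H \<one>\<^bsub>H\<^esub>)"

locale weak_hopf_algebra = weak_bialgebra R H
  for R :: "('k, 'z) ring_scheme" and H :: "('k, 'h, 'y) weak_hopf_scheme" +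
  assumes antipode_linear: "antipode H \<in> linear_maps R H H"
    and antipode_left: "h \<in> carrier H \<Longrightarrow>
      tensor_lift R H (\<lambda>a b. antipode H a \<otimes>\<^bsub>H\<^esub> b) (comult H h) = eps_s R H h"
    and antipode_right: "h \<in> carrier H \<Longrightarrow>
      tensor_lift R H (\<lambda>a b. a \<otimes>\<^bsub>H\<^esub> antipode H b) (comult H h) = eps_t R H h"
    and antipode_antipode: "h \<in> carrier H \<Longrightarrow>
      tensor_lift R H
        (\<lambda>a b. tensor_lift R H (\<lambda>c d. antipode H c \<otimes>\<^bsub>H\<^esub> d \<otimes>\<^bsub>H\<^esub> antipode H b) (comult H a))
        (comult H h) = antipode H h"


section \<open>Left-left Yetter-Drinfeld modules\<close>

record ('k, 'h, 'm) yd_mod = "('k, 'm) module" +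
  act :: "'h \<Rightarrow> 'm \<Rightarrow> 'm"
  coact :: "'m \<Rightarrow> ('k, 'h, 'm) tensor"

text \<open>\<open>M \<otimes>\<^sub>t N = \<Delta>(1)(M \<otimes> N)\<close>, a submodule of \<open>M \<otimes> N\<close>, for \<open>H\<close>-actions \<open>\<alpha>\<close> on \<open>M\<close>, \<open>\<beta>\<close> on \<open>N\<close>.\<close>

definition tensor_t ::
  "('k, 'z) ring_scheme \<Rightarrow> ('k, 'h, 'y) weak_bialg_scheme
     \<Rightarrow> ('k, 'm, 'u) module_scheme \<Rightarrow> ('k, 'n, 'v) module_scheme
     \<Rightarrow> ('h \<Rightarrow> 'm \<Rightarrow> 'm) \<Rightarrow> ('h \<Rightarrow> 'n \<Rightarrow> 'n) \<Rightarrow> ('k, ('k, 'm, 'n) tensor) module"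
  where "tensor_t R H M N \<alpha> \<beta> =
    (tensor_module R M N)
      \<lparr>carrier := tensor_act R M N \<alpha> \<beta> (comult H \<one>\<^bsub>H\<^esub>) ` carrier (tensor_module R M N)\<rparr>"

locale left_hmodule = H?: weak_bialgebra R H + M?: module R M
  for R :: "('k, 'z) ring_scheme" and H :: "('k, 'h, 'y) weak_bialg_scheme"
    and M :: "('k, 'h, 'm, 'u) yd_mod_scheme" +
  assumes act_linear_left: "m \<in> carrier M \<Longrightarrow> (\<lambda>h. act M h m) \<in> linear_maps R H M"
    and act_linear_right: "h \<in> carrier H \<Longrightarrow> act M h \<in> linear_maps R M M"
    and act_mult: "\<lbrakk>g \<in> carrier H; h \<in> carrier H; m \<in> carrier M\<rbrakk>
      \<Longrightarrow> act M (g \<otimes>\<^bsub>H\<^esub> h) m = act M g (act M h m)"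
    and act_one: "m \<in> carrier M \<Longrightarrow> act M \<one>\<^bsub>H\<^esub> m = m"

text \<open>Coassociativity is stated in \<open>(H \<otimes> H) \<otimes> M\<close>.\<close>

locale yetter_drinfeld = left_hmodule R H M
  for R :: "('k, 'z) ring_scheme" and H :: "('k, 'h, 'y) weak_bialg_scheme"
    and M :: "('k, 'h, 'm, 'u) yd_mod_scheme" +
  assumes coact_linear: "coact M \<in> linear_maps R M (tensor_module R H M)"
    and coact_coassoc: "m \<in> carrier M \<Longrightarrow>
      tensor_lift R (tensor_module R (tensor_module R H H) M)
        (\<lambda>a x. pure_tensor R (tensor_module R H H) M (comult H a) x) (coact M m) =
      tensor_lift R (tensor_module R (tensor_module R H H) M)
        (\<lambda>a x. tensor_lift R (tensor_module R (tensor_module R H H) M)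
          (\<lambda>b y. pure_tensor R (tensor_module R H H) M (pure_tensor R H H a b) y) (coact M x))
        (coact M m)"
    and coact_counit: "m \<in> carrier M \<Longrightarrow>
      tensor_lift R M (\<lambda>a x. counit H a \<odot>\<^bsub>M\<^esub> x) (coact M m) = m"
    and coact_in_tensor_t: "m \<in> carrier M \<Longrightarrow>
      coact M m \<in> carrier (tensor_t R H H M (monoid.mult H) (act M))"
    and compatibility: "\<lbrakk>h \<in> carrier H; m \<in> carrier M\<rbrakk> \<Longrightarrow>
      tensor_act R H M (monoid.mult H) (act M) (comult H h) (coact M m) =
      tensor_lift R (tensor_module R H M)
        (\<lambda>a b. tensor_lift R (tensor_module R H M)
          (\<lambda>c x. pure_tensor R H M (c \<otimes>\<^bsub>H\<^esub> b) x) (coact M (act M a m)))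
        (comult H h)"

definition fgp_yetter_drinfeld ::
  "('k, 'z) ring_scheme \<Rightarrow> ('k, 'h, 'y) weak_bialg_scheme \<Rightarrow> ('k, 'h, 'm) yd_mod \<Rightarrow> bool"
  where "fgp_yetter_drinfeld R H M \<longleftrightarrow>
    yetter_drinfeld R H M \<and> finitely_generated R M \<and> projective R M"

definition yd_morphisms ::
  "('k, 'z) ring_scheme \<Rightarrow> ('k, 'h, 'y) weak_bialg_scheme
     \<Rightarrow> ('k, 'h, 'm) yd_mod \<Rightarrow> ('k, 'h, 'n) yd_mod \<Rightarrow> ('m \<Rightarrow> 'n) set"
  where "yd_morphisms R H M N =
    {f \<in> linear_maps R M N.
       (\<forall>h \<in> carrier H. \<forall>m \<in> carrier M. f (act M h m) = act N h (f m)) \<and>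
       (\<forall>m \<in> carrier M. coact N (f m) = tensor_map R H N (\<lambda>h. h) f (coact M m))}"


section \<open>The monoidal structure\<close>

text \<open>Multiplication by \<open>\<Delta>(1)\<close> is the projection of \<open>M \<otimes> N\<close> onto its direct summand \<open>M \<otimes>\<^sub>t N\<close>.
  Tensor products are taken of modules with given carriers, so whenever an element of \<open>M \<otimes> N\<close>
  known to lie in \<open>M \<otimes>\<^sub>t N\<close> has to be used inside a further tensor product with \<open>M \<otimes>\<^sub>t N\<close> as a
  factor, the projection is applied to its pure tensors.\<close>

definition project_t ::
  "('k, 'z) ring_scheme \<Rightarrow> ('k, 'h, 'y) weak_bialg_scheme
     \<Rightarrow> ('k, 'h, 'm) yd_mod \<Rightarrow> ('k, 'h, 'n) yd_mod \<Rightarrow> ('k, 'm, 'n) tensor \<Rightarrow> ('k, 'm, 'n) tensor"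
  where "project_t R H M N = tensor_act R M N (act M) (act N) (comult H \<one>\<^bsub>H\<^esub>)"

text \<open>The map \<open>m \<otimes> n \<mapsto> m\<^sub>[\<^sub>-\<^sub>1\<^sub>]n\<^sub>[\<^sub>-\<^sub>1\<^sub>] \<otimes> m\<^sub>[\<^sub>0\<^sub>] \<otimes> n\<^sub>[\<^sub>0\<^sub>]\<close> on \<open>M \<otimes> N\<close> takes the same value
  on \<open>1\<^sub>(\<^sub>1\<^sub>)m \<otimes> 1\<^sub>(\<^sub>2\<^sub>)n\<close> as on \<open>m \<otimes> n\<close>; its restriction to \<open>M \<otimes>\<^sub>t N\<close> is the coaction.
  The unit constraints below are restrictions of maps on the full tensor product in the same way.\<close>

definition yd_tensor ::
  "('k, 'z) ring_scheme \<Rightarrow> ('k, 'h, 'y) weak_bialg_scheme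
     \<Rightarrow> ('k, 'h, 'm) yd_mod \<Rightarrow> ('k, 'h, 'n) yd_mod \<Rightarrow> ('k, 'h, ('k, 'm, 'n) tensor) yd_mod"
  where "yd_tensor R H M N =
    (let T = tensor_t R H M N (act M) (act N) in
      \<lparr>carrier = carrier T, monoid.mult = monoid.mult T, one = one T,
       zero = zero T, add = add T, smult = smult T,
       act = (\<lambda>h. tensor_act R M N (act M) (act N) (comult H h)),
       coact = tensor_lift R (tensor_module R H T)
         (\<lambda>m n. tensor_lift R (tensor_module R H T)
           (\<lambda>a x. tensor_lift R (tensor_module R H T)
             (\<lambda>b y. pure_tensor R H T (a \<otimes>\<^bsub>H\<^esub> b) (project_t R H M N (pure_tensor R M N x y)))
             (coact N n))
           (coact M m))\<rparr>)"

text \<open>The unit object \<open>H\<^sub>t\<close>. Its coaction is the restriction of \<open>\<Delta>\<close>; since \<open>\<Delta>(H\<^sub>t) \<subseteq> H \<otimes> H\<^sub>t\<close> and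
  \<open>\<epsilon>\<^sub>t\<close> is a projection of \<open>H\<close> onto \<open>H\<^sub>t\<close>, applying \<open>\<epsilon>\<^sub>t\<close> to the second factor only moves the value
  from \<open>H \<otimes> H\<close> to \<open>H \<otimes> H\<^sub>t\<close>.\<close>

definition unit_module ::
  "('k, 'z) ring_scheme \<Rightarrow> ('k, 'h, 'y) weak_bialg_scheme \<Rightarrow> ('k, 'h) module"
  where "unit_module R H =
    \<lparr>carrier = eps_t R H ` carrier H, monoid.mult = monoid.mult H, one = one H,
     zero = zero H, add = add H, smult = smult H\<rparr>"

definition yd_unit ::
  "('k, 'z) ring_scheme \<Rightarrow> ('k, 'h, 'y) weak_bialg_scheme \<Rightarrow> ('k, 'h, 'h) yd_mod"
  where "yd_unit R H =
    \<lparr>carrier = eps_t R H ` carrier H, monoid.mult = monoid.mult H, one = one H,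
     zero = zero H, add = add H, smult = smult H,
     act = (\<lambda>h z. eps_t R H (h \<otimes>\<^bsub>H\<^esub> z)),
     coact = (\<lambda>z. tensor_map R H (unit_module R H) (\<lambda>h. h) (eps_t R H) (comult H z))\<rparr>"

text \<open>\<open>(m \<otimes> n) \<otimes> p \<mapsto> m \<otimes> (n \<otimes> p)\<close>, from \<open>(M \<otimes>\<^sub>t N) \<otimes>\<^sub>t P\<close> to \<open>M \<otimes>\<^sub>t (N \<otimes>\<^sub>t P)\<close>, and its inverse.\<close>

definition yd_assoc ::
  "('k, 'z) ring_scheme \<Rightarrow> ('k, 'h, 'y) weak_bialg_scheme
     \<Rightarrow> ('k, 'h, 'm) yd_mod \<Rightarrow> ('k, 'h, 'n) yd_mod \<Rightarrow> ('k, 'h, 'p) yd_mod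
     \<Rightarrow> ('k, ('k, 'm, 'n) tensor, 'p) tensor \<Rightarrow> ('k, 'm, ('k, 'n, 'p) tensor) tensor"
  where "yd_assoc R H M N P =
    (let NP = yd_tensor R H N P in
      tensor_lift R (tensor_module R M NP)
        (\<lambda>x p. tensor_lift R (tensor_module R M NP)
          (\<lambda>m n. pure_tensor R M NP m (project_t R H N P (pure_tensor R N P n p))) x))"

definition yd_assoc_inv ::
  "('k, 'z) ring_scheme \<Rightarrow> ('k, 'h, 'y) weak_bialg_scheme
     \<Rightarrow> ('k, 'h, 'm) yd_mod \<Rightarrow> ('k, 'h, 'n) yd_mod \<Rightarrow> ('k, 'h, 'p) yd_mod
     \<Rightarrow> ('k, 'm, ('k, 'n, 'p) tensor) tensor \<Rightarrow> ('k, ('k, 'm, 'n) tensor, 'p) tensor"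
  where "yd_assoc_inv R H M N P =
    (let MN = yd_tensor R H M N in
      tensor_lift R (tensor_module R MN P)
        (\<lambda>m y. tensor_lift R (tensor_module R MN P)
          (\<lambda>n p. pure_tensor R MN P (project_t R H M N (pure_tensor R M N m n)) p) y))"

definition yd_unit_left ::
  "('k, 'z) ring_scheme \<Rightarrow> ('k, 'h, 'm) yd_mod \<Rightarrow> ('k, 'h, 'm) tensor \<Rightarrow> 'm"
  where "yd_unit_left R M = tensor_lift R M (\<lambda>z m. act M z m)"

definition yd_unit_right ::
  "('k, 'z) ring_scheme \<Rightarrow> ('k, 'h, 'y) weak_bialg_scheme
     \<Rightarrow> ('k, 'h, 'm) yd_mod \<Rightarrow> ('k, 'm, 'h) tensor \<Rightarrow> 'm"
  where "yd_unit_right R H M = tensor_lift R M (\<lambda>m z. act M (eps_s_bar R H z) m)"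


section \<open>Left duals\<close>

text \<open>\<open>D\<close> is a left dual of \<open>M\<close>. The two triangle identities, with the constraints written out and
  the inverse unit constraints moved to the other side, are equalities of maps
  \<open>H\<^sub>t \<otimes>\<^sub>t M \<rightarrow> M\<close> and \<open>D \<otimes>\<^sub>t H\<^sub>t \<rightarrow> D\<close>.\<close>

definition is_left_dual ::
  "('k, 'z) ring_scheme \<Rightarrow> ('k, 'h, 'y) weak_bialg_scheme
     \<Rightarrow> ('k, 'h, 'm) yd_mod \<Rightarrow> ('k, 'h, 'd) yd_mod \<Rightarrow> bool"
  where "is_left_dual R H M D \<longleftrightarrow>
    (let I = yd_unit R H; DM = yd_tensor R H D M; MD = yd_tensor R H M D in
      \<exists>ev \<in> yd_morphisms R H DM I. \<exists>coev \<in> yd_morphisms R H I MD.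
        (\<forall>x \<in> carrier (yd_tensor R H I M).
           yd_unit_right R H M (tensor_map R M I (\<lambda>m. m) ev
             (yd_assoc R H M D M (tensor_map R MD M coev (\<lambda>m. m) x))) = yd_unit_left R M x) \<and>
        (\<forall>x \<in> carrier (yd_tensor R H D I).
           yd_unit_left R D (tensor_map R I D ev (\<lambda>d. d)
             (yd_assoc_inv R H D M D (tensor_map R D MD (\<lambda>d. d) coev x))) = yd_unit_right R H D x))"

end

theory Submission
  imports Defs
begin

text \<open>
  The dual of \<open>M\<close> is \<open>M\<^sup>* = Hom(M, R)\<close> with \<open>(h\<phi>)(m) = \<phi>(S(h)m)\<close> and the coaction determined by
  \<open>\<phi>\<^sub>[\<^sub>-\<^sub>1\<^sub>] \<phi>\<^sub>[\<^sub>0\<^sub>](m) = S\<inverse>(m\<^sub>[\<^sub>-\<^sub>1\<^sub>]) \<phi>(m\<^sub>[\<^sub>0\<^sub>])\<close>; it exists because \<open>M\<close> has a finite dual basis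
  \<open>n\<^sub>i, n\<^sup>i\<close>, which also identifies \<open>N \<otimes> M\<^sup>*\<close> with \<open>Hom(M, N)\<close>, so that identities in \<open>N \<otimes> M\<^sup>*\<close> can be
  checked by evaluation at the elements of \<open>M\<close>. Since \<open>S\<close> reverses products and coproducts, the
  Yetter-Drinfeld condition for \<open>M\<^sup>*\<close> and \<open>h\<close> is the one for \<open>M\<close> and \<open>S(h)\<close>.
  Evaluation is \<open>\<phi> \<otimes> m \<mapsto> \<phi>(1\<^sub>(\<^sub>1\<^sub>)m)1\<^sub>(\<^sub>2\<^sub>)\<close>, and coevaluation sends \<open>z\<close> to \<open>\<Sum> zn\<^sub>i \<otimes> n\<^sup>i\<close>, the element that
  corresponds to the endomorphism \<open>x \<mapsto> zx\<close>. Both are morphisms by the commutation of \<open>H\<^sub>t\<close> and \<open>H\<^sub>s\<close>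
  and by \<open>S(1\<^sub>(\<^sub>2\<^sub>)) \<otimes> S(1\<^sub>(\<^sub>1\<^sub>)) = 1\<^sub>(\<^sub>1\<^sub>) \<otimes> 1\<^sub>(\<^sub>2\<^sub>)\<close>; the triangle identities reduce to
  \<open>e(1\<^sub>(\<^sub>2\<^sub>))1\<^sub>(\<^sub>1\<^sub>) = 1\<close> for the map \<open>e\<close> called \<open>eps_s_bar\<close>, and to \<open>1\<^sub>(\<^sub>1\<^sub>)S(1\<^sub>(\<^sub>2\<^sub>)) = 1\<close>.
\<close>

section \<open>Linear and bilinear maps\<close>

text \<open>Tensors are cosets of formal sums, so a Sweedler expression is read as the value of a
  linear map on a tensor, and its manipulation rests on multilinearity of everything inside. Two
  features of the weak setting shape the computations. A single term of \<Delta>(1) need not have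
  its legs in H_s and H_t, only the whole sum lies in H_s \<otimes> H_t. So \<open>es\<close> or
  \<open>et\<close> is inserted on a leg, a rule for elements of H_s or H_t is applied term by term,
  and the projection is removed again. In the same way a single pure tensor need not lie in the
  truncated product. So evaluation, coevaluation and the triangle composites are studied on full
  tensor products, where pure tensors suffice, and are restricted afterwards. The inverse antipode
  \<open>T\<close> in the coaction of the dual has two origins. In the Yetter-Drinfeld condition
  \<open>T\<close> must undo the \<open>S\<close> of the dual action, as in T(S(b)c) = T(c)b. In the
  colinearity of evaluation the product T(k2)k1 of the components of one coproduct appears, and it
  collapses to \<open>T (es k)\<close>.\<close>

definition lin :: "('k, 'z) ring_scheme \<Rightarrow> ('k, 'm, 'u) module_scheme \<Rightarrow> ('k, 'n, 'v) module_scheme \<Rightarrow> ('m \<Rightarrow> 'n) \<Rightarrow> bool"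
  where "lin R M N f \<longleftrightarrow> f \<in> linear_maps R M N"

lemma linI:
  assumes "\<And>x. x \<in> carrier M \<Longrightarrow> f x \<in> carrier N"
    and "\<And>x y. x \<in> carrier M \<Longrightarrow> y \<in> carrier M \<Longrightarrow> f (x \<oplus>\<^bsub>M\<^esub> y) = f x \<oplus>\<^bsub>N\<^esub> f y"
    and "\<And>r x. r \<in> carrier R \<Longrightarrow> x \<in> carrier M \<Longrightarrow> f (r \<odot>\<^bsub>M\<^esub> x) = r \<odot>\<^bsub>N\<^esub> f x"
  shows "lin R M N f"
  using assms by (auto simp: lin_def linear_maps_def)

lemma lin_closed: "lin R M N f \<Longrightarrow> x \<in> carrier M \<Longrightarrow> f x \<in> carrier N"
  and lin_add: "lin R M N f \<Longrightarrow> x \<in> carrier M \<Longrightarrow> y \<in> carrier M \<Longrightarrow> f (x \<oplus>\<^bsub>M\<^esub> y) = f x \<oplus>\<^bsub>N\<^esub> f y"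
  and lin_smult: "lin R M N f \<Longrightarrow> r \<in> carrier R \<Longrightarrow> x \<in> carrier M \<Longrightarrow> f (r \<odot>\<^bsub>M\<^esub> x) = r \<odot>\<^bsub>N\<^esub> f x"
  by (auto simp: lin_def linear_maps_def)

lemma lin_cong:
  assumes "module R M" "\<And>x. x \<in> carrier M \<Longrightarrow> f x = g x" "lin R M N g"
  shows "lin R M N f"
proof -
  interpret M: module R M by fact
  show ?thesis by (rule linI) (simp_all add: assms(2) lin_closed[OF assms(3)] lin_add[OF assms(3)] lin_smult[OF assms(3)])
qed

lemma lin_zero:
  assumes "module R M" "module R N" "lin R M N f" shows "f \<zero>\<^bsub>M\<^esub> = \<zero>\<^bsub>N\<^esub>"
proof -
  interpret M: module R M by fact
  interpret N: module R N by fact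
  have "f (\<zero>\<^bsub>R\<^esub> \<odot>\<^bsub>M\<^esub> \<zero>\<^bsub>M\<^esub>) = \<zero>\<^bsub>R\<^esub> \<odot>\<^bsub>N\<^esub> f \<zero>\<^bsub>M\<^esub>"
    by (rule lin_smult[OF assms(3)]) auto
  then show ?thesis using lin_closed[OF assms(3)] by simp
qed

lemma lin_minus:
  assumes "module R M" "module R N" "lin R M N f" "x \<in> carrier M" "y \<in> carrier M"
  shows "f (x \<ominus>\<^bsub>M\<^esub> y) = f x \<ominus>\<^bsub>N\<^esub> f y"
proof -
  interpret M: module R M by fact
  interpret N: module R N by fact
  have e: "\<ominus>\<^bsub>M\<^esub> y = (\<ominus>\<^bsub>R\<^esub> \<one>\<^bsub>R\<^esub>) \<odot>\<^bsub>M\<^esub> y" using assms by (simp add: M.smult_l_minus)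
  have "f (\<ominus>\<^bsub>M\<^esub> y) = \<ominus>\<^bsub>N\<^esub> f y"
    unfolding e using assms lin_closed[OF assms(3)] by (subst lin_smult[OF assms(3)]) (auto simp: N.smult_l_minus)
  then show ?thesis using assms lin_closed[OF assms(3)]
    by (simp add: a_minus_def lin_add)
qed

lemma lin_finsum:
  assumes "module R M" "module R N" "lin R M N f" "finite A" "g \<in> A \<rightarrow> carrier M"
  shows "f (finsum M g A) = finsum N (\<lambda>x. f (g x)) A"
proof -
  interpret M: module R M by fact
  interpret N: module R N by fact
  show ?thesis using assms(4,5)
  proof (induction A)
    case empty then show ?case using lin_zero[OF assms(1-3)] by simp
  next
    case (insert a A)
    then have "g \<in> A \<rightarrow> carrier M" "g a \<in> carrier M" by auto
    moreover have "(\<lambda>x. f (g x)) \<in> A \<rightarrow> carrier N" using calculation lin_closed[OF assms(3)] by (auto simp: Pi_iff)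
    ultimately show ?case using insert lin_closed[OF assms(3)] by (simp add: lin_add[OF assms(3)])
  qed
qed

definition bil where "bil R M N P f \<longleftrightarrow>
   (\<forall>y\<in>carrier N. lin R M P (\<lambda>x. f x y)) \<and> (\<forall>x\<in>carrier M. lin R N P (\<lambda>y. f x y))"

lemma bilI:
  "(\<And>y. y \<in> carrier N \<Longrightarrow> lin R M P (\<lambda>x. f x y)) \<Longrightarrow> (\<And>x. x \<in> carrier M \<Longrightarrow> lin R N P (\<lambda>y. f x y)) \<Longrightarrow> bil R M N P f"
  by (auto simp: bil_def)

lemma bil_lin1: "bil R M N P f \<Longrightarrow> y \<in> carrier N \<Longrightarrow> lin R M P (\<lambda>x. f x y)"
  and bil_lin2: "bil R M N P f \<Longrightarrow> x \<in> carrier M \<Longrightarrow> lin R N P (\<lambda>y. f x y)"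
  and bil_closed: "bil R M N P f \<Longrightarrow> x \<in> carrier M \<Longrightarrow> y \<in> carrier N \<Longrightarrow> f x y \<in> carrier P"
  by (auto simp: bil_def intro: lin_closed)

section \<open>Free modules and quotients\<close>

lemma regular_module_simps [simp]:
  "carrier (regular_module R) = carrier R" "zero (regular_module R) = zero R"
  "add (regular_module R) = add R" "smult (regular_module R) = monoid.mult R"
  by (simp_all add: regular_module_def)

lemma regular_module_module:
  assumes "cring R" shows "module R (regular_module R)"
proof -
  interpret cring R by fact
  show ?thesis
  proof (intro moduleI abelian_groupI)
    fix x assume "x \<in> carrier (regular_module R)"
    then show "\<exists>y\<in>carrier (regular_module R). y \<oplus>\<^bsub>regular_module R\<^esub> x = \<zero>\<^bsub>regular_module R\<^esub>"
      by (intro bexI[of _ "\<ominus>\<^bsub>R\<^esub> x"]) (simp_all add: l_neg)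
  qed (simp_all add: l_distr r_distr m_assoc a_ac assms)
qed

lemma finsum_regular [simp]: "finsum (regular_module R) f A = finsum R f A"
  by (simp add: finsum_def finprod_def regular_module_def)

lemma free_module_simps [simp]:
  "zero (free_module R X) = (\<lambda>x. \<zero>\<^bsub>R\<^esub>)" "add (free_module R X) = (\<lambda>f g x. f x \<oplus>\<^bsub>R\<^esub> g x)"
  "smult (free_module R X) = (\<lambda>r f x. r \<otimes>\<^bsub>R\<^esub> f x)"
  by (simp_all add: free_module_def)

lemma free_module_carrier:
  "f \<in> carrier (free_module R X) \<longleftrightarrow> (\<forall>x. f x \<in> carrier R) \<and> finite {x. f x \<noteq> \<zero>\<^bsub>R\<^esub>} \<and> {x. f x \<noteq> \<zero>\<^bsub>R\<^esub>} \<subseteq> X"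
  by (auto simp: free_module_def)

lemma free_module_module:
  assumes "cring R" shows "module R (free_module R X)"
proof -
  interpret cring R by fact
  have fin: "finite {x. f x \<oplus>\<^bsub>R\<^esub> g x \<noteq> \<zero>\<^bsub>R\<^esub>}" if "finite {x. f x \<noteq> \<zero>\<^bsub>R\<^esub>}" "finite {x. g x \<noteq> \<zero>\<^bsub>R\<^esub>}" for f g :: "'d \<Rightarrow> 'a"
    by (rule finite_subset[OF _ finite_UnI[OF that]]) auto
  have supp: "p \<in> X" if "f p \<oplus>\<^bsub>R\<^esub> g p \<noteq> \<zero>\<^bsub>R\<^esub>" "{x. f x \<noteq> \<zero>\<^bsub>R\<^esub>} \<subseteq> X" "{x. g x \<noteq> \<zero>\<^bsub>R\<^esub>} \<subseteq> X" for f g p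
    using that by (cases "f p = \<zero>\<^bsub>R\<^esub>") auto
  have fin2: "finite {x. r \<otimes>\<^bsub>R\<^esub> g x \<noteq> \<zero>\<^bsub>R\<^esub>}" if "r \<in> carrier R" "finite {x. g x \<noteq> \<zero>\<^bsub>R\<^esub>}" for r and g :: "'d \<Rightarrow> 'a"
    using that(1) by (intro finite_subset[OF _ that(2)]) auto
  show ?thesis
  proof (intro moduleI abelian_groupI)
    fix x assume x: "x \<in> carrier (free_module R X)"
    show "\<exists>y\<in>carrier (free_module R X). y \<oplus>\<^bsub>free_module R X\<^esub> x = \<zero>\<^bsub>free_module R X\<^esub>"
      using x fin2[of "\<ominus>\<^bsub>R\<^esub> \<one>\<^bsub>R\<^esub>" x]
      by (intro bexI[of _ "\<lambda>z. \<ominus>\<^bsub>R\<^esub> \<one>\<^bsub>R\<^esub> \<otimes>\<^bsub>R\<^esub> x z"]) (auto simp: free_module_carrier l_minus l_neg)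
  qed (auto simp: free_module_carrier fin fin2 supp l_distr r_distr m_assoc a_ac assms fun_eq_iff)
qed

lemma free_basis_in: "cring R \<Longrightarrow> x \<in> X \<Longrightarrow> free_basis R x \<in> carrier (free_module R X)"
  by (auto simp: free_module_carrier free_basis_def cring_def ring.ring_simprules intro: finite_subset[of _ "{x}"])

lemma free_module_finsum_apply:
  assumes "cring R" "finite A" "g \<in> A \<rightarrow> carrier (free_module R X)"
  shows "finsum (free_module R X) g A y = finsum R (\<lambda>a. g a y) A"
proof -
  interpret cring R by fact
  interpret F: module R "free_module R X" by (rule free_module_module) fact
  show ?thesis using assms(2,3)
  proof (induction A)
    case (insert a A)
    then have "g \<in> A \<rightarrow> carrier (free_module R X)" "g a \<in> carrier (free_module R X)" by auto
    moreover have "(\<lambda>x. g x y) \<in> A \<rightarrow> carrier R" "g a y \<in> carrier R"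
      using calculation by (auto simp: Pi_iff free_module_carrier)
    ultimately show ?case using insert by simp
  qed simp
qed

text \<open>The index set may exceed the support, so that many elements can be expanded over one
  common finite set.\<close>

lemma free_module_expand:
  assumes "cring R" "x \<in> carrier (free_module R X)" "finite A" "{p. x p \<noteq> \<zero>\<^bsub>R\<^esub>} \<subseteq> A" "A \<subseteq> X"
  shows "x = (\<Oplus>\<^bsub>free_module R X\<^esub>p\<in>A. x p \<odot>\<^bsub>free_module R X\<^esub> free_basis R p)"
proof
  interpret cring R by fact
  interpret F: module R "free_module R X" by (rule free_module_module) fact
  fix y
  have xc: "x p \<in> carrier R" for p using assms(2) by (auto simp: free_module_carrier)
  have "(\<lambda>p. x p \<odot>\<^bsub>free_module R X\<^esub> free_basis R p) \<in> A \<rightarrow> carrier (free_module R X)"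
    using assms xc by (intro Pi_I F.smult_closed free_basis_in) auto
  from free_module_finsum_apply[OF assms(1,3) this, of y]
  have "(\<Oplus>\<^bsub>free_module R X\<^esub>p\<in>A. x p \<odot>\<^bsub>free_module R X\<^esub> free_basis R p) y = (\<Oplus>\<^bsub>R\<^esub>p\<in>A. x p \<otimes>\<^bsub>R\<^esub> free_basis R p y)"
    by simp
  also have "\<dots> = (\<Oplus>\<^bsub>R\<^esub>p\<in>A. if y = p then x p else \<zero>\<^bsub>R\<^esub>)"
    using xc by (intro finsum_cong') (auto simp: free_basis_def)
  also have "\<dots> = x y"
  proof (cases "y \<in> A")
    case True then show ?thesis using xc assms(3) by (subst finsum_singleton) auto
  next
    case False
    then have "(\<Oplus>\<^bsub>R\<^esub>p\<in>A. if y = p then x p else \<zero>\<^bsub>R\<^esub>) = (\<Oplus>\<^bsub>R\<^esub>p\<in>A. \<zero>\<^bsub>R\<^esub>)" by (intro finsum_cong') auto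
    moreover have "x y = \<zero>\<^bsub>R\<^esub>" using False assms(4) by auto
    ultimately show ?thesis by simp
  qed
  finally show "x y = (\<Oplus>\<^bsub>free_module R X\<^esub>p\<in>A. x p \<odot>\<^bsub>free_module R X\<^esub> free_basis R p) y" by simp
qed

text \<open>This is \<open>tensor_lift\<close> after the choice of a representative. Its linearity
  can be proved before independence of that choice is at issue.\<close>

definition free_lift where
  "free_lift R P b x = (\<Oplus>\<^bsub>P\<^esub>p\<in>{p. x p \<noteq> \<zero>\<^bsub>R\<^esub>}. x p \<odot>\<^bsub>P\<^esub> b p)"

text \<open>The support of a sum can be smaller than the union of the supports, so additivity is not
  visible in the defining sum. Padding with zero terms brings all sums to a common index
  set.\<close>

lemma free_lift_superset:
  assumes "module R P" "x \<in> carrier (free_module R X)" "finite A" "{p. x p \<noteq> \<zero>\<^bsub>R\<^esub>} \<subseteq> A" "A \<subseteq> X"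
    "b \<in> X \<rightarrow> carrier P"
  shows "free_lift R P b x = (\<Oplus>\<^bsub>P\<^esub>p\<in>A. x p \<odot>\<^bsub>P\<^esub> b p)"
proof -
  interpret P: module R P by fact
  have xc: "x p \<in> carrier R" for p using assms(2) by (auto simp: free_module_carrier)
  have bc: "b p \<in> carrier P" if "p \<in> A" for p using assms that by auto
  show ?thesis unfolding free_lift_def
    using assms(3,4) xc bc by (intro P.add.finprod_mono_neutral_cong_left) auto
qed

lemma free_lift_lin:
  assumes "module R P" "b \<in> X \<rightarrow> carrier P"
  shows "lin R (free_module R X) P (free_lift R P b)"
proof -
  interpret P: module R P by fact
  interpret F: module R "free_module R X" by (rule free_module_module) (rule P.R.is_cring)
  have fin: "finite {p. x p \<noteq> \<zero>\<^bsub>R\<^esub>}" "{p. x p \<noteq> \<zero>\<^bsub>R\<^esub>} \<subseteq> X" "x p \<in> carrier R"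
    if "x \<in> carrier (free_module R X)" for x p
    using that by (auto simp: free_module_carrier)
  have bc: "b p \<in> carrier P" if "p \<in> X" for p using assms that by auto
  show ?thesis
  proof (rule linI)
    fix x assume x: "x \<in> carrier (free_module R X)"
    show "free_lift R P b x \<in> carrier P" unfolding free_lift_def using fin[OF x] bc
      by (intro P.finsum_closed) auto
    fix y assume y: "y \<in> carrier (free_module R X)"
    let ?A = "{p. x p \<noteq> \<zero>\<^bsub>R\<^esub>} \<union> {p. y p \<noteq> \<zero>\<^bsub>R\<^esub>}"
    have A: "finite ?A" "?A \<subseteq> X" using fin x y by auto
    then have bA: "b p \<in> carrier P" if "p \<in> ?A" for p using that bc by blast
    have xy: "x \<oplus>\<^bsub>free_module R X\<^esub> y \<in> carrier (free_module R X)" using x y by (rule F.a_closed)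
    have "free_lift R P b (x \<oplus>\<^bsub>free_module R X\<^esub> y) = (\<Oplus>\<^bsub>P\<^esub>p\<in>?A. (x \<oplus>\<^bsub>free_module R X\<^esub> y) p \<odot>\<^bsub>P\<^esub> b p)"
      using A fin(3)[OF x] fin(3)[OF y] by (intro free_lift_superset[OF assms(1) xy _ _ _ assms(2)]) auto
    also have "\<dots> = (\<Oplus>\<^bsub>P\<^esub>p\<in>?A. x p \<odot>\<^bsub>P\<^esub> b p \<oplus>\<^bsub>P\<^esub> y p \<odot>\<^bsub>P\<^esub> b p)"
      using A bA fin(3)[OF x] fin(3)[OF y] by (intro P.finsum_cong') (auto simp: P.smult_l_distr)
    also have "\<dots> = (\<Oplus>\<^bsub>P\<^esub>p\<in>?A. x p \<odot>\<^bsub>P\<^esub> b p) \<oplus>\<^bsub>P\<^esub> (\<Oplus>\<^bsub>P\<^esub>p\<in>?A. y p \<odot>\<^bsub>P\<^esub> b p)"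
      using A bA fin(3)[OF x] fin(3)[OF y] by (intro P.finsum_addf) auto
    also have "\<dots> = free_lift R P b x \<oplus>\<^bsub>P\<^esub> free_lift R P b y"
      using A by (intro arg_cong2[where f="add P"] free_lift_superset[symmetric, OF assms(1) x _ _ _ assms(2)]
         free_lift_superset[symmetric, OF assms(1) y _ _ _ assms(2)]) auto
    finally show "free_lift R P b (x \<oplus>\<^bsub>free_module R X\<^esub> y) = free_lift R P b x \<oplus>\<^bsub>P\<^esub> free_lift R P b y" .
  next
    fix r x assume r: "r \<in> carrier R" and x: "x \<in> carrier (free_module R X)"
    let ?A = "{p. x p \<noteq> \<zero>\<^bsub>R\<^esub>}"
    have rx: "r \<odot>\<^bsub>free_module R X\<^esub> x \<in> carrier (free_module R X)" using r x by (rule F.smult_closed)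
    have "free_lift R P b (r \<odot>\<^bsub>free_module R X\<^esub> x) = (\<Oplus>\<^bsub>P\<^esub>p\<in>?A. (r \<odot>\<^bsub>free_module R X\<^esub> x) p \<odot>\<^bsub>P\<^esub> b p)"
      using fin[OF x] r by (intro free_lift_superset[OF assms(1) rx _ _ _ assms(2)]) auto
    also have "\<dots> = (\<Oplus>\<^bsub>P\<^esub>p\<in>?A. r \<odot>\<^bsub>P\<^esub> (x p \<odot>\<^bsub>P\<^esub> b p))"
      using fin[OF x] bc r by (intro P.finsum_cong') (auto simp: P.smult_assoc1)
    also have "\<dots> = r \<odot>\<^bsub>P\<^esub> free_lift R P b x" unfolding free_lift_def
      using fin[OF x] bc r by (intro P.finsum_smult_ldistr[symmetric]) auto
    finally show "free_lift R P b (r \<odot>\<^bsub>free_module R X\<^esub> x) = r \<odot>\<^bsub>P\<^esub> free_lift R P b x" .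
  qed
qed

lemma free_lift_basis:
  assumes "module R P" "b \<in> X \<rightarrow> carrier P" "p \<in> X"
  shows "free_lift R P b (free_basis R p) = b p"
proof -
  interpret P: module R P by fact
  have bp: "b p \<in> carrier P" using assms by auto
  have "free_lift R P b (free_basis R p) = (\<Oplus>\<^bsub>P\<^esub>q\<in>{p}. free_basis R p q \<odot>\<^bsub>P\<^esub> b q)"
    using assms by (intro free_lift_superset[OF assms(1) free_basis_in[OF P.R.is_cring assms(3)]])
       (auto simp: free_basis_def)
  also have "\<dots> = (\<Oplus>\<^bsub>P\<^esub>q\<in>{p}. b q)"
    using bp by (intro P.finsum_cong') (auto simp: free_basis_def)
  finally show ?thesis using bp by simp
qed

section \<open>Quotients by submodules\<close>

locale module_quotient = module R F + submodule K R F for R and F :: "('k,'m,'u) module_scheme" and K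
begin

lemma sub: "abelian_subgroup K F"
  by (rule abelian_subgroupI3) (auto intro!: additive_subgroupI subgroup_axioms M.abelian_group_axioms)

interpretation K: abelian_subgroup K F by (rule sub)

text \<open>The scalar action on a coset is a union over all its elements; each of them yields the
  same coset and there is at least one, so the union is that coset.\<close>

lemma quotient_smult:
  assumes "r \<in> carrier R" "x \<in> carrier F"
  shows "r \<odot>\<^bsub>quotient_module F K\<^esub> (K +>\<^bsub>F\<^esub> x) = K +>\<^bsub>F\<^esub> (r \<odot>\<^bsub>F\<^esub> x)"
proof -
  have "K +>\<^bsub>F\<^esub> (r \<odot>\<^bsub>F\<^esub> y) = K +>\<^bsub>F\<^esub> (r \<odot>\<^bsub>F\<^esub> x)" if y: "y \<in> K +>\<^bsub>F\<^esub> x" for y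
  proof -
    from y obtain k where k: "k \<in> K" "y = k \<oplus>\<^bsub>F\<^esub> x" unfolding a_r_coset_def' by auto
    have kc: "k \<in> carrier F" using k K.a_subset by auto
    have "r \<odot>\<^bsub>F\<^esub> y = r \<odot>\<^bsub>F\<^esub> k \<oplus>\<^bsub>F\<^esub> r \<odot>\<^bsub>F\<^esub> x" using k assms kc by (simp add: smult_r_distr)
    moreover have "r \<odot>\<^bsub>F\<^esub> k \<in> K" using assms k by auto
    ultimately have "r \<odot>\<^bsub>F\<^esub> y \<in> K +>\<^bsub>F\<^esub> (r \<odot>\<^bsub>F\<^esub> x)" unfolding a_r_coset_def' by auto
    then show ?thesis using assms K.a_repr_independence' by auto
  qed
  moreover have "K +>\<^bsub>F\<^esub> x \<noteq> {}" using K.a_rcos_self assms by blast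
  ultimately show ?thesis by (auto simp: quotient_module_def)
qed

lemma quotient_add:
  assumes "x \<in> carrier F" "y \<in> carrier F"
  shows "(K +>\<^bsub>F\<^esub> x) \<oplus>\<^bsub>quotient_module F K\<^esub> (K +>\<^bsub>F\<^esub> y) = K +>\<^bsub>F\<^esub> (x \<oplus>\<^bsub>F\<^esub> y)"
  using assms by (simp add: quotient_module_def K.a_rcos_sum)

lemma quotient_carrier: "carrier (quotient_module F K) = (\<lambda>x. K +>\<^bsub>F\<^esub> x) ` carrier F"
  by (auto simp: quotient_module_def A_RCOSETS_def')

lemma quotient_zero: "\<zero>\<^bsub>quotient_module F K\<^esub> = K +>\<^bsub>F\<^esub> \<zero>\<^bsub>F\<^esub>"
  using K.a_subset by (simp add: quotient_module_def)

lemma quotient_is_module: "module R (quotient_module F K)"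
proof (intro moduleI abelian_groupI)
  fix X assume "X \<in> carrier (quotient_module F K)"
  then obtain x where x: "x \<in> carrier F" "X = K +>\<^bsub>F\<^esub> x" by (auto simp: quotient_carrier)
  then show "\<exists>Y\<in>carrier (quotient_module F K). Y \<oplus>\<^bsub>quotient_module F K\<^esub> X = \<zero>\<^bsub>quotient_module F K\<^esub>"
    by (intro bexI[of _ "K +>\<^bsub>F\<^esub> (\<ominus>\<^bsub>F\<^esub> x)"]) (auto simp: quotient_add quotient_zero M.l_neg quotient_carrier)
qed (auto simp: quotient_carrier quotient_smult quotient_add quotient_zero smult_l_distr smult_r_distr smult_assoc1
   M.a_ac R.is_cring)

lemma quotient_proj_lin: "lin R F (quotient_module F K) (\<lambda>x. K +>\<^bsub>F\<^esub> x)"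
  by (rule linI) (auto simp: quotient_carrier quotient_smult quotient_add)

end

section \<open>Tensor products\<close>

lemma submodule_Inter:
  assumes "module R F" "\<And>K. K \<in> A \<Longrightarrow> submodule K R F" "A \<noteq> {}"
  shows "submodule (\<Inter>A) R F"
proof -
  interpret F: module R F by fact
  note E = F.submoduleE[OF assms(2)]
  have "\<zero>\<^bsub>F\<^esub> \<in> K" if "K \<in> A" for K
    using subgroup.one_closed[OF submodule.axioms(1)[OF assms(2)[OF that]]] by simp
  moreover have "\<Inter>A \<subseteq> carrier F" using E(1) assms(3) by blast
  ultimately show ?thesis
    using E(3,4,5) by (intro F.submoduleI) auto
qed

lemma lin_kernel_submodule:
  assumes "module R F" "module R P" "lin R F P f"
  shows "submodule {x \<in> carrier F. f x = \<zero>\<^bsub>P\<^esub>} R F"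
proof -
  interpret F: module R F by fact
  interpret P: module R P by fact
  have "f (\<ominus>\<^bsub>F\<^esub> a) = \<ominus>\<^bsub>P\<^esub> f a" if "a \<in> carrier F" for a
  proof -
    have "f (\<zero>\<^bsub>F\<^esub> \<ominus>\<^bsub>F\<^esub> a) = \<zero>\<^bsub>P\<^esub> \<ominus>\<^bsub>P\<^esub> f a"
      using lin_minus[OF assms F.zero_closed that] lin_zero[OF assms] by simp
    then show ?thesis using that lin_closed[OF assms(3) that] by (simp add: a_minus_def)
  qed
  then show ?thesis
    by (intro F.submoduleI) (auto simp: lin_zero[OF assms] lin_add[OF assms(3)] lin_smult[OF assms(3)])
qed

locale tensor_pair = M?: module R M + N?: module R N
  for R and M :: "('k, 'm, 'u) module_scheme" and N :: "('k, 'n, 'v) module_scheme"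
begin

abbreviation "F \<equiv> free_module R (carrier M \<times> carrier N)"
abbreviation "K \<equiv> tensor_kernel R M N"

interpretation F: module R F by (rule free_module_module) (rule is_cring)

lemma basis_in: "m \<in> carrier M \<Longrightarrow> n \<in> carrier N \<Longrightarrow> free_basis R (m, n) \<in> carrier F"
  by (simp add: free_basis_in is_cring)

lemma bilinear_relations_subset: "bilinear_relations R M N \<subseteq> carrier F"
  unfolding bilinear_relations_def Let_def
  by (auto intro!: basis_in simp del: free_module_simps)

lemma kernel_submodule: "submodule K R F"
  unfolding tensor_kernel_def
  using bilinear_relations_subset F.carrier_is_submodule by (intro submodule_Inter F.module_axioms) auto

lemma relations_in_kernel: "bilinear_relations R M N \<subseteq> K"
  by (auto simp: tensor_kernel_def)

sublocale Q: module_quotient R F K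
  using kernel_submodule F.module_axioms by (simp add: module_quotient_def)

lemma tensor_carrier: "carrier (tensor_module R M N) = (\<lambda>x. K +>\<^bsub>F\<^esub> x) ` carrier F"
  by (simp add: tensor_module_def Q.quotient_carrier)

lemma tensor_is_module: "module R (tensor_module R M N)"
  unfolding tensor_module_def by (rule Q.quotient_is_module)

lemma proj_lin: "lin R F (tensor_module R M N) (\<lambda>x. K +>\<^bsub>F\<^esub> x)"
  unfolding tensor_module_def by (rule Q.quotient_proj_lin)

lemma coset_eqI:
  assumes "x \<in> carrier F" "y \<in> carrier F" "x \<ominus>\<^bsub>F\<^esub> y \<in> K"
  shows "K +>\<^bsub>F\<^esub> x = K +>\<^bsub>F\<^esub> y"
proof -
  interpret K: abelian_subgroup K F by (rule Q.sub)
  have "x \<in> K +>\<^bsub>F\<^esub> y" using K.a_rcos_module[OF assms(2,1)] assms(3) by (simp add: a_minus_def)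
  then show ?thesis using K.a_repr_independence' assms by simp
qed

lemma coset_eqD:
  assumes "x \<in> carrier F" "y \<in> K +>\<^bsub>F\<^esub> x"
  shows "y \<in> carrier F" "y \<ominus>\<^bsub>F\<^esub> x \<in> K" "K +>\<^bsub>F\<^esub> y = K +>\<^bsub>F\<^esub> x"
proof -
  interpret K: abelian_subgroup K F by (rule Q.sub)
  show y: "y \<in> carrier F" using K.a_elemrcos_carrier[OF assms] .
  show "y \<ominus>\<^bsub>F\<^esub> x \<in> K" using K.a_rcos_module[OF assms(1) y] assms(2) by (simp add: a_minus_def)
  show "K +>\<^bsub>F\<^esub> y = K +>\<^bsub>F\<^esub> x" using K.a_repr_independence' assms by simp
qed

lemma trep:
  assumes "X \<in> carrier (tensor_module R M N)"
  shows "(SOME x. x \<in> X) \<in> carrier F" "K +>\<^bsub>F\<^esub> (SOME x. x \<in> X) = X"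
proof -
  interpret K: abelian_subgroup K F by (rule Q.sub)
  obtain x where x: "x \<in> carrier F" "X = K +>\<^bsub>F\<^esub> x" using assms by (auto simp: tensor_carrier)
  then have "x \<in> X" using K.a_rcos_self by simp
  then have "(SOME x. x \<in> X) \<in> X" by (rule someI[of "\<lambda>x. x \<in> X"])
  then show "(SOME x. x \<in> X) \<in> carrier F" "K +>\<^bsub>F\<^esub> (SOME x. x \<in> X) = X"
    using coset_eqD[OF x(1)] x(2) by auto
qed

lemma trep_coeff:
  assumes "X \<in> carrier (tensor_module R M N)"
  shows "finite {p. (SOME x. x \<in> X) p \<noteq> \<zero>\<^bsub>R\<^esub>}" "{p. (SOME x. x \<in> X) p \<noteq> \<zero>\<^bsub>R\<^esub>} \<subseteq> carrier M \<times> carrier N"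
    "(SOME x. x \<in> X) p \<in> carrier R"
  using trep(1)[OF assms] unfolding free_module_carrier by blast+

lemma tensor_lift_free_lift: "tensor_lift R P b X = free_lift R P (\<lambda>p. b (fst p) (snd p)) (SOME x. x \<in> X)"
  by (simp add: tensor_lift_def free_lift_def Let_def)

text \<open>The zero set of the linear extension of \<open>b\<close> is a submodule, and bilinearity
  puts the relations into it. The kernel, being the intersection of all such submodules, is
  contained in it.\<close>

lemma kernel_vanish:
  assumes "module R P" "bil R M N P b" "x \<in> K"
  shows "free_lift R P (\<lambda>p. b (fst p) (snd p)) x = \<zero>\<^bsub>P\<^esub>"
proof -
  interpret P: module R P by fact
  let ?b = "\<lambda>p. b (fst p) (snd p)"
  have bP: "?b \<in> carrier M \<times> carrier N \<rightarrow> carrier P" using bil_closed[OF assms(2)] by auto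
  have l: "lin R F P (free_lift R P ?b)" by (rule free_lift_lin[OF assms(1) bP])
  have bas: "free_lift R P ?b (free_basis R (m, n)) = b m n" if "m \<in> carrier M" "n \<in> carrier N" for m n
    using free_lift_basis[OF assms(1) bP, of "(m,n)"] that by simp
  note [simp] = lin_minus[OF F.module_axioms assms(1) l] lin_add[OF l] lin_smult[OF l] basis_in F.a_closed F.smult_closed bas
    bil_closed[OF assms(2)] lin_add[OF bil_lin1[OF assms(2)]] lin_add[OF bil_lin2[OF assms(2)]]
     lin_smult[OF bil_lin1[OF assms(2)]] lin_smult[OF bil_lin2[OF assms(2)]]
  have "bilinear_relations R M N \<subseteq> {x \<in> carrier F. free_lift R P ?b x = \<zero>\<^bsub>P\<^esub>}"
    using bilinear_relations_subset
    unfolding bilinear_relations_def Let_def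
    by (auto simp del: free_module_simps simp: a_minus_def[symmetric] P.r_neg[folded a_minus_def])
  moreover have "submodule {x \<in> carrier F. free_lift R P ?b x = \<zero>\<^bsub>P\<^esub>} R F"
    by (rule lin_kernel_submodule[OF F.module_axioms assms(1) l])
  ultimately have "K \<subseteq> {x \<in> carrier F. free_lift R P ?b x = \<zero>\<^bsub>P\<^esub>}"
    unfolding tensor_kernel_def by blast
  then show ?thesis using assms by auto
qed

text \<open>Independence of the representative: the chosen one differs from \<open>x\<close> by an
  element of the kernel, where the extension of \<open>b\<close> vanishes.\<close>

lemma tensor_lift_coset:
  assumes "module R P" "bil R M N P b" "x \<in> carrier F"
  shows "tensor_lift R P b (K +>\<^bsub>F\<^esub> x) = free_lift R P (\<lambda>p. b (fst p) (snd p)) x"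
proof -
  interpret P: module R P by fact
  let ?b = "\<lambda>p. b (fst p) (snd p)"
  have bP: "?b \<in> carrier M \<times> carrier N \<rightarrow> carrier P" using bil_closed[OF assms(2)] by auto
  have l: "lin R F P (free_lift R P ?b)" by (rule free_lift_lin[OF assms(1) bP])
  let ?X = "K +>\<^bsub>F\<^esub> x"
  let ?y = "SOME y. y \<in> ?X"
  have X: "?X \<in> carrier (tensor_module R M N)" using assms(3) by (auto simp: tensor_carrier)
  have y: "?y \<in> carrier F" "K +>\<^bsub>F\<^esub> ?y = ?X" using trep[OF X] by auto
  have "?y \<in> ?X"
    using abelian_subgroup.a_rcos_self[OF Q.sub y(1)] y(2) by simp
  then have "?y \<ominus>\<^bsub>F\<^esub> x \<in> K" using coset_eqD(2)[OF assms(3)] by simp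
  from kernel_vanish[OF assms(1,2) this]
  have "free_lift R P ?b ?y \<ominus>\<^bsub>P\<^esub> free_lift R P ?b x = \<zero>\<^bsub>P\<^esub>"
    using lin_minus[OF F.module_axioms assms(1) l y(1) assms(3)] by simp
  then have "free_lift R P ?b ?y = free_lift R P ?b x"
    using lin_closed[OF l y(1)] lin_closed[OF l assms(3)]
      P.minus_equality[of "free_lift R P ?b ?y" "\<ominus>\<^bsub>P\<^esub> free_lift R P ?b x"]
    by (simp add: a_minus_def P.minus_minus)
  then show ?thesis by (simp add: tensor_lift_free_lift)
qed

lemma tensor_lift_lin:
  assumes "module R P" "bil R M N P b"
  shows "lin R (tensor_module R M N) P (tensor_lift R P b)"
proof -
  let ?b = "\<lambda>p. b (fst p) (snd p)"
  have bP: "?b \<in> carrier M \<times> carrier N \<rightarrow> carrier P" using bil_closed[OF assms(2)] by auto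
  have l: "lin R F P (free_lift R P ?b)" by (rule free_lift_lin[OF assms(1) bP])
  show ?thesis
    by (rule linI)
      (auto simp: tensor_carrier tensor_lift_coset[OF assms] lin_add[OF l] lin_smult[OF l] F.a_closed F.smult_closed
        lin_closed[OF l] lin_add[OF proj_lin, symmetric] lin_smult[OF proj_lin, symmetric] simp del: free_module_simps)
qed

lemma pure_closed: "m \<in> carrier M \<Longrightarrow> n \<in> carrier N \<Longrightarrow> pure_tensor R M N m n \<in> carrier (tensor_module R M N)"
  unfolding pure_tensor_def by (rule lin_closed[OF proj_lin]) (rule basis_in)

lemma tensor_lift_pure:
  assumes "module R P" "bil R M N P b" "m \<in> carrier M" "n \<in> carrier N"
  shows "tensor_lift R P b (pure_tensor R M N m n) = b m n"
proof -
  have bP: "(\<lambda>p. b (fst p) (snd p)) \<in> carrier M \<times> carrier N \<rightarrow> carrier P" using bil_closed[OF assms(2)] by auto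
  show ?thesis
    unfolding pure_tensor_def using assms free_lift_basis[OF assms(1) bP, of "(m,n)"]
    by (simp add: tensor_lift_coset basis_in)
qed

lemma pure_bil: "bil R M N (tensor_module R M N) (pure_tensor R M N)"
proof -
  note rel = subsetD[OF relations_in_kernel[unfolded bilinear_relations_def Let_def]]
  note eq = coset_eqI[OF _ _ rel]
  note s = lin_add[OF proj_lin, symmetric] lin_smult[OF proj_lin, symmetric] basis_in F.a_closed F.smult_closed
  show ?thesis
  proof (rule bilI; rule linI; (simp add: pure_closed; fail)?)
    fix y x x' assume "y \<in> carrier N" "x \<in> carrier M" "x' \<in> carrier M"
    then show "pure_tensor R M N (x \<oplus>\<^bsub>M\<^esub> x') y = pure_tensor R M N x y \<oplus>\<^bsub>tensor_module R M N\<^esub> pure_tensor R M N x' y"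
      unfolding pure_tensor_def by (simp add: s del: free_module_simps) (rule eq; (blast | simp add: s del: free_module_simps))
  next
    fix y x x' assume "x \<in> carrier M" "y \<in> carrier N" "x' \<in> carrier N"
    then show "pure_tensor R M N x (y \<oplus>\<^bsub>N\<^esub> x') = pure_tensor R M N x y \<oplus>\<^bsub>tensor_module R M N\<^esub> pure_tensor R M N x x'"
      unfolding pure_tensor_def by (simp add: s del: free_module_simps) (rule eq; (blast | simp add: s del: free_module_simps))
  next
    fix y x r assume "y \<in> carrier N" "r \<in> carrier R" "x \<in> carrier M"
    then show "pure_tensor R M N (r \<odot>\<^bsub>M\<^esub> x) y = r \<odot>\<^bsub>tensor_module R M N\<^esub> pure_tensor R M N x y"
      unfolding pure_tensor_def by (simp add: s del: free_module_simps) (rule eq; (blast | simp add: s del: free_module_simps))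
  next
    fix y x r assume "x \<in> carrier M" "r \<in> carrier R" "y \<in> carrier N"
    then show "pure_tensor R M N x (r \<odot>\<^bsub>N\<^esub> y) = r \<odot>\<^bsub>tensor_module R M N\<^esub> pure_tensor R M N x y"
      unfolding pure_tensor_def by (simp add: s del: free_module_simps) (rule eq; (blast | simp add: s del: free_module_simps))
  qed
qed

text \<open>A representative is a combination of basis elements, whose cosets are the pure tensors.
  This is the source of every argument by pure tensors.\<close>

lemma tensor_lift_expand:
  assumes "X \<in> carrier (tensor_module R M N)"
  shows "tensor_lift R (tensor_module R M N) (pure_tensor R M N) X = X"
proof -
  interpret T: module R "tensor_module R M N" by (rule tensor_is_module)
  let ?x = "SOME x. x \<in> X"
  let ?S = "{p. ?x p \<noteq> \<zero>\<^bsub>R\<^esub>}"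
  note c = trep_coeff[OF assms]
  have cl: "?x p \<odot>\<^bsub>F\<^esub> free_basis R p \<in> carrier F" if "p \<in> ?S" for p
    using that c by (intro F.smult_closed free_basis_in is_cring) auto
  have "X = K +>\<^bsub>F\<^esub> ?x" using trep[OF assms] by simp
  also have "?x = (\<Oplus>\<^bsub>F\<^esub>p\<in>?S. ?x p \<odot>\<^bsub>F\<^esub> free_basis R p)"
    by (rule free_module_expand[OF is_cring trep(1)[OF assms] c(1) _ c(2)]) simp
  also have "K +>\<^bsub>F\<^esub> \<dots> = (\<Oplus>\<^bsub>tensor_module R M N\<^esub>p\<in>?S. K +>\<^bsub>F\<^esub> (?x p \<odot>\<^bsub>F\<^esub> free_basis R p))"
    using cl c(1) by (intro lin_finsum[OF F.module_axioms T.module_axioms proj_lin]) auto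
  also have "\<dots> = (\<Oplus>\<^bsub>tensor_module R M N\<^esub>p\<in>?S. ?x p \<odot>\<^bsub>tensor_module R M N\<^esub> pure_tensor R M N (fst p) (snd p))"
    using c by (intro T.finsum_cong') (auto simp: pure_tensor_def lin_smult[OF proj_lin] basis_in lin_closed[OF proj_lin] simp del: free_module_simps)
  finally show ?thesis by (simp add: tensor_lift_def Let_def)
qed

end

text \<open>\<open>tensor_lift\<close> with the tensor product made explicit, so that a congruence rule holds.\<close>

definition sw where
  "sw R M N P X b = (if X \<in> carrier (tensor_module R M N)
     then tensor_lift R P (\<lambda>m n. if m \<in> carrier M \<and> n \<in> carrier N then b m n else \<zero>\<^bsub>P\<^esub>) X else \<zero>\<^bsub>P\<^esub>)"

text \<open>As a congruence rule it hands the simplifier the membership of both components when it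
  rewrites below \<open>sw\<close>, which is what discharges the side conditions of Sweedler
  calculations.\<close>

lemma sw_cong [cong]:
  assumes "X = Y" "\<And>m n. m \<in> carrier M \<Longrightarrow> n \<in> carrier N \<Longrightarrow> f m n = g m n"
  shows "sw R M N P X f = sw R M N P Y g"
proof -
  have "(\<lambda>m n. if m \<in> carrier M \<and> n \<in> carrier N then f m n else \<zero>\<^bsub>P\<^esub>) = (\<lambda>m n. if m \<in> carrier M \<and> n \<in> carrier N then g m n else \<zero>\<^bsub>P\<^esub>)"
    using assms(2) by (auto simp: fun_eq_iff)
  then show ?thesis using assms(1) by (simp only: sw_def)
qed

lemma tensor_module_module [simp]: "module R M \<Longrightarrow> module R N \<Longrightarrow> module R (tensor_module R M N)"
  by (rule tensor_pair.tensor_is_module[OF tensor_pair.intro])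

lemma pure_tensor_closed [simp]:
  "module R M \<Longrightarrow> module R N \<Longrightarrow> m \<in> carrier M \<Longrightarrow> n \<in> carrier N \<Longrightarrow>
    pure_tensor R M N m n \<in> carrier (tensor_module R M N)"
  by (rule tensor_pair.pure_closed[OF tensor_pair.intro])

context
  fixes R :: "('k, 'z) ring_scheme" and M :: "('k, 'm, 'u) module_scheme" and N :: "('k, 'n, 'v) module_scheme"
  assumes M: "module R M" and N: "module R N"
begin

interpretation tensor_pair R M N by (intro tensor_pair.intro M N)

lemma sw_as_sum:
  assumes "module R P" "X \<in> carrier (tensor_module R M N)"
    and "\<And>m n. m \<in> carrier M \<Longrightarrow> n \<in> carrier N \<Longrightarrow> b m n \<in> carrier P"
  defines "x \<equiv> SOME x. x \<in> X"
  shows "sw R M N P X b = (\<Oplus>\<^bsub>P\<^esub>p\<in>{p. x p \<noteq> \<zero>\<^bsub>R\<^esub>}. x p \<odot>\<^bsub>P\<^esub> b (fst p) (snd p))"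
proof -
  interpret P: module R P by fact
  define S where "S = {p. x p \<noteq> \<zero>\<^bsub>R\<^esub>}"
  note c = trep_coeff[OF assms(2), folded x_def, folded S_def]
  have S: "fst p \<in> carrier M" "snd p \<in> carrier N" if "p \<in> S" for p using that c by auto
  show ?thesis using c(3) S assms(2,3)
    by (auto simp: sw_def tensor_lift_def Let_def x_def[symmetric] S_def[symmetric] intro!: P.finsum_cong')
qed

lemma sw_eq_tensor_lift:
  assumes "module R P" "X \<in> carrier (tensor_module R M N)"
    and "\<And>m n. m \<in> carrier M \<Longrightarrow> n \<in> carrier N \<Longrightarrow> b m n \<in> carrier P"
  shows "tensor_lift R P b X = sw R M N P X b"
  using sw_as_sum[OF assms] by (simp add: tensor_lift_def Let_def)

lemma sw_closed [simp]:
  assumes P: "module R P" and "\<And>m n. m \<in> carrier M \<Longrightarrow> n \<in> carrier N \<Longrightarrow> f m n \<in> carrier P"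
  shows "sw R M N P X f \<in> carrier P"
proof -
  interpret P: module R P by fact
  show ?thesis
  proof (cases "X \<in> carrier (tensor_module R M N)")
    case True
    define x where "x = (SOME x. x \<in> X)"
    define S where "S = {p. x p \<noteq> \<zero>\<^bsub>R\<^esub>}"
    note c = trep_coeff[OF True, folded x_def, folded S_def]
    have "sw R M N P X f = (\<Oplus>\<^bsub>P\<^esub>p\<in>S. x p \<odot>\<^bsub>P\<^esub> f (fst p) (snd p))"
      unfolding S_def x_def by (rule sw_as_sum[OF P True]) (rule assms(2))
    also have "\<dots> \<in> carrier P" using c assms(2)
      by (intro P.finsum_closed) auto
    finally show ?thesis .
  qed (simp add: sw_def)
qed

lemma sw_lin:
  assumes P: "module R P" and "bil R M N P f"
  shows "lin R (tensor_module R M N) P (\<lambda>X. sw R M N P X f)"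
  by (rule lin_cong[OF tensor_is_module _ tensor_lift_lin[OF assms]])
    (simp add: sw_eq_tensor_lift P bil_closed[OF assms(2)])

lemma sw_pure:
  assumes P: "module R P" and "bil R M N P f" "m \<in> carrier M" "n \<in> carrier N"
  shows "sw R M N P (pure_tensor R M N m n) f = f m n"
  by (subst sw_eq_tensor_lift[symmetric]) (simp_all add: bil_closed[OF assms(2)] pure_closed assms tensor_lift_pure)

lemma sw_expand:
  assumes "X \<in> carrier (tensor_module R M N)"
  shows "sw R M N (tensor_module R M N) X (pure_tensor R M N) = X"
  using assms by (subst sw_eq_tensor_lift[symmetric]) (simp_all add: tensor_lift_expand tensor_is_module pure_closed)

text \<open>The way linear maps move through Sweedler expressions. Outside the tensor product both
  sides are zero, so the rule applies to every \<open>X\<close>.\<close>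

lemma sw_push:
  assumes P: "module R P" and Q: "module R Q" and g: "lin R P Q g"
    and f: "\<And>m n. m \<in> carrier M \<Longrightarrow> n \<in> carrier N \<Longrightarrow> f m n \<in> carrier P"
  shows "g (sw R M N P X f) = sw R M N Q X (\<lambda>m n. g (f m n))"
proof (cases "X \<in> carrier (tensor_module R M N)")
  case True
  interpret P: module R P by fact
  interpret Q: module R Q by fact
  note c = trep_coeff[OF True]
  define x where "x = (SOME x. x \<in> X)"
  define S where "S = {p. x p \<noteq> \<zero>\<^bsub>R\<^esub>}"
  note c = c[folded x_def, folded S_def]
  have S: "f (fst p) (snd p) \<in> carrier P" if "p \<in> S" for p using that c f by auto
  have e: "sw R M N P X f = (\<Oplus>\<^bsub>P\<^esub>p\<in>S. x p \<odot>\<^bsub>P\<^esub> f (fst p) (snd p))"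
      "sw R M N Q X (\<lambda>m n. g (f m n)) = (\<Oplus>\<^bsub>Q\<^esub>p\<in>S. x p \<odot>\<^bsub>Q\<^esub> g (f (fst p) (snd p)))"
    unfolding S_def x_def by (intro sw_as_sum P Q True f lin_closed[OF g]; assumption)+
  show ?thesis
    unfolding e
    using c(3) S
    by (subst lin_finsum[OF P Q g c(1)])
       (auto intro!: Q.finsum_cong' lin_closed[OF g] simp: lin_smult[OF g])
qed (simp add: sw_def lin_zero[OF P Q g])

lemma sw_lin2:
  assumes A: "module R A" and P: "module R P" and f: "\<And>m n. m \<in> carrier M \<Longrightarrow> n \<in> carrier N \<Longrightarrow> lin R A P (\<lambda>x. f x m n)"
  shows "lin R A P (\<lambda>x. sw R M N P X (f x))"
proof (cases "X \<in> carrier (tensor_module R M N)")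
  case True
  interpret A: module R A by fact
  interpret P: module R P by fact
  note c = trep_coeff[OF True]
  define S where "S = {p. (SOME x. x \<in> X) p \<noteq> \<zero>\<^bsub>R\<^esub>}"
  define x where "x = (SOME x. x \<in> X)"
  note c = c[folded S_def, folded x_def]
  note fl = lin_closed[OF f] lin_add[OF f] lin_smult[OF f]
  have S: "fst p \<in> carrier M" "snd p \<in> carrier N" if "p \<in> S" for p using that c by auto
  have e: "sw R M N P X (f a) = (\<Oplus>\<^bsub>P\<^esub>p\<in>S. x p \<odot>\<^bsub>P\<^esub> f a (fst p) (snd p))" if "a \<in> carrier A" for a
    unfolding S_def x_def by (rule sw_as_sum[OF P True]) (rule fl(1)[OF _ _ that])
  show ?thesis
  proof (rule linI)
    fix a b assume "a \<in> carrier A" "b \<in> carrier A"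
    then show "sw R M N P X (f (a \<oplus>\<^bsub>A\<^esub> b)) = sw R M N P X (f a) \<oplus>\<^bsub>P\<^esub> sw R M N P X (f b)"
      using c(3) S by (simp add: e, intro trans[OF P.finsum_cong' P.finsum_addf]) (auto intro!: P.smult_closed simp: fl P.smult_r_distr)
  next
    fix r a assume "r \<in> carrier R" "a \<in> carrier A"
    then show "sw R M N P X (f (r \<odot>\<^bsub>A\<^esub> a)) = r \<odot>\<^bsub>P\<^esub> sw R M N P X (f a)"
      using c(1,3) S e
      by (simp, subst P.finsum_smult_ldistr) (auto intro!: P.finsum_cong' simp: fl P.smult_assoc1[symmetric] comm_monoid.m_comm[OF cring.axioms(2)[OF module.axioms(1)[OF P]]])
  next
    fix a assume "a \<in> carrier A"
    then show "sw R M N P X (f a) \<in> carrier P" using P.module_axioms fl(1) by (intro sw_closed)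
  qed
next
  case False
  interpret P: module R P by fact
  show ?thesis using False by (intro linI) (simp_all add: sw_def)
qed

lemma sw_add:
  assumes P: "module R P"
    and f: "\<And>m n. m \<in> carrier M \<Longrightarrow> n \<in> carrier N \<Longrightarrow> f m n \<in> carrier P"
    and g: "\<And>m n. m \<in> carrier M \<Longrightarrow> n \<in> carrier N \<Longrightarrow> g m n \<in> carrier P"
  shows "sw R M N P X (\<lambda>m n. f m n \<oplus>\<^bsub>P\<^esub> g m n) = sw R M N P X f \<oplus>\<^bsub>P\<^esub> sw R M N P X g"
proof (cases "X \<in> carrier (tensor_module R M N)")
  case True
  interpret P: module R P by fact
  note c = trep_coeff[OF True]
  define x where "x = (SOME x. x \<in> X)"
  define S where "S = {p. x p \<noteq> \<zero>\<^bsub>R\<^esub>}"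
  note c = c[folded x_def, folded S_def]
  have S: "f (fst p) (snd p) \<in> carrier P" "g (fst p) (snd p) \<in> carrier P" if "p \<in> S" for p using that c f g by auto
  have e: "sw R M N P X b = (\<Oplus>\<^bsub>P\<^esub>p\<in>S. x p \<odot>\<^bsub>P\<^esub> b (fst p) (snd p))"
    if "\<And>m n. m \<in> carrier M \<Longrightarrow> n \<in> carrier N \<Longrightarrow> b m n \<in> carrier P" for b
    unfolding S_def x_def by (rule sw_as_sum[OF P True]) (rule that)
  have "sw R M N P X (\<lambda>m n. f m n \<oplus>\<^bsub>P\<^esub> g m n) = (\<Oplus>\<^bsub>P\<^esub>p\<in>S. x p \<odot>\<^bsub>P\<^esub> (f (fst p) (snd p) \<oplus>\<^bsub>P\<^esub> g (fst p) (snd p)))"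
    by (rule e) (simp add: f g)
  also have "\<dots> = (\<Oplus>\<^bsub>P\<^esub>p\<in>S. x p \<odot>\<^bsub>P\<^esub> f (fst p) (snd p)) \<oplus>\<^bsub>P\<^esub> (\<Oplus>\<^bsub>P\<^esub>p\<in>S. x p \<odot>\<^bsub>P\<^esub> g (fst p) (snd p))"
    using c(3) S by (intro trans[OF P.finsum_cong' P.finsum_addf]) (auto simp: P.smult_r_distr)
  finally show ?thesis by (simp add: e[of f] e[of g] f g)
next
  case False
  interpret P: module R P by fact
  show ?thesis using False by (simp add: sw_def)
qed

text \<open>By \<open>sw_expand\<close> a tensor is a sum of pure ones, and \<open>sw_push\<close>
  carries both maps inside that sum.\<close>

lemma lin_tensor_eqI:
  assumes P: "module R P" and f: "lin R (tensor_module R M N) P f" and g: "lin R (tensor_module R M N) P g"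
    and "\<And>m n. m \<in> carrier M \<Longrightarrow> n \<in> carrier N \<Longrightarrow> f (pure_tensor R M N m n) = g (pure_tensor R M N m n)"
    and X: "X \<in> carrier (tensor_module R M N)"
  shows "f X = g X"
proof -
  have "f (sw R M N (tensor_module R M N) X (pure_tensor R M N)) = sw R M N P X (\<lambda>m n. f (pure_tensor R M N m n))"
    by (rule sw_push[OF tensor_is_module P f pure_closed])
  also have "\<dots> = sw R M N P X (\<lambda>m n. g (pure_tensor R M N m n))"
    by (rule sw_cong) (simp_all add: assms(4))
  also have "\<dots> = g (sw R M N (tensor_module R M N) X (pure_tensor R M N))"
    by (rule sw_push[OF tensor_is_module P g pure_closed, symmetric])
  finally show ?thesis by (simp add: sw_expand X)
qed

end

lemma sw_finsum:
  assumes MN: "module R M" "module R N" and P: "module R P" and S: "finite S"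
    and h: "\<And>p m n. p \<in> S \<Longrightarrow> m \<in> carrier M \<Longrightarrow> n \<in> carrier N \<Longrightarrow> h p m n \<in> carrier P"
  shows "sw R M N P X (\<lambda>m n. \<Oplus>\<^bsub>P\<^esub>p\<in>S. h p m n) = (\<Oplus>\<^bsub>P\<^esub>p\<in>S. sw R M N P X (h p))"
  using S h
proof (induction S)
  interpret P: module R P by fact
  case empty
  have "lin R P P (\<lambda>x. \<zero>\<^bsub>P\<^esub>)" by (rule linI) auto
  from sw_push[OF MN P P this, of "\<lambda>m n. \<zero>\<^bsub>P\<^esub>" X] show ?case by simp
next
  interpret P: module R P by fact
  case (insert p S)
  have "sw R M N P X (\<lambda>m n. \<Oplus>\<^bsub>P\<^esub>p\<in>insert p S. h p m n) = sw R M N P X (\<lambda>m n. h p m n \<oplus>\<^bsub>P\<^esub> (\<Oplus>\<^bsub>P\<^esub>p\<in>S. h p m n))"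
    using insert by (intro sw_cong) auto
  also have "\<dots> = sw R M N P X (h p) \<oplus>\<^bsub>P\<^esub> sw R M N P X (\<lambda>m n. (\<Oplus>\<^bsub>P\<^esub>p\<in>S. h p m n))"
    using insert by (intro sw_add[OF MN P]) auto
  also have "\<dots> = (\<Oplus>\<^bsub>P\<^esub>p\<in>insert p S. sw R M N P X (h p))"
    using insert by (subst P.finsum_insert) (auto intro!: sw_closed[OF MN P])
  finally show ?case .
qed

text \<open>Fubini for Sweedler sums: the outer one is a finite linear combination, and the inner
  one respects scalars by \<open>sw_push\<close> and finite sums by
  \<open>sw_finsum\<close>.\<close>

lemma sw_swap:
  assumes MN: "module R M" "module R N" and MN': "module R M'" "module R N'" and P: "module R P"
    and f: "\<And>m n m' n'. m \<in> carrier M \<Longrightarrow> n \<in> carrier N \<Longrightarrow> m' \<in> carrier M' \<Longrightarrow> n' \<in> carrier N' \<Longrightarrow> f m n m' n' \<in> carrier P"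
  shows "sw R M N P X (\<lambda>m n. sw R M' N' P Y (\<lambda>m' n'. f m n m' n')) =
     sw R M' N' P Y (\<lambda>m' n'. sw R M N P X (\<lambda>m n. f m n m' n'))"
proof (cases "X \<in> carrier (tensor_module R M N)")
  interpret P: module R P by fact
  case True
  note c = tensor_pair.trep_coeff[OF tensor_pair.intro[OF MN] True]
  define x where "x = (SOME x. x \<in> X)"
  define S where "S = {p. x p \<noteq> \<zero>\<^bsub>R\<^esub>}"
  note c = c[folded x_def, folded S_def]
  have S: "fst p \<in> carrier M" "snd p \<in> carrier N" if "p \<in> S" for p using that c by auto
  have e: "sw R M N P X g = (\<Oplus>\<^bsub>P\<^esub>p\<in>S. x p \<odot>\<^bsub>P\<^esub> g (fst p) (snd p))"
    if "\<And>m n. m \<in> carrier M \<Longrightarrow> n \<in> carrier N \<Longrightarrow> g m n \<in> carrier P" for g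
    unfolding S_def x_def by (rule sw_as_sum[OF MN P True]) (rule that)
  have l: "lin R P P (\<lambda>y. x p \<odot>\<^bsub>P\<^esub> y)" for p
    using c(3) by (intro linI) (auto simp: P.smult_r_distr P.smult_assoc1[symmetric] P.m_comm)
  have "sw R M N P X (\<lambda>m n. sw R M' N' P Y (\<lambda>m' n'. f m n m' n')) =
      (\<Oplus>\<^bsub>P\<^esub>p\<in>S. sw R M' N' P Y (\<lambda>m' n'. x p \<odot>\<^bsub>P\<^esub> f (fst p) (snd p) m' n'))"
    using S c f
    by (subst e) (auto intro!: P.finsum_cong' sw_closed[OF MN' P] sw_push[OF MN' P P l])
  also have "\<dots> = sw R M' N' P Y (\<lambda>m' n'. \<Oplus>\<^bsub>P\<^esub>p\<in>S. x p \<odot>\<^bsub>P\<^esub> f (fst p) (snd p) m' n')"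
    using S c(1,3) f by (intro sw_finsum[symmetric, OF MN' P]) auto
  also have "\<dots> = sw R M' N' P Y (\<lambda>m' n'. sw R M N P X (\<lambda>m n. f m n m' n'))"
    by (intro sw_cong refl e[symmetric] f)
  finally show ?thesis .
next
  interpret P: module R P by fact
  case False
  have "lin R P P (\<lambda>x. \<zero>\<^bsub>P\<^esub>)" by (rule linI) auto
  from sw_push[OF MN' P P this, of "\<lambda>m n. \<zero>\<^bsub>P\<^esub>" Y] show ?thesis using False by (simp add: sw_def)
qed

section \<open>Multilinearity of Sweedler expressions\<close>

definition tril where "tril R A B C P f \<longleftrightarrow>
   (\<forall>b\<in>carrier B. \<forall>c\<in>carrier C. lin R A P (\<lambda>a. f a b c)) \<and>
   (\<forall>a\<in>carrier A. \<forall>c\<in>carrier C. lin R B P (\<lambda>b. f a b c)) \<and>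
   (\<forall>a\<in>carrier A. \<forall>b\<in>carrier B. lin R C P (\<lambda>c. f a b c))"

lemma tril_closed: "tril R A B C P f \<Longrightarrow> a \<in> carrier A \<Longrightarrow> b \<in> carrier B \<Longrightarrow> c \<in> carrier C \<Longrightarrow> f a b c \<in> carrier P"
  by (rule lin_closed[where f = "f a b" and M = C and R = R]) (simp_all add: tril_def)

lemma lin_id [simp]: "lin R A A (\<lambda>x. x)"
  by (rule linI) auto

lemma lin_compose:
  assumes "lin R M P g" "lin R A M f"
  shows "lin R A P (\<lambda>x. g (f x))"
  using assms by (intro linI) (auto simp: lin_closed lin_add lin_smult)

lemmas bil_rules = bil_closed bil_lin1 bil_lin2 lin_compose[OF bil_lin1] lin_compose[OF bil_lin2]

text \<open>This and the following closure rules speak of an arbitrary linear inner map, so that the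
  simplifier settles the linearity of a nested expression by recursion on its shape.\<close>

lemma lin_pure1 [simp]:
  "module R M \<Longrightarrow> module R N \<Longrightarrow> lin R A M f \<Longrightarrow> n \<in> carrier N \<Longrightarrow> lin R A (tensor_module R M N) (\<lambda>x. pure_tensor R M N (f x) n)"
  and lin_pure2 [simp]:
  "module R M \<Longrightarrow> module R N \<Longrightarrow> lin R A N g \<Longrightarrow> m \<in> carrier M \<Longrightarrow> lin R A (tensor_module R M N) (\<lambda>x. pure_tensor R M N m (g x))"
  using tensor_pair.pure_bil[OF tensor_pair.intro, of R M N]
  by (auto intro: lin_compose[OF bil_lin1] lin_compose[OF bil_lin2])

lemma lin_sw1 [simp]:
  "module R M \<Longrightarrow> module R N \<Longrightarrow> module R P \<Longrightarrow> lin R A (tensor_module R M N) f \<Longrightarrow> bil R M N P g \<Longrightarrow>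
    lin R A P (\<lambda>x. sw R M N P (f x) g)"
  by (rule lin_compose[OF sw_lin])

lemma lin_sw2 [simp]:
  "module R M \<Longrightarrow> module R N \<Longrightarrow> module R P \<Longrightarrow> module R A \<Longrightarrow>
    (\<And>m n. m \<in> carrier M \<Longrightarrow> n \<in> carrier N \<Longrightarrow> lin R A P (\<lambda>x. f x m n)) \<Longrightarrow>
    lin R A P (\<lambda>x. sw R M N P X (f x))"
  by (rule sw_lin2)

lemma lin_smult1 [simp]:
  assumes "module R P" "lin R A (regular_module R) f" "p \<in> carrier P"
  shows "lin R A P (\<lambda>x. f x \<odot>\<^bsub>P\<^esub> p)"
proof -
  interpret P: module R P by fact
  show ?thesis using lin_closed[OF assms(2)] lin_add[OF assms(2)] lin_smult[OF assms(2)] assms(3)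
    by (intro linI) (auto simp: P.smult_l_distr P.smult_assoc1)
qed

lemma lin_smult2 [simp]:
  assumes "module R P" "lin R A P f" "r \<in> carrier R"
  shows "lin R A P (\<lambda>x. r \<odot>\<^bsub>P\<^esub> f x)"
proof -
  interpret P: module R P by fact
  show ?thesis using lin_closed[OF assms(2)] lin_add[OF assms(2)] lin_smult[OF assms(2)] assms(3)
    by (intro linI) (auto simp: P.smult_r_distr P.smult_assoc1[symmetric] P.m_comm)
qed

lemma sw_sw:
  assumes "module R M" "module R N" "module R A" "module R B" "module R P" "bil R M N P f"
    and "\<And>a b. a \<in> carrier A \<Longrightarrow> b \<in> carrier B \<Longrightarrow> g a b \<in> carrier (tensor_module R M N)"
  shows "sw R M N P (sw R A B (tensor_module R M N) X g) f = sw R A B P X (\<lambda>a b. sw R M N P (g a b) f)"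
  using assms by (intro sw_push[where g = "\<lambda>Y. sw R M N P Y f"]) (simp_all add: sw_lin)

lemma smult_sw:
  assumes "module R M" "module R N" "module R P" "r \<in> carrier R"
    and "\<And>a b. a \<in> carrier M \<Longrightarrow> b \<in> carrier N \<Longrightarrow> g a b \<in> carrier P"
  shows "r \<odot>\<^bsub>P\<^esub> sw R M N P X g = sw R M N P X (\<lambda>a b. r \<odot>\<^bsub>P\<^esub> g a b)"
  using assms(5) by (intro sw_push[where g = "\<lambda>Y. r \<odot>\<^bsub>P\<^esub> Y"] assms lin_smult2 lin_id)

lemma sw_smult:
  assumes "module R M" "module R N" "module R P" "p \<in> carrier P"
    and "\<And>a b. a \<in> carrier M \<Longrightarrow> b \<in> carrier N \<Longrightarrow> g a b \<in> carrier R"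
  shows "sw R M N (regular_module R) X g \<odot>\<^bsub>P\<^esub> p = sw R M N P X (\<lambda>a b. g a b \<odot>\<^bsub>P\<^esub> p)"
  using assms by (intro sw_push[where g = "\<lambda>Y. Y \<odot>\<^bsub>P\<^esub> p"]) (simp_all add: regular_module_module[OF module.axioms(1)[OF assms(3)]])

section \<open>Weak bialgebras\<close>

context weak_bialgebra
begin

abbreviation mH (infixl \<open>\<cdot>\<close> 70) where "g \<cdot> h \<equiv> g \<otimes>\<^bsub>H\<^esub> h"
abbreviation "HH \<equiv> tensor_module R H H"
abbreviation "HHH \<equiv> tensor_module R HH H"
abbreviation "KR \<equiv> regular_module R"
abbreviation "\<epsilon> \<equiv> counit H"
abbreviation "pHH \<equiv> pure_tensor R H H"
text \<open>Sweedler notation: in \<open>dsum P h (\<lambda>a b. ...)\<close> the variables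
  \<open>a\<close> and \<open>b\<close> stand for the two components of the coproduct of
  \<open>h\<close>; \<open>osum\<close> is the same for the unit.\<close>

abbreviation dsum where "dsum P h f \<equiv> sw R H H P (comult H h) f"
abbreviation osum where "osum P f \<equiv> sw R H H P (comult H \<one>\<^bsub>H\<^esub>) f"

lemma mod_H [simp]: "module R H" by (rule module_axioms)
lemma mod_KR [simp]: "module R KR" by (rule regular_module_module) (rule R.is_cring)
lemma cring_R [simp]: "cring R" by (rule R.is_cring)

lemma smult_closed' [simp]:
  "module R P \<Longrightarrow> r \<in> carrier R \<Longrightarrow> p \<in> carrier P \<Longrightarrow> r \<odot>\<^bsub>P\<^esub> p \<in> carrier P"
  by (rule module.smult_closed)

lemma lin_mult1 [simp]: "lin R A H f \<Longrightarrow> h \<in> carrier H \<Longrightarrow> lin R A H (\<lambda>x. f x \<cdot> h)"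
  by (rule linI) (auto simp: lin_closed lin_add lin_smult H.l_distr smult_mult_left)

lemma lin_mult2 [simp]: "lin R A H f \<Longrightarrow> h \<in> carrier H \<Longrightarrow> lin R A H (\<lambda>x. h \<cdot> f x)"
  by (rule linI) (auto simp: lin_closed lin_add lin_smult H.r_distr smult_mult_right)

lemma lin_comult0 [simp]: "lin R H HH (comult H)" using comult_linear by (simp add: lin_def)
lemma lin_counit0 [simp]: "lin R H KR \<epsilon>" using counit_linear by (simp add: lin_def)
lemma lin_comult [simp]: "lin R A H f \<Longrightarrow> lin R A HH (\<lambda>x. comult H (f x))" by (rule lin_compose) auto
lemma lin_counit [simp]: "lin R A H f \<Longrightarrow> lin R A KR (\<lambda>x. \<epsilon> (f x))" by (rule lin_compose[of _ H]) auto
lemma comult_closed [simp]: "h \<in> carrier H \<Longrightarrow> comult H h \<in> carrier HH" by (rule lin_closed[OF lin_comult0])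
lemma counit_closed [simp]: "h \<in> carrier H \<Longrightarrow> \<epsilon> h \<in> carrier R" using lin_closed[OF lin_counit0] by simp

section \<open>The weak bialgebra axioms in Sweedler form\<close>

lemma tensor_lift_dsum:
  assumes "module R P" "h \<in> carrier H" "\<And>a b. a \<in> carrier H \<Longrightarrow> b \<in> carrier H \<Longrightarrow> f a b \<in> carrier P"
  shows "tensor_lift R P f (comult H h) = dsum P h f"
  using assms by (intro sw_eq_tensor_lift) auto

lemma mult_dsum:
  assumes "g \<in> carrier H" "\<And>a b. a \<in> carrier H \<Longrightarrow> b \<in> carrier H \<Longrightarrow> f a b \<in> carrier H"
  shows "g \<cdot> dsum H h f = dsum H h (\<lambda>a b. g \<cdot> f a b)"
  using assms by (intro sw_push) auto

lemma dsum_mult: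
  assumes "g \<in> carrier H" "\<And>a b. a \<in> carrier H \<Longrightarrow> b \<in> carrier H \<Longrightarrow> f a b \<in> carrier H"
  shows "dsum H h f \<cdot> g = dsum H h (\<lambda>a b. f a b \<cdot> g)"
  using assms by (intro sw_push[where g="\<lambda>x. x \<cdot> g"]) auto

lemma counit_dsum:
  assumes "\<And>a b. a \<in> carrier H \<Longrightarrow> b \<in> carrier H \<Longrightarrow> f a b \<in> carrier H"
  shows "\<epsilon> (dsum H h f) = dsum KR h (\<lambda>a b. \<epsilon> (f a b))"
  using assms by (intro sw_push) auto

text \<open>A trilinear \<open>f\<close> factors through a linear map on \<open>HHH\<close>; that
  map is applied to both sides of the axiom. The tensor-valued axioms below are converted by the
  same device.\<close>

lemma sweedler_coassoc:
  assumes [simp]: "module R P" "h \<in> carrier H" and f: "tril R H H H P f"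
  shows "dsum P h (\<lambda>a b. dsum P a (\<lambda>c d. f c d b)) = dsum P h (\<lambda>a b. dsum P b (\<lambda>c d. f a c d))"
proof -
  note [simp] = tril_closed[OF f] f[unfolded tril_def, rule_format]
  have [simp]: "bil R HH H P (\<lambda>x d. sw R H H P x (\<lambda>a b. f a b d))"
    by (simp add: bil_def)
  have "dsum HHH h (\<lambda>a b. pure_tensor R HH H (comult H a) b) =
    dsum HHH h (\<lambda>a b. dsum HHH b (\<lambda>c d. pure_tensor R HH H (pHH a c) d))"
    using coassoc[of h] by (simp add: tensor_lift_dsum)
  from arg_cong[OF this, of "\<lambda>X. sw R HH H P X (\<lambda>x d. sw R H H P x (\<lambda>a b. f a b d))"]
  show ?thesis by (simp add: sw_sw sw_pure bil_def)
qed

lemma sweedler_comult_mult: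
  assumes [simp]: "module R P" "g \<in> carrier H" "h \<in> carrier H" and f: "bil R H H P f"
  shows "dsum P (g \<cdot> h) f = dsum P g (\<lambda>a b. dsum P h (\<lambda>c d. f (a \<cdot> c) (b \<cdot> d)))"
proof -
  note [simp] = bil_rules[OF f]
  have "comult H (g \<cdot> h) = dsum HH g (\<lambda>a b. dsum HH h (\<lambda>c d. pHH (a \<cdot> c) (b \<cdot> d)))"
    by (simp add: comult_mult tensor_act_def tensor_map_def tensor_lift_dsum)
  then show ?thesis by (simp add: sw_sw sw_pure f)
qed

lemma sweedler_one_left:
  assumes [simp]: "module R P" and f: "tril R H H H P f"
  shows "osum P (\<lambda>a b. osum P (\<lambda>c d. f a (b \<cdot> c) d)) = osum P (\<lambda>a b. dsum P a (\<lambda>c d. f c d b))"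
proof -
  note [simp] = tril_closed[OF f] f[unfolded tril_def, rule_format]
  have [simp]: "bil R HH H P (\<lambda>x d. sw R H H P x (\<lambda>a b. f a b d))"
    by (simp add: bil_def)
  have "osum HHH (\<lambda>a b. pure_tensor R HH H (comult H a) b) =
    osum HHH (\<lambda>a b. osum HHH (\<lambda>c d. pure_tensor R HH H (pHH a (b \<cdot> c)) d))"
    using comult_one_left by (simp add: tensor_lift_dsum)
  from arg_cong[OF this, of "\<lambda>X. sw R HH H P X (\<lambda>x d. sw R H H P x (\<lambda>a b. f a b d))"]
  show ?thesis by (simp add: sw_sw sw_pure bil_def)
qed

lemma sweedler_one_right:
  assumes [simp]: "module R P" and f: "tril R H H H P f"
  shows "osum P (\<lambda>a b. osum P (\<lambda>c d. f a (c \<cdot> b) d)) = osum P (\<lambda>a b. dsum P a (\<lambda>c d. f c d b))"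
proof -
  note [simp] = tril_closed[OF f] f[unfolded tril_def, rule_format]
  have [simp]: "bil R HH H P (\<lambda>x d. sw R H H P x (\<lambda>a b. f a b d))"
    by (simp add: bil_def)
  have "osum HHH (\<lambda>a b. pure_tensor R HH H (comult H a) b) =
    osum HHH (\<lambda>a b. osum HHH (\<lambda>c d. pure_tensor R HH H (pHH a (c \<cdot> b)) d))"
    using comult_one_right by (simp add: tensor_lift_dsum)
  from arg_cong[OF this, of "\<lambda>X. sw R HH H P X (\<lambda>x d. sw R H H P x (\<lambda>a b. f a b d))"]
  show ?thesis by (simp add: sw_sw sw_pure bil_def)
qed

text \<open>By coassociativity the threefold coproduct of the unit can be split at its right leg as
  well.\<close>

lemma sweedler_one_left_split:
  assumes "module R P" and f: "tril R H H H P f"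
  shows "osum P (\<lambda>a b. osum P (\<lambda>c d. f a (b \<cdot> c) d)) = osum P (\<lambda>a b. dsum P b (\<lambda>c d. f a c d))"
  by (rule trans[OF sweedler_one_left sweedler_coassoc]) (use assms in simp_all)

lemma sweedler_one_right_split:
  assumes "module R P" and f: "tril R H H H P f"
  shows "osum P (\<lambda>a b. osum P (\<lambda>c d. f a (c \<cdot> b) d)) = osum P (\<lambda>a b. dsum P b (\<lambda>c d. f a c d))"
  by (rule trans[OF sweedler_one_right sweedler_coassoc]) (use assms in simp_all)

lemma sweedler_counit_left:
  assumes [simp]: "module R P" "h \<in> carrier H" and g: "lin R H P g"
  shows "dsum P h (\<lambda>a b. \<epsilon> a \<odot>\<^bsub>P\<^esub> g b) = g h"
proof -
  note [simp] = lin_closed[OF g] lin_smult[OF g]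
  have "g (dsum H h (\<lambda>a b. \<epsilon> a \<odot>\<^bsub>H\<^esub> b)) = dsum P h (\<lambda>a b. g (\<epsilon> a \<odot>\<^bsub>H\<^esub> b))"
    by (rule sw_push[OF _ _ _ _ g]) auto
  then show ?thesis using counit_left[of h] by (simp add: tensor_lift_dsum)
qed

lemma sweedler_counit_right:
  assumes [simp]: "module R P" "h \<in> carrier H" and g: "lin R H P g"
  shows "dsum P h (\<lambda>a b. \<epsilon> b \<odot>\<^bsub>P\<^esub> g a) = g h"
proof -
  note [simp] = lin_closed[OF g] lin_smult[OF g]
  have "g (dsum H h (\<lambda>a b. \<epsilon> b \<odot>\<^bsub>H\<^esub> a)) = dsum P h (\<lambda>a b. g (\<epsilon> b \<odot>\<^bsub>H\<^esub> a))"
    by (rule sw_push[OF _ _ _ _ g]) auto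
  then show ?thesis using counit_right[of h] by (simp add: tensor_lift_dsum)
qed

lemma counit_mult_osum:
  assumes [simp]: "g \<in> carrier H" "h \<in> carrier H"
  shows "\<epsilon> (g \<cdot> h) = osum KR (\<lambda>a b. \<epsilon> (g \<cdot> a) \<otimes>\<^bsub>R\<^esub> \<epsilon> (b \<cdot> h))"
    "\<epsilon> (g \<cdot> h) = osum KR (\<lambda>a b. \<epsilon> (g \<cdot> b) \<otimes>\<^bsub>R\<^esub> \<epsilon> (a \<cdot> h))"
  using counit_mult[of g "\<one>\<^bsub>H\<^esub>" h] counit_mult_op[of g "\<one>\<^bsub>H\<^esub>" h] by (simp_all add: tensor_lift_dsum)

section \<open>The counital maps and the algebras H_t and H_s\<close>

abbreviation "et \<equiv> eps_t R H"
abbreviation "es \<equiv> eps_s R H"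
abbreviation "esb \<equiv> eps_s_bar R H"

lemma et_eq: "h \<in> carrier H \<Longrightarrow> et h = osum H (\<lambda>a b. \<epsilon> (a \<cdot> h) \<odot>\<^bsub>H\<^esub> b)"
  and es_eq: "h \<in> carrier H \<Longrightarrow> es h = osum H (\<lambda>a b. \<epsilon> (h \<cdot> b) \<odot>\<^bsub>H\<^esub> a)"
  and esb_eq: "h \<in> carrier H \<Longrightarrow> esb h = osum H (\<lambda>a b. \<epsilon> (b \<cdot> h) \<odot>\<^bsub>H\<^esub> a)"
  by (simp_all add: eps_t_def eps_s_def eps_s_bar_def tensor_lift_dsum)

lemma lin_et0 [simp]: "lin R H H et" and lin_es0 [simp]: "lin R H H es" and lin_esb0 [simp]: "lin R H H esb"
  by (rule lin_cong, simp, erule et_eq es_eq esb_eq, simp)+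

lemma lin_et [simp]: "lin R A H f \<Longrightarrow> lin R A H (\<lambda>x. et (f x))"
  and lin_es [simp]: "lin R A H f \<Longrightarrow> lin R A H (\<lambda>x. es (f x))"
  and lin_esb [simp]: "lin R A H f \<Longrightarrow> lin R A H (\<lambda>x. esb (f x))"
  by (rule lin_compose[of _ H]; simp)+

lemma et_closed [simp]: "h \<in> carrier H \<Longrightarrow> et h \<in> carrier H"
  and es_closed [simp]: "h \<in> carrier H \<Longrightarrow> es h \<in> carrier H"
  and esb_closed [simp]: "h \<in> carrier H \<Longrightarrow> esb h \<in> carrier H"
  by (auto intro: lin_closed[of R H])

text \<open>Opens a counital map inside a linear context, leaving a bare sum over \<Delta>(1) that
  can be exchanged with the sums around it.\<close>

lemma lin_eps_expand:
  assumes [simp]: "module R P" "h \<in> carrier H" and g: "lin R H P g"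
  shows "g (et h) = osum P (\<lambda>a b. \<epsilon> (a \<cdot> h) \<odot>\<^bsub>P\<^esub> g b)"
    "g (es h) = osum P (\<lambda>a b. \<epsilon> (h \<cdot> b) \<odot>\<^bsub>P\<^esub> g a)"
    "g (esb h) = osum P (\<lambda>a b. \<epsilon> (b \<cdot> h) \<odot>\<^bsub>P\<^esub> g a)"
proof -
  have *: "g (osum H (\<lambda>a b. c a b \<odot>\<^bsub>H\<^esub> d a b)) = osum P (\<lambda>a b. c a b \<odot>\<^bsub>P\<^esub> g (d a b))"
    if "\<And>a b. a \<in> carrier H \<Longrightarrow> b \<in> carrier H \<Longrightarrow> c a b \<in> carrier R \<and> d a b \<in> carrier H" for c d
    by (subst sw_push[OF _ _ _ _ g]) (auto intro!: sw_cong simp: lin_smult[OF g] that)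
  show "g (et h) = osum P (\<lambda>a b. \<epsilon> (a \<cdot> h) \<odot>\<^bsub>P\<^esub> g b)"
    "g (es h) = osum P (\<lambda>a b. \<epsilon> (h \<cdot> b) \<odot>\<^bsub>P\<^esub> g a)"
    "g (esb h) = osum P (\<lambda>a b. \<epsilon> (b \<cdot> h) \<odot>\<^bsub>P\<^esub> g a)"
    by (simp_all only: et_eq es_eq esb_eq assms, subst *, simp_all, subst *, simp_all, subst *, simp_all)
qed

text \<open>The identity h1 \<otimes> et(h2) = 1_1 h \<otimes> 1_2. Writing h as 1h and opening
  \<open>et\<close> produces two copies of \<Delta>(1) multiplied in the middle; they merge into
  (\<Delta> \<otimes> H)\<Delta>(1), and the counit then acts on the coproduct of 1_1 h.\<close>

lemma comult_eps_t_right: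
  assumes [simp]: "module R P" "h \<in> carrier H" and f: "bil R H H P f"
  shows "dsum P h (\<lambda>a b. f a (et b)) = osum P (\<lambda>a b. f (a \<cdot> h) b)"
proof -
  note [simp] = bil_rules[OF f]
  have "dsum P h (\<lambda>a b. f a (et b)) = dsum P (\<one>\<^bsub>H\<^esub> \<cdot> h) (\<lambda>a b. osum P (\<lambda>e e'. \<epsilon> (e \<cdot> b) \<odot>\<^bsub>P\<^esub> f a e'))"
    by (simp add: lin_eps_expand(1)[where P=P and g="f _"])
  also have "\<dots> = osum P (\<lambda>p q. dsum P h (\<lambda>a b. osum P (\<lambda>e e'. \<epsilon> (e \<cdot> (q \<cdot> b)) \<odot>\<^bsub>P\<^esub> f (p \<cdot> a) e')))"
    by (subst sweedler_comult_mult) (simp_all add: bil_def)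
  also have "\<dots> = dsum P h (\<lambda>a b. osum P (\<lambda>p q. osum P (\<lambda>e e'. \<epsilon> ((e \<cdot> q) \<cdot> b) \<odot>\<^bsub>P\<^esub> f (p \<cdot> a) e')))"
    by (subst sw_swap) (simp_all add: H.m_assoc)
  also have "\<dots> = dsum P h (\<lambda>a b. osum P (\<lambda>e e'. dsum P e (\<lambda>p q. \<epsilon> (q \<cdot> b) \<odot>\<^bsub>P\<^esub> f (p \<cdot> a) e')))"
    by (intro sw_cong refl sweedler_one_right) (simp_all add: tril_def)
  also have "\<dots> = osum P (\<lambda>e e'. dsum P h (\<lambda>a b. dsum P e (\<lambda>p q. \<epsilon> (q \<cdot> b) \<odot>\<^bsub>P\<^esub> f (p \<cdot> a) e')))"
    by (rule sw_swap) (simp_all add: bil_def)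
  also have "\<dots> = osum P (\<lambda>e e'. dsum P e (\<lambda>p q. dsum P h (\<lambda>a b. \<epsilon> (q \<cdot> b) \<odot>\<^bsub>P\<^esub> f (p \<cdot> a) e')))"
    by (intro sw_cong refl sw_swap) (simp_all add: bil_def)
  also have "\<dots> = osum P (\<lambda>e e'. dsum P (e \<cdot> h) (\<lambda>x y. \<epsilon> y \<odot>\<^bsub>P\<^esub> f x e'))"
    by (simp add: sweedler_comult_mult bil_def)
  also have "\<dots> = osum P (\<lambda>a b. f (a \<cdot> h) b)"
    by (simp add: sweedler_counit_right)
  finally show ?thesis .
qed

text \<open>The mirror image es(h1) \<otimes> h2 = 1_1 \<otimes> h 1_2, starting from h = h1 with
  the unit on the right and splitting the right leg of \<Delta>(1).\<close>

lemma comult_eps_s_left: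
  assumes [simp]: "module R P" "h \<in> carrier H" and f: "bil R H H P f"
  shows "dsum P h (\<lambda>a b. f (es a) b) = osum P (\<lambda>a b. f a (h \<cdot> b))"
proof -
  note [simp] = bil_rules[OF f]
  have "dsum P h (\<lambda>a b. f (es a) b) = dsum P (h \<cdot> \<one>\<^bsub>H\<^esub>) (\<lambda>a b. osum P (\<lambda>e e'. \<epsilon> (a \<cdot> e') \<odot>\<^bsub>P\<^esub> f e b))"
    by (simp add: lin_eps_expand(2)[where P=P and g="\<lambda>x. f x _"])
  also have "\<dots> = dsum P h (\<lambda>a b. osum P (\<lambda>p q. osum P (\<lambda>e e'. \<epsilon> (a \<cdot> (p \<cdot> e')) \<odot>\<^bsub>P\<^esub> f e (b \<cdot> q))))"
    by (subst sweedler_comult_mult) (simp_all add: bil_def H.m_assoc)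
  also have "\<dots> = dsum P h (\<lambda>a b. osum P (\<lambda>e e'. osum P (\<lambda>p q. \<epsilon> (a \<cdot> (p \<cdot> e')) \<odot>\<^bsub>P\<^esub> f e (b \<cdot> q))))"
    by (intro sw_cong refl sw_swap) simp_all
  also have "\<dots> = dsum P h (\<lambda>a b. osum P (\<lambda>e e'. dsum P e' (\<lambda>p q. \<epsilon> (a \<cdot> p) \<odot>\<^bsub>P\<^esub> f e (b \<cdot> q))))"
    by (intro sw_cong refl sweedler_one_right_split) (simp_all add: tril_def)
  also have "\<dots> = osum P (\<lambda>e e'. dsum P (h \<cdot> e') (\<lambda>x y. \<epsilon> x \<odot>\<^bsub>P\<^esub> f e y))"
    by (subst sw_swap) (simp_all add: sweedler_comult_mult bil_def)
  also have "\<dots> = osum P (\<lambda>a b. f a (h \<cdot> b))"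
    by (simp add: sweedler_counit_left)
  finally show ?thesis .
qed

lemma counit_et [simp]:
  assumes [simp]: "g \<in> carrier H" "h \<in> carrier H"
  shows "\<epsilon> (g \<cdot> et h) = \<epsilon> (g \<cdot> h)" "\<epsilon> (es g \<cdot> h) = \<epsilon> (g \<cdot> h)" "\<epsilon> (g \<cdot> esb h) = \<epsilon> (g \<cdot> h)"
  using counit_mult_osum[OF assms]
  by (simp_all add: lin_eps_expand[where P=KR and g="\<lambda>x. \<epsilon> (g \<cdot> x)"] lin_eps_expand[where P=KR and g="\<lambda>x. \<epsilon> (x \<cdot> h)"] R.m_comm)

lemma et_mult_et:
  assumes [simp]: "g \<in> carrier H" "h \<in> carrier H"
  shows "et (g \<cdot> et h) = et (g \<cdot> h)" "es (es g \<cdot> h) = es (g \<cdot> h)"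
  by (simp_all add: et_eq[of "g \<cdot> _"] es_eq[of "_ \<cdot> h"] H.m_assoc[symmetric]) (simp_all add: H.m_assoc)

lemma et_idem [simp]: "h \<in> carrier H \<Longrightarrow> et (et h) = et h" "h \<in> carrier H \<Longrightarrow> es (es h) = es h"
  using et_mult_et(1)[of "\<one>\<^bsub>H\<^esub>" h] et_mult_et(2)[of h "\<one>\<^bsub>H\<^esub>"] by simp_all

text \<open>The case h = 1 of the two preceding identities. It justifies inserting and deleting
  projections on the legs of \<Delta>(1).\<close>

lemma osum_et:
  assumes [simp]: "module R P" and f: "bil R H H P f"
  shows "osum P (\<lambda>a b. f a (et b)) = osum P f" "osum P (\<lambda>a b. f (es a) b) = osum P f"
proof -
  have "osum P (\<lambda>a b. f (a \<cdot> \<one>\<^bsub>H\<^esub>) b) = osum P f" "osum P (\<lambda>a b. f a (\<one>\<^bsub>H\<^esub> \<cdot> b)) = osum P f"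
    by (rule sw_cong; simp)+
  then show "osum P (\<lambda>a b. f a (et b)) = osum P f" "osum P (\<lambda>a b. f (es a) b) = osum P f"
    using comult_eps_t_right[OF assms(1) H.one_closed f] comult_eps_s_left[OF assms(1) H.one_closed f] by simp_all
qed

text \<open>With both maps opened, the two products differ only in the order of the middle factors
  1_2 and 1'_1, and the two axioms for (\<Delta> \<otimes> H)\<Delta>(1) say that this order is
  immaterial.\<close>

lemma et_es_commute:
  assumes [simp]: "g \<in> carrier H" "h \<in> carrier H"
  shows "et h \<cdot> es g = es g \<cdot> et h"
proof -
  have "et h \<cdot> es g = osum H (\<lambda>a b. osum H (\<lambda>c d. \<epsilon> (a \<cdot> h) \<odot>\<^bsub>H\<^esub> (\<epsilon> (g \<cdot> d) \<odot>\<^bsub>H\<^esub> (b \<cdot> c))))"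
    by (simp add: lin_eps_expand[where P=H and g="\<lambda>x. x \<cdot> es g"])
      (simp add: lin_eps_expand[where P=H and g="\<lambda>x. _ \<cdot> x"] smult_sw)
  also have "\<dots> = osum H (\<lambda>a b. osum H (\<lambda>c d. \<epsilon> (a \<cdot> h) \<odot>\<^bsub>H\<^esub> (\<epsilon> (g \<cdot> d) \<odot>\<^bsub>H\<^esub> (c \<cdot> b))))"
    using sweedler_one_left[of H "\<lambda>a b d. \<epsilon> (a \<cdot> h) \<odot>\<^bsub>H\<^esub> (\<epsilon> (g \<cdot> d) \<odot>\<^bsub>H\<^esub> b)"]
      sweedler_one_right[of H "\<lambda>a b d. \<epsilon> (a \<cdot> h) \<odot>\<^bsub>H\<^esub> (\<epsilon> (g \<cdot> d) \<odot>\<^bsub>H\<^esub> b)"]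
    by (simp add: tril_def)
  also have "\<dots> = es g \<cdot> et h"
    by (simp add: lin_eps_expand[where P=H and g="\<lambda>x. es g \<cdot> x"])
      (simp add: lin_eps_expand[where P=H and g="\<lambda>x. x \<cdot> _"] smult_sw smult_mult_right)
  finally show ?thesis .
qed

lemma et_one [simp]: "et \<one>\<^bsub>H\<^esub> = \<one>\<^bsub>H\<^esub>" "es \<one>\<^bsub>H\<^esub> = \<one>\<^bsub>H\<^esub>"
  using sweedler_counit_left[of H "\<one>\<^bsub>H\<^esub>" "\<lambda>x. x"] sweedler_counit_right[of H "\<one>\<^bsub>H\<^esub>" "\<lambda>x. x"]
  by (simp_all add: et_eq es_eq)

text \<open>For z in H_t, \<Delta>(z) = z 1_1 \<otimes> 1_2 = 1_1 z \<otimes> 1_2. Opening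
  \<open>et\<close> puts \<Delta> on the right leg of \<Delta>(1), where the two weak unit axioms
  provide the two forms.\<close>

lemma comult_et:
  assumes [simp]: "module R P" "h \<in> carrier H" and f: "bil R H H P f"
  shows "dsum P (et h) f = osum P (\<lambda>a b. f (et h \<cdot> a) b)" (is ?A)
    and "dsum P (et h) f = osum P (\<lambda>a b. f (a \<cdot> et h) b)" (is ?B)
proof -
  note [simp] = bil_rules[OF f]
  have 1: "dsum P (et h) f = osum P (\<lambda>a b. dsum P b (\<lambda>c d. \<epsilon> (a \<cdot> h) \<odot>\<^bsub>P\<^esub> f c d))"
    by (simp add: lin_eps_expand(1)[where P=P and g="\<lambda>x. dsum P x f"] f smult_sw)
  also have "\<dots> = osum P (\<lambda>a b. osum P (\<lambda>c d. \<epsilon> (a \<cdot> h) \<odot>\<^bsub>P\<^esub> f (b \<cdot> c) d))"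
    by (rule sweedler_one_left_split[symmetric]) (simp_all add: tril_def)
  also have "\<dots> = osum P (\<lambda>c d. osum P (\<lambda>a b. \<epsilon> (a \<cdot> h) \<odot>\<^bsub>P\<^esub> f (b \<cdot> c) d))"
    by (rule sw_swap) simp_all
  finally show ?A by (simp add: lin_eps_expand(1)[where P=P and g="\<lambda>x. f (x \<cdot> _) _"])
  have "osum P (\<lambda>a b. dsum P b (\<lambda>c d. \<epsilon> (a \<cdot> h) \<odot>\<^bsub>P\<^esub> f c d)) =
     osum P (\<lambda>a b. osum P (\<lambda>c d. \<epsilon> (a \<cdot> h) \<odot>\<^bsub>P\<^esub> f (c \<cdot> b) d))"
    by (rule sweedler_one_right_split[symmetric]) (simp_all add: tril_def)
  also have "\<dots> = osum P (\<lambda>c d. osum P (\<lambda>a b. \<epsilon> (a \<cdot> h) \<odot>\<^bsub>P\<^esub> f (c \<cdot> b) d))"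
    by (rule sw_swap) simp_all
  finally show ?B by (simp add: 1 lin_eps_expand(1)[where P=P and g="\<lambda>x. f (_ \<cdot> x) _"])
qed

lemma comult_es:
  assumes [simp]: "module R P" "h \<in> carrier H" and f: "bil R H H P f"
  shows "dsum P (es h) f = osum P (\<lambda>a b. f a (es h \<cdot> b))" (is ?A)
    and "dsum P (es h) f = osum P (\<lambda>a b. f a (b \<cdot> es h))" (is ?B)
proof -
  note [simp] = bil_rules[OF f]
  have 1: "dsum P (es h) f = osum P (\<lambda>a b. dsum P a (\<lambda>c d. \<epsilon> (h \<cdot> b) \<odot>\<^bsub>P\<^esub> f c d))"
    by (simp add: lin_eps_expand(2)[where P=P and g="\<lambda>x. dsum P x f"] f smult_sw)
  also have "\<dots> = osum P (\<lambda>a b. osum P (\<lambda>c d. \<epsilon> (h \<cdot> d) \<odot>\<^bsub>P\<^esub> f a (c \<cdot> b)))"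
    by (rule sweedler_one_right[symmetric]) (simp_all add: tril_def)
  finally show ?A by (simp add: lin_eps_expand(2)[where P=P and g="\<lambda>x. f _ (x \<cdot> _)"])
  have "osum P (\<lambda>a b. dsum P a (\<lambda>c d. \<epsilon> (h \<cdot> b) \<odot>\<^bsub>P\<^esub> f c d)) =
      osum P (\<lambda>a b. osum P (\<lambda>c d. \<epsilon> (h \<cdot> d) \<odot>\<^bsub>P\<^esub> f a (b \<cdot> c)))"
    by (rule sweedler_one_left[symmetric]) (simp_all add: tril_def)
  then show ?B by (simp add: 1 lin_eps_expand(2)[where P=P and g="\<lambda>x. f _ (_ \<cdot> x)"])
qed

lemma comult_one_mult:
  assumes [simp]: "module R P" "h \<in> carrier H" and f: "bil R H H P f"
  shows "osum P (\<lambda>a b. dsum P h (\<lambda>c d. f (a \<cdot> c) (b \<cdot> d))) = dsum P h f"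
    and "dsum P h (\<lambda>a b. osum P (\<lambda>c d. f (a \<cdot> c) (b \<cdot> d))) = dsum P h f"
  using sweedler_comult_mult[OF assms(1) H.one_closed assms(2) f] sweedler_comult_mult[OF assms(1,2) H.one_closed f] by simp_all

end

section \<open>Weak Hopf algebras\<close>

locale weak_hopf_bijective = weak_hopf_algebra +
  assumes antipode_bij: "bij_betw (antipode H) (carrier H) (carrier H)"
begin

abbreviation "S \<equiv> antipode H"

lemma lin_S0 [simp]: "lin R H H S" using antipode_linear by (simp add: lin_def)
lemma lin_S [simp]: "lin R A H f \<Longrightarrow> lin R A H (\<lambda>x. S (f x))" by (rule lin_compose[of _ H]) auto
lemma S_closed [simp]: "h \<in> carrier H \<Longrightarrow> S h \<in> carrier H" by (rule lin_closed[OF lin_S0])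

lemma S_left: "h \<in> carrier H \<Longrightarrow> dsum H h (\<lambda>a b. S a \<cdot> b) = es h"
  and S_right: "h \<in> carrier H \<Longrightarrow> dsum H h (\<lambda>a b. a \<cdot> S b) = et h"
  using antipode_left[of h] antipode_right[of h] by (simp_all add: tensor_lift_dsum)

lemma lin_antipode_convolution:
  assumes [simp]: "module R P" "h \<in> carrier H" and g: "lin R H P g"
  shows "dsum P h (\<lambda>a b. g (S a \<cdot> b)) = g (es h)" "dsum P h (\<lambda>a b. g (a \<cdot> S b)) = g (et h)"
  by (simp_all add: S_left[symmetric] S_right[symmetric] sw_push[OF _ _ _ _ g])

lemma es_S:
  assumes [simp]: "h \<in> carrier H"
  shows "dsum H h (\<lambda>a b. es a \<cdot> S b) = S h"
proof -
  have "dsum H h (\<lambda>a b. dsum H a (\<lambda>c d. S c \<cdot> d \<cdot> S b)) = S h"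
    using antipode_antipode[of h] by (simp add: tensor_lift_dsum)
  then show ?thesis by (simp add: lin_antipode_convolution(1)[where g="\<lambda>x. x \<cdot> S _"])
qed

text \<open>Both this and \<open>es_S\<close> are bracketings of S(h1) h2 S(h3) = S(h).\<close>

lemma S_et:
  assumes [simp]: "h \<in> carrier H"
  shows "dsum H h (\<lambda>a b. S a \<cdot> et b) = S h"
proof -
  have "dsum H h (\<lambda>a b. S a \<cdot> et b) = dsum H h (\<lambda>a b. dsum H b (\<lambda>c d. S a \<cdot> c \<cdot> S d))"
    by (simp add: S_right[symmetric] mult_dsum H.m_assoc)
  also have "\<dots> = dsum H h (\<lambda>a b. dsum H a (\<lambda>c d. S c \<cdot> d \<cdot> S b))"
    by (rule sweedler_coassoc[symmetric]) (simp_all add: tril_def)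
  also have "\<dots> = S h" using es_S[OF assms] by (simp add: lin_antipode_convolution(1)[where g="\<lambda>x. x \<cdot> S _"])
  finally show ?thesis .
qed

text \<open>With z = \<open>et g\<close>, the value et(hz) is (hz)_1 S((hz)_2). Since \<Delta>(z) =
  1_1 z \<otimes> 1_2 and \<Delta>(h)\<Delta>(1) = \<Delta>(h), only z between h1 and S(h2)
  remains.\<close>

lemma et_mult:
  assumes [simp]: "h \<in> carrier H" "g \<in> carrier H"
  shows "et (h \<cdot> g) = dsum H h (\<lambda>a b. a \<cdot> (et g \<cdot> S b))"
proof -
  have "et (h \<cdot> g) = dsum H (h \<cdot> et g) (\<lambda>a b. a \<cdot> S b)"
    by (simp add: S_right et_mult_et)
  also have "\<dots> = dsum H h (\<lambda>a b. osum H (\<lambda>c d. (a \<cdot> c) \<cdot> (et g \<cdot> S (b \<cdot> d))))"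
    by (simp add: sweedler_comult_mult bil_def comult_et(1)[where f="\<lambda>c d. _ \<cdot> c \<cdot> S (_ \<cdot> d)"] H.m_assoc)
       (simp add: comult_et(2)[where f="\<lambda>c d. _ \<cdot> (c \<cdot> S (_ \<cdot> d))"] bil_def H.m_assoc)
  also have "\<dots> = dsum H h (\<lambda>a b. a \<cdot> (et g \<cdot> S b))"
    by (rule comult_one_mult(2)) (simp_all add: bil_def)
  finally show ?thesis .
qed

lemma es_mult:
  assumes [simp]: "h \<in> carrier H" "g \<in> carrier H"
  shows "es (h \<cdot> g) = dsum H g (\<lambda>a b. S a \<cdot> (es h \<cdot> b))"
proof -
  have "es (h \<cdot> g) = dsum H (es h \<cdot> g) (\<lambda>a b. S a \<cdot> b)"
    by (simp add: S_left et_mult_et)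
  also have "\<dots> = osum H (\<lambda>c d. dsum H g (\<lambda>a b. S (c \<cdot> a) \<cdot> (es h \<cdot> (d \<cdot> b))))"
    by (subst sweedler_comult_mult) (simp_all add: bil_def comult_es(1)[where f="\<lambda>a b. dsum H g (\<lambda>c d. S (a \<cdot> c) \<cdot> (b \<cdot> d))"] H.m_assoc)
  also have "\<dots> = dsum H g (\<lambda>a b. S a \<cdot> (es h \<cdot> b))"
    by (rule comult_one_mult(1)) (simp_all add: bil_def)
  finally show ?thesis .
qed

text \<open>A weak form of the uniqueness of convolution inverses. S(hg) = S(h1 g1) et(h2 g2), and
  the second factor unfolds to h2 g2 S(g3) S(h3). Regrouping turns S(h1 g1) h2 g2 into es(h1 g1) =
  S(g1) es(h1) g2, after which g2 S(g3) collapses to an element of H_t.\<close>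

lemma S_mult:
  assumes [simp]: "h \<in> carrier H" "g \<in> carrier H"
  shows "S (h \<cdot> g) = S g \<cdot> S h"
proof -
  have "S (h \<cdot> g) = dsum H h (\<lambda>a b. dsum H g (\<lambda>c d. S (a \<cdot> c) \<cdot> et (b \<cdot> d)))"
    by (subst S_et[symmetric]) (simp_all add: sweedler_comult_mult bil_def)
  also have "\<dots> = dsum H h (\<lambda>a b. dsum H g (\<lambda>c d. dsum H b (\<lambda>p q. dsum H d (\<lambda>r s. S (a \<cdot> c) \<cdot> (p \<cdot> r) \<cdot> (S s \<cdot> S q)))))"
    by (simp add: et_mult mult_dsum) (simp add: S_right[symmetric] mult_dsum dsum_mult H.m_assoc)
  also have "\<dots> = dsum H h (\<lambda>a b. dsum H b (\<lambda>p q. dsum H g (\<lambda>c d. dsum H d (\<lambda>r s. S (a \<cdot> c) \<cdot> (p \<cdot> r) \<cdot> (S s \<cdot> S q)))))"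
    by (intro sw_cong refl sw_swap) simp_all
  also have "\<dots> = dsum H h (\<lambda>a q. dsum H a (\<lambda>x p. dsum H g (\<lambda>c d. dsum H d (\<lambda>r s. S (x \<cdot> c) \<cdot> (p \<cdot> r) \<cdot> (S s \<cdot> S q)))))"
    by (rule sweedler_coassoc[symmetric]) (simp_all add: tril_def bil_def)
  also have "\<dots> = dsum H h (\<lambda>a q. dsum H a (\<lambda>x p. dsum H g (\<lambda>c s. dsum H c (\<lambda>y r. S (x \<cdot> y) \<cdot> (p \<cdot> r) \<cdot> (S s \<cdot> S q)))))"
    by (intro sw_cong refl sweedler_coassoc[symmetric]) (simp_all add: tril_def bil_def)
  also have "\<dots> = dsum H h (\<lambda>a q. dsum H g (\<lambda>c s. dsum H a (\<lambda>x p. dsum H c (\<lambda>y r. S (x \<cdot> y) \<cdot> (p \<cdot> r) \<cdot> (S s \<cdot> S q)))))"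
    by (intro sw_cong refl sw_swap) simp_all
  also have "\<dots> = dsum H h (\<lambda>a q. dsum H g (\<lambda>c s. dsum H (a \<cdot> c) (\<lambda>u v. S u \<cdot> v \<cdot> (S s \<cdot> S q))))"
    by (simp add: sweedler_comult_mult bil_def)
  also have "\<dots> = dsum H h (\<lambda>a q. dsum H g (\<lambda>c s. dsum H c (\<lambda>y r. S y \<cdot> (es a \<cdot> r) \<cdot> (S s \<cdot> S q))))"
    by (simp add: lin_antipode_convolution(1)[where g="\<lambda>x. x \<cdot> (S _ \<cdot> S _)"] es_mult dsum_mult)
  also have "\<dots> = dsum H h (\<lambda>a q. dsum H g (\<lambda>y c. dsum H c (\<lambda>r s. S y \<cdot> (es a \<cdot> r) \<cdot> (S s \<cdot> S q))))"
    by (intro sw_cong refl sweedler_coassoc) (simp_all add: tril_def bil_def)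
  also have "\<dots> = dsum H h (\<lambda>a q. dsum H g (\<lambda>y c. (S y \<cdot> et c) \<cdot> (es a \<cdot> S q)))"
  proof (intro sw_cong refl)
    fix a q y c assume [simp]: "a \<in> carrier H" "q \<in> carrier H" "y \<in> carrier H" "c \<in> carrier H"
    have "dsum H c (\<lambda>r s. S y \<cdot> (es a \<cdot> r) \<cdot> (S s \<cdot> S q)) = dsum H c (\<lambda>r s. S y \<cdot> (es a \<cdot> ((r \<cdot> S s) \<cdot> S q)))"
      by (simp add: H.m_assoc)
    also have "\<dots> = S y \<cdot> (es a \<cdot> (et c \<cdot> S q))"
      by (simp add: lin_antipode_convolution(2)[where g="\<lambda>x. S y \<cdot> (es a \<cdot> (x \<cdot> S q))"])
    \<comment> \<open>Moving \<open>et c\<close> past \<open>es a\<close> separates the components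
      of \<open>g\<close> from those of \<open>h\<close>.\<close>
    also have "\<dots> = (S y \<cdot> et c) \<cdot> (es a \<cdot> S q)"
      by (simp add: H.m_assoc[symmetric] et_es_commute) (simp add: H.m_assoc et_es_commute)
    finally show "dsum H c (\<lambda>r s. S y \<cdot> (es a \<cdot> r) \<cdot> (S s \<cdot> S q)) = (S y \<cdot> et c) \<cdot> (es a \<cdot> S q)" .
  qed
  also have "\<dots> = S g \<cdot> S h"
    by (simp add: dsum_mult[symmetric] mult_dsum[symmetric] S_et es_S)
  finally show ?thesis .
qed

lemma S_one [simp]: "S \<one>\<^bsub>H\<^esub> = \<one>\<^bsub>H\<^esub>"
proof -
  have "S \<one>\<^bsub>H\<^esub> = osum H (\<lambda>a b. S a \<cdot> b)"
    using S_et[of "\<one>\<^bsub>H\<^esub>"] osum_et(1)[of H "\<lambda>a b. S a \<cdot> b"] by (simp add: bil_def)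
  then show ?thesis by (simp add: S_left)
qed

text \<open>For y in H_s, \<Delta>(y) = 1_1 \<otimes> y 1_2, so y_1 S(y_2) = 1_1 S(1_2) S(y) = S(y).
  The case of H_t is symmetric.\<close>

lemma S_et_es:
  assumes [simp]: "h \<in> carrier H"
  shows "S (es h) = et (es h)" "S (et h) = es (et h)"
proof -
  have "et (es h) = dsum H (es h) (\<lambda>a b. a \<cdot> S b)" by (simp add: S_right)
  also have "\<dots> = osum H (\<lambda>a b. a \<cdot> S b) \<cdot> S (es h)"
    by (subst comult_es(1)) (simp_all add: bil_def S_mult dsum_mult H.m_assoc)
  finally show "S (es h) = et (es h)" by (simp add: S_right)
  have "es (et h) = dsum H (et h) (\<lambda>a b. S a \<cdot> b)" by (simp add: S_left)
  also have "\<dots> = S (et h) \<cdot> osum H (\<lambda>a b. S a \<cdot> b)"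
    by (subst comult_et(2)) (simp_all add: bil_def S_mult mult_dsum H.m_assoc)
  finally show "S (et h) = es (et h)" by (simp add: S_left)
qed

text \<open>Once the legs carry \<open>es\<close> and \<open>et\<close>, the antipode acts on them
  as a counital map and can be replaced by one. Opening both counital maps gives three copies of
  \<Delta>(1); the original copy is contracted by weak multiplicativity of \<epsilon>, and what
  remains is 1_1 \<otimes> et(1_2).\<close>

lemma osum_S_flip:
  assumes [simp]: "module R P" and f: "bil R H H P f"
  shows "osum P (\<lambda>a b. f (S b) (S a)) = osum P f"
proof -
  interpret P: module R P by fact
  note [simp] = bil_rules[OF f]
  have b: "bil R H H P (\<lambda>a b. f (S b) (S a))" "bil R H H P (\<lambda>a b. f (es b) (et a))"
    "bil R H H P (\<lambda>a b. f (es b) (et (es a)))" "bil R H H P (\<lambda>a b. f (S b) (S (es a)))"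
    by (simp_all add: bil_def)
  have "osum P (\<lambda>a b. f (S b) (S a)) = osum P (\<lambda>a b. f (S (et b)) (S (es a)))"
    using osum_et(2)[OF _ b(1)] osum_et(1)[OF _ b(4)] by simp
  also have "\<dots> = osum P (\<lambda>a b. f (es (et b)) (et (es a)))"
    by (simp add: S_et_es)
  also have "\<dots> = osum P (\<lambda>a b. f (es b) (et a))"
    using osum_et(2)[OF _ b(2)] osum_et(1)[OF _ b(3)] by simp
  also have "\<dots> = osum P (\<lambda>a b. osum P (\<lambda>c d. osum P (\<lambda>p q. (\<epsilon> (p \<cdot> a) \<otimes>\<^bsub>R\<^esub> \<epsilon> (b \<cdot> d)) \<odot>\<^bsub>P\<^esub> f c q)))"
    by (simp add: lin_eps_expand(2)[where P=P and g="\<lambda>x. f x _"])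
      (simp add: lin_eps_expand(1)[where P=P and g="\<lambda>x. f _ x"] smult_sw P.smult_assoc1[symmetric] R.m_comm)
  also have "\<dots> = osum P (\<lambda>c d. osum P (\<lambda>a b. osum P (\<lambda>p q. (\<epsilon> (p \<cdot> a) \<otimes>\<^bsub>R\<^esub> \<epsilon> (b \<cdot> d)) \<odot>\<^bsub>P\<^esub> f c q)))"
    by (rule sw_swap) simp_all
  also have "\<dots> = osum P (\<lambda>c d. osum P (\<lambda>p q. osum P (\<lambda>a b. (\<epsilon> (p \<cdot> a) \<otimes>\<^bsub>R\<^esub> \<epsilon> (b \<cdot> d)) \<odot>\<^bsub>P\<^esub> f c q)))"
    by (intro sw_cong refl sw_swap) simp_all
  also have "\<dots> = osum P (\<lambda>c d. f c (et d))"
    by (simp add: sw_smult[symmetric] counit_mult_osum(1)[symmetric] lin_eps_expand(1)[where P=P and g="\<lambda>x. f _ x"])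
  also have "\<dots> = osum P f" by (rule osum_et(1)[OF _ f]) simp
  finally show ?thesis .
qed

text \<open>The formula that \<Delta>(h1 S(h2)) would give if S were known to reverse coproducts. It
  is obtained independently: the inner h2 S(h3) is \<open>et\<close>, and h1 \<otimes> et(h2) = 1_1
  h \<otimes> 1_2 does the rest. The proof of \<open>comult_S\<close> builds on it.\<close>

lemma comult_et_unfold:
  assumes [simp]: "module R P" "h \<in> carrier H" and f: "bil R H H P f"
  shows "dsum P h (\<lambda>a b. dsum P a (\<lambda>p q. dsum P b (\<lambda>r s. f (p \<cdot> S s) (q \<cdot> S r)))) = dsum P (et h) f"
proof -
  note [simp] = bil_rules[OF f]
  have "dsum P h (\<lambda>a b. dsum P a (\<lambda>p q. dsum P b (\<lambda>r s. f (p \<cdot> S s) (q \<cdot> S r)))) =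
     dsum P h (\<lambda>p t. dsum P t (\<lambda>q b. dsum P b (\<lambda>r s. f (p \<cdot> S s) (q \<cdot> S r))))"
    by (rule sweedler_coassoc) (simp_all add: tril_def bil_def)
  also have "\<dots> = dsum P h (\<lambda>p t. dsum P t (\<lambda>u s. dsum P u (\<lambda>q r. f (p \<cdot> S s) (q \<cdot> S r))))"
    by (intro sw_cong refl sweedler_coassoc[symmetric]) (simp_all add: tril_def bil_def)
  also have "\<dots> = dsum P h (\<lambda>p t. dsum P t (\<lambda>u s. f (p \<cdot> S s) (et u)))"
    by (simp add: lin_antipode_convolution(2)[where g="f _"])
  also have "\<dots> = dsum P h (\<lambda>a s. dsum P a (\<lambda>p u. f (p \<cdot> S s) (et u)))"
    by (intro sweedler_coassoc[symmetric]) (simp_all add: tril_def bil_def)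
  also have "\<dots> = dsum P h (\<lambda>a s. osum P (\<lambda>x y. f (x \<cdot> (a \<cdot> S s)) y))"
    by (intro sw_cong refl trans[OF comult_eps_t_right]) (simp_all add: bil_def H.m_assoc)
  also have "\<dots> = osum P (\<lambda>x y. dsum P h (\<lambda>a s. f (x \<cdot> (a \<cdot> S s)) y))"
    by (intro sw_swap) simp_all
  also have "\<dots> = osum P (\<lambda>x y. f (x \<cdot> et h) y)"
    by (simp add: lin_antipode_convolution(2)[where g="\<lambda>u. f (_ \<cdot> u) _"])
  also have "\<dots> = dsum P (et h) f" by (rule comult_et(2)[symmetric, OF _ _ f]) simp_all
  finally show ?thesis .
qed

text \<open>\<Delta>(S h) = \<Delta>(S h1) \<Delta>(et h2), with the last factor unfolded. Then
  \<Delta>(S h1)\<Delta>(h2) becomes the coproduct of an element of H_s, whose factor is absorbed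
  through es(h1) S(h2) = S(h). This leaves S(h2) \<otimes> S(h1) with \<Delta>(1) in front.\<close>

lemma comult_S:
  assumes [simp]: "module R P" "h \<in> carrier H" and f: "bil R H H P f"
  shows "dsum P (S h) f = dsum P h (\<lambda>a b. f (S b) (S a))"
proof -
  note [simp] = bil_rules[OF f]
  have "dsum P (S h) f = dsum P (dsum H h (\<lambda>a b. S a \<cdot> et b)) f" by (simp add: S_et)
  also have "\<dots> = dsum P h (\<lambda>a b. dsum P (S a \<cdot> et b) f)"
    by (rule sw_push[where g="\<lambda>x. dsum P x f"]) (simp_all add: f)
  also have "\<dots> = dsum P h (\<lambda>a b. dsum P (S a) (\<lambda>x y. dsum P (et b) (\<lambda>c d. f (x \<cdot> c) (y \<cdot> d))))"
    by (simp add: sweedler_comult_mult f)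
  also have "\<dots> = dsum P h (\<lambda>a b. dsum P (S a) (\<lambda>x y. dsum P b (\<lambda>b1 b2. dsum P b1 (\<lambda>p q. dsum P b2 (\<lambda>r s. f (x \<cdot> (p \<cdot> S s)) (y \<cdot> (q \<cdot> S r)))))))"
    by (intro sw_cong refl comult_et_unfold[symmetric]) (simp_all add: bil_def)
  also have "\<dots> = dsum P h (\<lambda>a b. dsum P b (\<lambda>b1 b2. dsum P (S a) (\<lambda>x y. dsum P b1 (\<lambda>p q. dsum P b2 (\<lambda>r s. f (x \<cdot> (p \<cdot> S s)) (y \<cdot> (q \<cdot> S r)))))))"
    by (intro sw_cong refl sw_swap) (simp_all)
  also have "\<dots> = dsum P h (\<lambda>c b2. dsum P c (\<lambda>a b1. dsum P (S a) (\<lambda>x y. dsum P b1 (\<lambda>p q. dsum P b2 (\<lambda>r s. f (x \<cdot> (p \<cdot> S s)) (y \<cdot> (q \<cdot> S r)))))))"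
    by (rule sweedler_coassoc[symmetric]) (simp_all add: tril_def bil_def)
  also have "\<dots> = dsum P h (\<lambda>c b2. dsum P c (\<lambda>a b1. dsum P (S a \<cdot> b1) (\<lambda>u v. dsum P b2 (\<lambda>r s. f (u \<cdot> S s) (v \<cdot> S r)))))"
    by (simp add: sweedler_comult_mult bil_def H.m_assoc)
  also have "\<dots> = dsum P h (\<lambda>c b2. dsum P (es c) (\<lambda>u v. dsum P b2 (\<lambda>r s. f (u \<cdot> S s) (v \<cdot> S r))))"
    by (simp add: lin_antipode_convolution(1)[where g="\<lambda>x. dsum P x (\<lambda>u v. dsum P _ (\<lambda>r s. f (u \<cdot> S s) (v \<cdot> S r)))"] bil_def)
  also have "\<dots> = dsum P h (\<lambda>c b2. osum P (\<lambda>u v. dsum P b2 (\<lambda>r s. f (u \<cdot> S s) (v \<cdot> es c \<cdot> S r))))"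
    by (intro sw_cong refl trans[OF comult_es(2)]) (simp_all add: bil_def)
  also have "\<dots> = dsum P h (\<lambda>c b2. dsum P b2 (\<lambda>r s. osum P (\<lambda>u v. f (u \<cdot> S s) (v \<cdot> es c \<cdot> S r))))"
    by (intro sw_cong refl sw_swap) (simp_all)
  also have "\<dots> = dsum P h (\<lambda>k s. dsum P k (\<lambda>c r. osum P (\<lambda>u v. f (u \<cdot> S s) (v \<cdot> es c \<cdot> S r))))"
    by (rule sweedler_coassoc[symmetric]) (simp_all add: tril_def bil_def)
  also have "\<dots> = dsum P h (\<lambda>k s. osum P (\<lambda>u v. dsum P k (\<lambda>c r. f (u \<cdot> S s) (v \<cdot> (es c \<cdot> S r)))))"
    by (simp add: H.m_assoc, intro sw_cong refl sw_swap) (simp_all)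
  also have "\<dots> = dsum P h (\<lambda>k s. osum P (\<lambda>u v. f (u \<cdot> S s) (v \<cdot> S k)))"
    by (simp add: sw_push[where g="\<lambda>x. f (_ \<cdot> S _) (_ \<cdot> x)" and Q=P and P=H, symmetric] es_S)
  \<comment> \<open>Written as the image of its own flip under S, the leftover \<Delta>(1) moves
    inside S to the right of \<Delta>(h), where it is absorbed.\<close>
  also have "\<dots> = dsum P h (\<lambda>k s. osum P (\<lambda>u v. f (S v \<cdot> S s) (S u \<cdot> S k)))"
    by (intro sw_cong refl osum_S_flip[symmetric]) (simp_all add: bil_def)
  also have "\<dots> = dsum P h (\<lambda>k s. osum P (\<lambda>u v. f (S (s \<cdot> v)) (S (k \<cdot> u))))"
    by (simp add: S_mult)
  also have "\<dots> = dsum P h (\<lambda>a b. f (S b) (S a))"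
    by (rule comult_one_mult(2)) (simp_all add: bil_def)
  finally show ?thesis .
qed

text \<open>The counit ignores \<open>es\<close> on a left factor, so \<epsilon>(es(h1) S(h2)) =
  \<epsilon>(h1 S(h2)) = \<epsilon>(et h).\<close>

lemma counit_S [simp]:
  assumes [simp]: "h \<in> carrier H"
  shows "\<epsilon> (S h) = \<epsilon> h"
proof -
  have "\<epsilon> (S h) = \<epsilon> (dsum H h (\<lambda>a b. es a \<cdot> S b))" by (simp add: es_S)
  also have "\<dots> = \<epsilon> (dsum H h (\<lambda>a b. a \<cdot> S b))" by (simp add: counit_dsum)
  also have "\<dots> = \<epsilon> h" using counit_et(1)[of "\<one>\<^bsub>H\<^esub>" h] by (simp add: S_right)
  finally show ?thesis .
qed

section \<open>The inverse antipode\<close>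

abbreviation "T \<equiv> inv_into (carrier H) S"

lemma T_closed [simp]: "h \<in> carrier H \<Longrightarrow> T h \<in> carrier H"
  using antipode_bij by (simp add: bij_betw_def inv_into_into)

lemma T_S [simp]: "h \<in> carrier H \<Longrightarrow> T (S h) = h" and S_T [simp]: "h \<in> carrier H \<Longrightarrow> S (T h) = h"
  using antipode_bij by (simp_all add: bij_betw_inv_into_left bij_betw_inv_into_right)

lemma S_eqD: "S g = S h \<Longrightarrow> g \<in> carrier H \<Longrightarrow> h \<in> carrier H \<Longrightarrow> g = h"
  using T_S by metis

lemma lin_T0 [simp]: "lin R H H T"
  by (rule linI, simp; rule S_eqD; simp add: lin_add[OF lin_S0] lin_smult[OF lin_S0])

lemma lin_T [simp]: "lin R A H f \<Longrightarrow> lin R A H (\<lambda>x. T (f x))" by (rule lin_compose[of _ H]) auto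

lemma T_mult: "g \<in> carrier H \<Longrightarrow> h \<in> carrier H \<Longrightarrow> T (g \<cdot> h) = T h \<cdot> T g"
  by (rule S_eqD) (simp_all add: S_mult)

lemma T_one [simp]: "T \<one>\<^bsub>H\<^esub> = \<one>\<^bsub>H\<^esub>" by (rule S_eqD) simp_all

lemma counit_T [simp]: "h \<in> carrier H \<Longrightarrow> \<epsilon> (T h) = \<epsilon> h" using counit_S[of "T h"] by simp

lemma comult_T:
  assumes [simp]: "module R P" "h \<in> carrier H" and f: "bil R H H P f"
  shows "dsum P (T h) f = dsum P h (\<lambda>a b. f (T b) (T a))"
proof -
  note [simp] = bil_rules[OF f]
  show ?thesis using comult_S[of P "T h" "\<lambda>a b. f (T b) (T a)"] by (simp add: bil_def)
qed

lemma osum_T_flip: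
  assumes [simp]: "module R P" and f: "bil R H H P f"
  shows "osum P (\<lambda>a b. f (T b) (T a)) = osum P f"
  using comult_T[OF assms(1) H.one_closed f] by simp

text \<open>Applying the injective, product-reversing S turns both claims into the antipode axioms.
  Note the reversed order of the components.\<close>

lemma antipode_inv_convolution: 
  assumes [simp]: "h \<in> carrier H"
  shows "dsum H h (\<lambda>a b. T b \<cdot> a) = T (es h)" "dsum H h (\<lambda>a b. b \<cdot> T a) = T (et h)"
proof -
  show "dsum H h (\<lambda>a b. T b \<cdot> a) = T (es h)"
    by (rule S_eqD) (simp_all add: sw_push[where g=S and Q=H and P=H] S_mult S_left)
  show "dsum H h (\<lambda>a b. b \<cdot> T a) = T (et h)"
    by (rule S_eqD) (simp_all add: sw_push[where g=S and Q=H and P=H] S_mult S_right)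
qed

text \<open>It identifies the right unit constraint of the dual: \<open>esb z\<close> acts on a form
  by precomposition with S(esb z), which for z in H_t is z itself. In the proof S(1_1) becomes
  et(1_1), and two counits contract.\<close>

lemma S_esb:
  assumes [simp]: "h \<in> carrier H"
  shows "S (esb h) = et h"
proof -
  have "S (esb h) = osum H (\<lambda>a b. \<epsilon> (b \<cdot> h) \<odot>\<^bsub>H\<^esub> S a)"
    by (simp add: lin_eps_expand(3)[where g=S and P=H])
  also have "\<dots> = osum H (\<lambda>a b. \<epsilon> (b \<cdot> h) \<odot>\<^bsub>H\<^esub> S (es a))"
    by (rule osum_et(2)[symmetric]) (simp_all add: bil_def)
  also have "\<dots> = osum H (\<lambda>a b. \<epsilon> (b \<cdot> h) \<odot>\<^bsub>H\<^esub> et (es a))"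
    by (simp add: S_et_es)
  also have "\<dots> = osum H (\<lambda>a b. \<epsilon> (b \<cdot> h) \<odot>\<^bsub>H\<^esub> et a)"
    by (rule osum_et(2)) (simp_all add: bil_def)
  also have "\<dots> = osum H (\<lambda>a b. osum H (\<lambda>p q. (\<epsilon> (p \<cdot> a) \<otimes>\<^bsub>R\<^esub> \<epsilon> (b \<cdot> h)) \<odot>\<^bsub>H\<^esub> q))"
    by (simp add: et_eq smult_sw smult_assoc1[symmetric] R.m_comm)
  also have "\<dots> = osum H (\<lambda>p q. osum H (\<lambda>a b. (\<epsilon> (p \<cdot> a) \<otimes>\<^bsub>R\<^esub> \<epsilon> (b \<cdot> h)) \<odot>\<^bsub>H\<^esub> q))"
    by (rule sw_swap) simp_all
  also have "\<dots> = et h"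
    by (simp add: sw_smult[symmetric] counit_mult_osum(1)[symmetric] et_eq)
  finally show ?thesis .
qed

lemma lin_antipode_inv_convolution:
  assumes [simp]: "module R P" "h \<in> carrier H" and g: "lin R H P g"
  shows "dsum P h (\<lambda>a b. g (T b \<cdot> a)) = g (T (es h))" "dsum P h (\<lambda>a b. g (b \<cdot> T a)) = g (T (et h))"
  by (simp_all add: antipode_inv_convolution[symmetric] sw_push[OF _ _ _ _ g])

text \<open>Opening \<open>esb\<close> and summing over the other copy of \<Delta>(1) first gives
  1_1 \<otimes> T(es(1_2)). On H_t the map \<open>es\<close> is S, so T cancels it.\<close>

lemma osum_esb_T:
  assumes [simp]: "module R P" and f: "bil R H H P f"
  shows "osum P (\<lambda>p q. f (esb q) (T p)) = osum P f"
proof -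
  note [simp] = bil_rules[OF f]
  have b: "bil R H H P (\<lambda>a b. f a (T (es b)))" by (simp add: bil_def)
  have "osum P (\<lambda>p q. f (esb q) (T p)) = osum P (\<lambda>p q. osum P (\<lambda>a b. \<epsilon> (b \<cdot> q) \<odot>\<^bsub>P\<^esub> f a (T p)))"
    by (simp add: lin_eps_expand(3)[where P=P and g="\<lambda>x. f x _"])
  also have "\<dots> = osum P (\<lambda>a b. osum P (\<lambda>p q. \<epsilon> (b \<cdot> q) \<odot>\<^bsub>P\<^esub> f a (T p)))"
    by (rule sw_swap) simp_all
  also have "\<dots> = osum P (\<lambda>a b. f a (T (es b)))"
    by (simp add: lin_eps_expand(2)[where P=P and g="\<lambda>x. f _ (T x)"])
  also have "\<dots> = osum P (\<lambda>a b. f a (T (es (et b))))"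
    by (rule osum_et(1)[symmetric, OF _ b]) simp
  also have "\<dots> = osum P (\<lambda>a b. f a (et b))"
    by (simp add: S_et_es[symmetric])
  also have "\<dots> = osum P f" by (rule osum_et(1)[OF _ f]) simp
  finally show ?thesis .
qed

text \<open>S(1'_2) may be replaced by es(1'_2). Opening that map, the copy 1'_1 \<otimes> 1'_2 is
  contracted by the counit and es(1_1) \<otimes> 1_2 is left.\<close>

lemma osum_counit_S:
  assumes [simp]: "module R P" and f: "bil R H H P f"
  shows "osum P (\<lambda>p q. osum P (\<lambda>a b. \<epsilon> (p \<cdot> a) \<odot>\<^bsub>P\<^esub> f (S b) q)) = osum P f"
proof -
  interpret P: module R P by fact
  note [simp] = bil_rules[OF f]
  have "osum P (\<lambda>p q. osum P (\<lambda>a b. \<epsilon> (p \<cdot> a) \<odot>\<^bsub>P\<^esub> f (S b) q)) = osum P (\<lambda>p q. osum P (\<lambda>a b. \<epsilon> (p \<cdot> a) \<odot>\<^bsub>P\<^esub> f (S (et b)) q))"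
    by (intro sw_cong refl osum_et(1)[symmetric]) (simp_all add: bil_def)
  also have "\<dots> = osum P (\<lambda>p q. osum P (\<lambda>a b. \<epsilon> (p \<cdot> a) \<odot>\<^bsub>P\<^esub> f (es (et b)) q))"
    by (simp add: S_et_es)
  also have "\<dots> = osum P (\<lambda>p q. osum P (\<lambda>a b. \<epsilon> (p \<cdot> a) \<odot>\<^bsub>P\<^esub> f (es b) q))"
    by (intro sw_cong refl osum_et(1)) (simp_all add: bil_def)
  also have "\<dots> = osum P (\<lambda>p q. osum P (\<lambda>a b. osum P (\<lambda>x y. (\<epsilon> (p \<cdot> a) \<otimes>\<^bsub>R\<^esub> \<epsilon> (b \<cdot> y)) \<odot>\<^bsub>P\<^esub> f x q)))"
    by (simp add: lin_eps_expand(2)[where P=P and g="\<lambda>x. f x _"] smult_sw P.smult_assoc1)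
  also have "\<dots> = osum P (\<lambda>p q. osum P (\<lambda>x y. osum P (\<lambda>a b. (\<epsilon> (p \<cdot> a) \<otimes>\<^bsub>R\<^esub> \<epsilon> (b \<cdot> y)) \<odot>\<^bsub>P\<^esub> f x q)))"
    by (intro sw_cong refl sw_swap) simp_all
  also have "\<dots> = osum P (\<lambda>p q. f (es p) q)"
    by (simp add: sw_smult[symmetric] counit_mult_osum(1)[symmetric] lin_eps_expand(2)[where P=P and g="\<lambda>x. f x _"])
  also have "\<dots> = osum P f" by (rule osum_et(2)[OF _ f]) simp
  finally show ?thesis .
qed

text \<open>With \<open>esb\<close> opened the sum is (H \<otimes>
  \<epsilon>)(\<Delta>(1)\<Delta>(1)), and \<Delta>(1) is idempotent.\<close>

lemma osum_esb: "osum H (\<lambda>a b. esb b \<cdot> a) = \<one>\<^bsub>H\<^esub>"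
proof -
  have "osum H (\<lambda>a b. esb b \<cdot> a) = osum H (\<lambda>a b. osum H (\<lambda>p q. \<epsilon> (q \<cdot> b) \<odot>\<^bsub>H\<^esub> (p \<cdot> a)))"
    by (simp add: lin_eps_expand(3)[where P=H and g="\<lambda>x. x \<cdot> _"])
  also have "\<dots> = osum H (\<lambda>p q. osum H (\<lambda>a b. \<epsilon> (q \<cdot> b) \<odot>\<^bsub>H\<^esub> (p \<cdot> a)))"
    by (rule sw_swap) simp_all
  also have "\<dots> = osum H (\<lambda>a b. \<epsilon> b \<odot>\<^bsub>H\<^esub> a)"
    by (rule comult_one_mult(1)) (simp_all add: bil_def)
  also have "\<dots> = \<one>\<^bsub>H\<^esub>" by (rule sweedler_counit_right) simp_all
  finally show ?thesis .
qed

end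

section \<open>Yetter-Drinfeld modules\<close>

locale yd_hopf = weak_hopf_bijective R H + yetter_drinfeld R H M
  for R :: "('k, 'z) ring_scheme" and H :: "('k, 'h, 'y) weak_hopf_scheme" and M :: "('k, 'h, 'm) yd_mod"
begin

section \<open>Sweedler calculus for the coaction\<close>

abbreviation am (infixr \<open>\<rhd>\<close> 75) where "h \<rhd> m \<equiv> act M h m"
abbreviation "HM \<equiv> tensor_module R H M"
abbreviation csum where "csum P m f \<equiv> sw R H M P (coact M m) f"

lemma mod_M [simp]: "module R M" by (rule M.module_axioms)

lemma lin_act1 [simp]: "lin R A H f \<Longrightarrow> m \<in> carrier M \<Longrightarrow> lin R A M (\<lambda>x. f x \<rhd> m)"
  by (rule lin_compose[where g="\<lambda>h. h \<rhd> m" and M=H]) (use act_linear_left[of m] in \<open>simp_all add: lin_def\<close>)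
lemma lin_act2 [simp]: "lin R A M f \<Longrightarrow> h \<in> carrier H \<Longrightarrow> lin R A M (\<lambda>x. h \<rhd> f x)"
  by (rule lin_compose[where g="act M h" and M=M]) (use act_linear_right[of h] in \<open>simp_all add: lin_def\<close>)
lemma act_closed [simp]: "h \<in> carrier H \<Longrightarrow> m \<in> carrier M \<Longrightarrow> h \<rhd> m \<in> carrier M"
  using lin_closed[OF lin_act2[OF lin_id]] .
lemma lin_coact0 [simp]: "lin R M HM (coact M)" using coact_linear by (simp add: lin_def)
lemma lin_coact [simp]: "lin R A M f \<Longrightarrow> lin R A HM (\<lambda>x. coact M (f x))" by (rule lin_compose[of _ M]) auto
lemma coact_closed [simp]: "m \<in> carrier M \<Longrightarrow> coact M m \<in> carrier HM" by (rule lin_closed[OF lin_coact0])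

declare act_one [simp]

lemma tensor_lift_csum:
  assumes "module R P" "m \<in> carrier M" "\<And>a b. a \<in> carrier H \<Longrightarrow> b \<in> carrier M \<Longrightarrow> f a b \<in> carrier P"
  shows "tensor_lift R P f (coact M m) = csum P m f"
  using assms by (intro sw_eq_tensor_lift) auto

lemma sweedler_coact_coassoc:
  assumes [simp]: "module R P" "m \<in> carrier M" and f: "tril R H H M P f"
  shows "csum P m (\<lambda>a x. dsum P a (\<lambda>b c. f b c x)) = csum P m (\<lambda>a x. csum P x (\<lambda>b y. f a b y))"
proof -
  note [simp] = tril_closed[OF f] f[unfolded tril_def, rule_format]
  have [simp]: "bil R HH M P (\<lambda>x d. sw R H H P x (\<lambda>a b. f a b d))"
    by (simp add: bil_def)
  let ?Q = "tensor_module R HH M"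
  have "csum ?Q m (\<lambda>a x. pure_tensor R HH M (comult H a) x) =
    csum ?Q m (\<lambda>a x. csum ?Q x (\<lambda>b y. pure_tensor R HH M (pHH a b) y))"
    using coact_coassoc[of m] by (simp add: tensor_lift_csum)
  from arg_cong[OF this, of "\<lambda>X. sw R HH M P X (\<lambda>x d. sw R H H P x (\<lambda>a b. f a b d))"]
  show ?thesis by (simp add: sw_sw sw_pure bil_def)
qed

lemma sweedler_coact_counit:
  assumes [simp]: "module R P" "m \<in> carrier M" and g: "lin R M P g"
  shows "csum P m (\<lambda>a x. \<epsilon> a \<odot>\<^bsub>P\<^esub> g x) = g m"
proof -
  note [simp] = lin_closed[OF g] lin_smult[OF g]
  have "g (csum M m (\<lambda>a b. \<epsilon> a \<odot>\<^bsub>M\<^esub> b)) = csum P m (\<lambda>a b. g (\<epsilon> a \<odot>\<^bsub>M\<^esub> b))"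
    by (rule sw_push[OF _ _ _ _ g]) auto
  then show ?thesis using coact_counit[of m] by (simp add: tensor_lift_csum)
qed

lemma sw_tensor_act:
  assumes [simp]: "module R P" "g \<in> carrier H" "Y \<in> carrier HM" and f: "bil R H M P f"
  shows "sw R H M P (tensor_act R H M (monoid.mult H) (act M) (comult H g) Y) f =
    dsum P g (\<lambda>a b. sw R H M P Y (\<lambda>c x. f (a \<cdot> c) (b \<rhd> x)))"
proof -
  note [simp] = bil_rules[OF f]
  have "tensor_act R H M (monoid.mult H) (act M) (comult H g) Y =
      dsum HM g (\<lambda>a b. sw R H M HM Y (\<lambda>c x. pure_tensor R H M (a \<cdot> c) (b \<rhd> x)))"
    by (simp add: tensor_act_def tensor_map_def tensor_lift_dsum sw_eq_tensor_lift[of R H M])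
  then show ?thesis by (simp add: sw_sw sw_pure f)
qed

text \<open>The coaction takes values in the image of multiplication by \<Delta>(1), which is
  idempotent.\<close>

lemma coact_t:
  assumes [simp]: "module R P" "m \<in> carrier M" and f: "bil R H M P f"
  shows "osum P (\<lambda>a b. csum P m (\<lambda>c x. f (a \<cdot> c) (b \<rhd> x))) = csum P m f"
proof -
  note [simp] = bil_rules[OF f]
  obtain Y where Y [simp]: "Y \<in> carrier HM" and c: "coact M m = tensor_act R H M (monoid.mult H) (act M) (comult H \<one>\<^bsub>H\<^esub>) Y"
    using coact_in_tensor_t[of m] by (auto simp: tensor_t_def)
  have "osum P (\<lambda>a b. csum P m (\<lambda>c x. f (a \<cdot> c) (b \<rhd> x))) =
      osum P (\<lambda>a b. osum P (\<lambda>p q. sw R H M P Y (\<lambda>c x. f ((a \<cdot> p) \<cdot> c) ((b \<cdot> q) \<rhd> x))))"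
    by (simp add: c sw_tensor_act bil_def H.m_assoc act_mult)
  also have "\<dots> = osum P (\<lambda>a b. sw R H M P Y (\<lambda>c x. f (a \<cdot> c) (b \<rhd> x)))"
    by (rule comult_one_mult(1)) (simp_all add: bil_def)
  also have "\<dots> = csum P m f"
    by (simp add: c sw_tensor_act f)
  finally show ?thesis .
qed

lemma sweedler_compatibility:
  assumes [simp]: "module R P" "h \<in> carrier H" "m \<in> carrier M" and f: "bil R H M P f"
  shows "dsum P h (\<lambda>a b. csum P m (\<lambda>c x. f (a \<cdot> c) (b \<rhd> x))) = dsum P h (\<lambda>a b. csum P (a \<rhd> m) (\<lambda>c x. f (c \<cdot> b) x))"
proof -
  note [simp] = bil_rules[OF f]
  have "tensor_act R H M (monoid.mult H) (act M) (comult H h) (coact M m) =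
     dsum HM h (\<lambda>a b. csum HM (a \<rhd> m) (\<lambda>c x. pure_tensor R H M (c \<cdot> b) x))"
    using compatibility[of h m] by (simp add: tensor_lift_dsum tensor_lift_csum)
  from arg_cong[OF this, of "\<lambda>X. sw R H M P X f"]
  show ?thesis by (simp add: sw_sw sw_pure f sw_tensor_act)
qed

section \<open>The coaction and the algebras H_t and H_s\<close>

lemma compatibility_one:
  assumes [simp]: "module R P" "m \<in> carrier M" and f: "bil R H M P f"
  shows "osum P (\<lambda>a b. csum P (a \<rhd> m) (\<lambda>c x. f (c \<cdot> b) x)) = csum P m f"
  using sweedler_compatibility[OF assms(1) H.one_closed assms(2) f] coact_t[OF assms] by simp

text \<open>For y in H_s, \<Delta>(y) is both 1_1 \<otimes> y 1_2 and 1_1 \<otimes> 1_2 y. In the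
  compatibility condition for y the first form puts y in front of m_[0], the second puts it to the
  right of m_[-1].\<close>

lemma coact_es:
  assumes [simp]: "module R P" "m \<in> carrier M" "h \<in> carrier H" and f: "bil R H M P f"
  shows "csum P m (\<lambda>a x. f a (es h \<rhd> x)) = csum P m (\<lambda>a x. f (a \<cdot> es h) x)"
proof -
  note [simp] = bil_rules[OF f]
  have "csum P m (\<lambda>a x. f a (es h \<rhd> x)) = osum P (\<lambda>a b. csum P m (\<lambda>c x. f (a \<cdot> c) (es h \<rhd> b \<rhd> x)))"
    by (rule coact_t[symmetric]) (simp_all add: bil_def)
  also have "\<dots> = dsum P (es h) (\<lambda>a b. csum P m (\<lambda>c x. f (a \<cdot> c) (b \<rhd> x)))"
    by (subst comult_es(1)) (simp_all add: bil_def act_mult)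
  also have "\<dots> = dsum P (es h) (\<lambda>a b. csum P (a \<rhd> m) (\<lambda>c x. f (c \<cdot> b) x))"
    by (rule sweedler_compatibility[OF _ _ _ f]) simp_all
  also have "\<dots> = osum P (\<lambda>a b. csum P (a \<rhd> m) (\<lambda>c x. f ((c \<cdot> b) \<cdot> es h) x))"
    by (subst comult_es(2)) (simp_all add: bil_def H.m_assoc)
  also have "\<dots> = csum P m (\<lambda>a x. f (a \<cdot> es h) x)"
    by (rule compatibility_one) (simp_all add: bil_def)
  finally show ?thesis .
qed

text \<open>The left leg of \<Delta>(1) is projected to H_s, moved by \<open>coact_es\<close> term
  by term, and freed of the projection.\<close>

lemma coact_osum:
  assumes [simp]: "module R P" "m \<in> carrier M" and f: "tril R H M H P f"
  shows "osum P (\<lambda>e e'. csum P m (\<lambda>a x. f a (e \<rhd> x) e')) = osum P (\<lambda>e e'. csum P m (\<lambda>a x. f (a \<cdot> e) x e'))"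
proof -
  note [simp] = tril_closed[OF f]
  have l: "b \<in> carrier M \<Longrightarrow> c \<in> carrier H \<Longrightarrow> lin R A H g \<Longrightarrow> lin R A P (\<lambda>x. f (g x) b c)"
    "a \<in> carrier H \<Longrightarrow> c \<in> carrier H \<Longrightarrow> lin R A M k \<Longrightarrow> lin R A P (\<lambda>x. f a (k x) c)"
    "a \<in> carrier H \<Longrightarrow> b \<in> carrier M \<Longrightarrow> lin R A H g \<Longrightarrow> lin R A P (\<lambda>x. f a b (g x))" for a b c A g k
    using f lin_compose[of R H P "\<lambda>x. f x b c" A g] lin_compose[of R M P "\<lambda>x. f a x c" A k] lin_compose[of R H P "f a b" A g]
    by (auto simp: tril_def)
  have l': "b \<in> carrier M \<Longrightarrow> c \<in> carrier H \<Longrightarrow> lin R H P (\<lambda>x. f x b c)"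
    "a \<in> carrier H \<Longrightarrow> c \<in> carrier H \<Longrightarrow> lin R M P (\<lambda>x. f a x c)"
    "a \<in> carrier H \<Longrightarrow> b \<in> carrier M \<Longrightarrow> lin R H P (f a b)" for a b c
    using f by (auto simp: tril_def)
  note [simp] = l l'
  have "osum P (\<lambda>e e'. csum P m (\<lambda>a x. f a (e \<rhd> x) e')) = osum P (\<lambda>e e'. csum P m (\<lambda>a x. f a (es e \<rhd> x) e'))"
    by (rule osum_et(2)[symmetric]) (simp_all add: bil_def)
  also have "\<dots> = osum P (\<lambda>e e'. csum P m (\<lambda>a x. f (a \<cdot> es e) x e'))"
    by (intro sw_cong refl coact_es) (simp_all add: bil_def)
  also have "\<dots> = osum P (\<lambda>e e'. csum P m (\<lambda>a x. f (a \<cdot> e) x e'))"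
    by (rule osum_et(2)) (simp_all add: bil_def)
  finally show ?thesis .
qed

text \<open>The analogue for z in H_t: the compatibility condition for z, with \<Delta>(z) = z 1_1
  \<otimes> 1_2 on one side and 1_1 z \<otimes> 1_2 on the other, makes the coaction
  H_t-linear.\<close>

lemma coact_et:
  assumes [simp]: "module R P" "m \<in> carrier M" "h \<in> carrier H" and f: "bil R H M P f"
  shows "csum P (et h \<rhd> m) f = csum P m (\<lambda>a x. f (et h \<cdot> a) x)"
proof -
  note [simp] = bil_rules[OF f]
  have "csum P m (\<lambda>a x. f (et h \<cdot> a) x) = osum P (\<lambda>a b. csum P m (\<lambda>c x. f (et h \<cdot> (a \<cdot> c)) (b \<rhd> x)))"
    by (rule coact_t[symmetric]) (simp_all add: bil_def)
  also have "\<dots> = dsum P (et h) (\<lambda>a b. csum P m (\<lambda>c x. f (a \<cdot> c) (b \<rhd> x)))"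
    by (subst comult_et(1)) (simp_all add: bil_def H.m_assoc)
  also have "\<dots> = dsum P (et h) (\<lambda>a b. csum P (a \<rhd> m) (\<lambda>c x. f (c \<cdot> b) x))"
    by (rule sweedler_compatibility[OF _ _ _ f]) simp_all
  also have "\<dots> = osum P (\<lambda>a b. csum P (a \<rhd> et h \<rhd> m) (\<lambda>c x. f (c \<cdot> b) x))"
    by (subst comult_et(2)) (simp_all add: bil_def act_mult)
  also have "\<dots> = csum P (et h \<rhd> m) f"
    by (rule compatibility_one[OF _ _ f]) simp_all
  finally show ?thesis by simp
qed

text \<open>\<epsilon>(m_[-1] h) splits into \<epsilon>(m_[-1] 1_1) \<epsilon>(1_2 h). Moving 1_1
  onto m_[0] frees the counit axiom of the coaction, and \<epsilon>(1_2 h) 1_1 is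
  \<open>esb h\<close>.\<close>

lemma coact_counit_right:
  assumes [simp]: "module R P" "m \<in> carrier M" "h \<in> carrier H" and g: "lin R M P g"
  shows "csum P m (\<lambda>a x. \<epsilon> (a \<cdot> h) \<odot>\<^bsub>P\<^esub> g x) = g (esb h \<rhd> m)"
proof -
  interpret P: module R P by fact
  note [simp] = lin_closed[OF g] lin_compose[OF g] g
  have "csum P m (\<lambda>a x. \<epsilon> (a \<cdot> h) \<odot>\<^bsub>P\<^esub> g x) = csum P m (\<lambda>a x. osum P (\<lambda>e e'. \<epsilon> (e' \<cdot> h) \<odot>\<^bsub>P\<^esub> (\<epsilon> (a \<cdot> e) \<odot>\<^bsub>P\<^esub> g x)))"
    by (intro sw_cong refl, subst counit_mult_osum(1)) (simp_all add: sw_smult P.smult_assoc1[symmetric] R.m_comm)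
  also have "\<dots> = osum P (\<lambda>e e'. csum P m (\<lambda>a x. \<epsilon> (e' \<cdot> h) \<odot>\<^bsub>P\<^esub> (\<epsilon> (a \<cdot> e) \<odot>\<^bsub>P\<^esub> g x)))"
    by (rule sw_swap) simp_all
  also have "\<dots> = osum P (\<lambda>e e'. csum P m (\<lambda>a x. \<epsilon> (e' \<cdot> h) \<odot>\<^bsub>P\<^esub> (\<epsilon> a \<odot>\<^bsub>P\<^esub> g (e \<rhd> x))))"
    by (rule coact_osum[symmetric]) (simp_all add: tril_def)
  also have "\<dots> = osum P (\<lambda>e e'. \<epsilon> (e' \<cdot> h) \<odot>\<^bsub>P\<^esub> g (e \<rhd> m))"
    by (simp add: smult_sw[symmetric] sweedler_coact_counit[where g="\<lambda>x. g (_ \<rhd> x)"])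
  also have "\<dots> = g (esb h \<rhd> m)"
    by (simp add: lin_eps_expand(3)[where P=P and g="\<lambda>x. g (x \<rhd> m)"])
  finally show ?thesis .
qed

text \<open>Here the splitting is \<epsilon>(h 1_1) \<epsilon>(1_2 m_[-1]). The leg 1_2, projected
  to H_t, enters the argument of the coaction by \<open>coact_et\<close>.\<close>

lemma coact_counit_left:
  assumes [simp]: "module R P" "m \<in> carrier M" "h \<in> carrier H" and g: "lin R M P g"
  shows "csum P m (\<lambda>a x. \<epsilon> (h \<cdot> a) \<odot>\<^bsub>P\<^esub> g x) = osum P (\<lambda>e e'. \<epsilon> (h \<cdot> e) \<odot>\<^bsub>P\<^esub> g (e' \<rhd> m))"
proof -
  interpret P: module R P by fact
  note [simp] = lin_closed[OF g] lin_compose[OF g] g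
  have "csum P m (\<lambda>a x. \<epsilon> (h \<cdot> a) \<odot>\<^bsub>P\<^esub> g x) = csum P m (\<lambda>a x. osum P (\<lambda>e e'. \<epsilon> (h \<cdot> e) \<odot>\<^bsub>P\<^esub> (\<epsilon> (e' \<cdot> a) \<odot>\<^bsub>P\<^esub> g x)))"
    by (intro sw_cong refl, subst counit_mult_osum(1)) (simp_all add: sw_smult P.smult_assoc1[symmetric])
  also have "\<dots> = osum P (\<lambda>e e'. csum P m (\<lambda>a x. \<epsilon> (h \<cdot> e) \<odot>\<^bsub>P\<^esub> (\<epsilon> (e' \<cdot> a) \<odot>\<^bsub>P\<^esub> g x)))"
    by (rule sw_swap) simp_all
  also have "\<dots> = osum P (\<lambda>e e'. csum P m (\<lambda>a x. \<epsilon> (h \<cdot> e) \<odot>\<^bsub>P\<^esub> (\<epsilon> (et e' \<cdot> a) \<odot>\<^bsub>P\<^esub> g x)))"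
    by (rule osum_et(1)[symmetric]) (simp_all add: bil_def)
  also have "\<dots> = osum P (\<lambda>e e'. \<epsilon> (h \<cdot> e) \<odot>\<^bsub>P\<^esub> csum P (et e' \<rhd> m) (\<lambda>a x. \<epsilon> a \<odot>\<^bsub>P\<^esub> g x))"
    by (simp add: smult_sw coact_et bil_def)
  also have "\<dots> = osum P (\<lambda>e e'. \<epsilon> (h \<cdot> e) \<odot>\<^bsub>P\<^esub> g (et e' \<rhd> m))"
    by (simp add: sweedler_coact_counit)
  also have "\<dots> = osum P (\<lambda>e e'. \<epsilon> (h \<cdot> e) \<odot>\<^bsub>P\<^esub> g (e' \<rhd> m))"
    by (rule osum_et(1)) (simp_all add: bil_def)
  finally show ?thesis .
qed

text \<open>The core of the colinearity of coevaluation. H_t-linearity extracts \<open>et h\<close>;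
  coassociativity then presents the other factors as k2 T(k1) = T(et k) with k = m_[-1], and the
  counit rules convert this into \<Delta>(1) acting on m.\<close>

lemma coact_T:
  assumes [simp]: "module R P" "h \<in> carrier H" "m \<in> carrier M" and f: "bil R H M P f"
  shows "csum P m (\<lambda>c y. csum P (et h \<rhd> y) (\<lambda>a x. f (a \<cdot> T c) x)) = osum P (\<lambda>a b. f (et h \<cdot> a) (b \<rhd> m))"
proof -
  note [simp] = bil_rules[OF f]
  have "csum P m (\<lambda>c y. csum P (et h \<rhd> y) (\<lambda>a x. f (a \<cdot> T c) x)) = csum P m (\<lambda>c y. csum P y (\<lambda>a x. f (et h \<cdot> (a \<cdot> T c)) x))"
    by (simp add: coact_et bil_def H.m_assoc)
  also have "\<dots> = csum P m (\<lambda>k x. dsum P k (\<lambda>c a. f (et h \<cdot> (a \<cdot> T c)) x))"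
    by (rule sweedler_coact_coassoc[symmetric]) (simp_all add: tril_def)
  also have "\<dots> = csum P m (\<lambda>k x. f (et h \<cdot> T (et k)) x)"
    by (simp add: lin_antipode_inv_convolution(2)[where g="\<lambda>u. f (et h \<cdot> u) _"])
  also have "\<dots> = csum P m (\<lambda>k x. osum P (\<lambda>p q. \<epsilon> (p \<cdot> k) \<odot>\<^bsub>P\<^esub> f (et h \<cdot> T q) x))"
    by (simp add: lin_eps_expand(1)[where P=P and g="\<lambda>u. f (et h \<cdot> T u) _"])
  also have "\<dots> = osum P (\<lambda>p q. csum P m (\<lambda>k x. \<epsilon> (p \<cdot> k) \<odot>\<^bsub>P\<^esub> f (et h \<cdot> T q) x))"
    by (rule sw_swap) simp_all
  also have "\<dots> = osum P (\<lambda>p q. osum P (\<lambda>a b. \<epsilon> (p \<cdot> a) \<odot>\<^bsub>P\<^esub> f (et h \<cdot> T q) (T (S b) \<rhd> m)))"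
    by (simp add: coact_counit_left)
  \<comment> \<open>The acting leg was written as \<open>T (S b)\<close> so that
    \<open>osum_counit_S\<close> matches with \<open>T\<close> kept inside the bilinear map.\<close>
  also have "\<dots> = osum P (\<lambda>p q. f (et h \<cdot> T q) (T p \<rhd> m))"
    by (rule osum_counit_S[where f="\<lambda>u q. f (et h \<cdot> T q) (T u \<rhd> m)"]) (simp_all add: bil_def)
  also have "\<dots> = osum P (\<lambda>a b. f (et h \<cdot> a) (b \<rhd> m))"
    by (rule osum_T_flip) (simp_all add: bil_def)
  finally show ?thesis .
qed

end

section \<open>Dual modules\<close>

lemma lin_finsum_fun [simp]:
  assumes "module R A" "module R P" "finite I" "\<And>i. i \<in> I \<Longrightarrow> lin R A P (\<lambda>x. f x i)"
  shows "lin R A P (\<lambda>x. \<Oplus>\<^bsub>P\<^esub>i\<in>I. f x i)"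
proof -
  interpret A: module R A by fact
  interpret P: module R P by fact
  note f = lin_closed[OF assms(4)] lin_add[OF assms(4)] lin_smult[OF assms(4)]
  show ?thesis
  proof (rule linI)
    fix x y assume [simp]: "x \<in> carrier A" "y \<in> carrier A"
    show "(\<Oplus>\<^bsub>P\<^esub>i\<in>I. f (x \<oplus>\<^bsub>A\<^esub> y) i) = (\<Oplus>\<^bsub>P\<^esub>i\<in>I. f x i) \<oplus>\<^bsub>P\<^esub> (\<Oplus>\<^bsub>P\<^esub>i\<in>I. f y i)"
      using f by (intro trans[OF P.finsum_cong' P.finsum_addf]) auto
  next
    fix r x assume [simp]: "r \<in> carrier R" "x \<in> carrier A"
    have "(\<Oplus>\<^bsub>P\<^esub>i\<in>I. f (r \<odot>\<^bsub>A\<^esub> x) i) = (\<Oplus>\<^bsub>P\<^esub>i\<in>I. r \<odot>\<^bsub>P\<^esub> f x i)"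
      using f by (intro P.finsum_cong') auto
    also have "\<dots> = r \<odot>\<^bsub>P\<^esub> (\<Oplus>\<^bsub>P\<^esub>i\<in>I. f x i)"
      using f assms(3) by (intro P.finsum_smult_ldistr[symmetric]) auto
    finally show "(\<Oplus>\<^bsub>P\<^esub>i\<in>I. f (r \<odot>\<^bsub>A\<^esub> x) i) = r \<odot>\<^bsub>P\<^esub> (\<Oplus>\<^bsub>P\<^esub>i\<in>I. f x i)" .
  qed (use f in \<open>auto intro!: P.finsum_closed\<close>)
qed

text \<open>The record fields for multiplication and its unit are junk for modules and may differ.\<close>

definition same_module where
  "same_module M N \<longleftrightarrow> carrier M = carrier N \<and> zero M = zero N \<and> add M = add N \<and> smult M = smult N"

text \<open>The tensor construction reads only the fields compared by \<open>same_module\<close>, so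
  the results are equal, not merely isomorphic.\<close>

lemma same_module_tensor:
  assumes "same_module M M'" "same_module N N'"
  shows "tensor_module R M N = tensor_module R M' N'" "pure_tensor R M N = pure_tensor R M' N'"
  using assms
  by (simp_all add: same_module_def tensor_module_def pure_tensor_def tensor_kernel_def bilinear_relations_def fun_eq_iff)

lemma same_module_lin:
  "same_module M M' \<Longrightarrow> same_module N N' \<Longrightarrow> lin R M N f \<longleftrightarrow> lin R M' N' f"
  by (simp add: same_module_def lin_def linear_maps_def)

lemma same_module_module:
  assumes "same_module M N" "module R N"
  shows "module R M"
proof -
  interpret N: module R N by fact
  have [simp]: "carrier M = carrier N" "zero M = zero N" "add M = add N" "smult M = smult N"
    using assms(1) by (auto simp: same_module_def)
  show ?thesis
  proof (intro moduleI abelian_groupI)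
    fix x assume "x \<in> carrier M"
    then show "\<exists>y\<in>carrier M. y \<oplus>\<^bsub>M\<^esub> x = \<zero>\<^bsub>M\<^esub>"
      by (intro bexI[of _ "\<ominus>\<^bsub>N\<^esub> x"]) (simp_all add: N.M.l_neg)
  qed (simp_all add: N.smult_l_distr N.smult_r_distr N.smult_assoc1 N.M.a_ac N.R.is_cring)
qed

text \<open>Linear forms are made zero outside the carrier, so that forms agreeing on the module are
  equal as functions.\<close>

definition dual_module :: "('k, 'z) ring_scheme \<Rightarrow> ('k, 'm, 'u) module_scheme \<Rightarrow> ('k, 'm \<Rightarrow> 'k) module"
  where "dual_module R M =
    \<lparr>carrier = {f. lin R M (regular_module R) f \<and> (\<forall>x. x \<notin> carrier M \<longrightarrow> f x = \<zero>\<^bsub>R\<^esub>)},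
     monoid.mult = undefined, one = undefined, zero = (\<lambda>x. \<zero>\<^bsub>R\<^esub>),
     add = (\<lambda>f g x. f x \<oplus>\<^bsub>R\<^esub> g x), smult = (\<lambda>r f x. r \<otimes>\<^bsub>R\<^esub> f x)\<rparr>"

lemma dual_module_simps [simp]:
  "zero (dual_module R X) = (\<lambda>x. \<zero>\<^bsub>R\<^esub>)" "add (dual_module R X) = (\<lambda>f g x. f x \<oplus>\<^bsub>R\<^esub> g x)"
  "smult (dual_module R X) = (\<lambda>r f x. r \<otimes>\<^bsub>R\<^esub> f x)"
  by (simp_all add: dual_module_def)

lemma dual_carrier:
  "f \<in> carrier (dual_module R M) \<longleftrightarrow> lin R M (regular_module R) f \<and> (\<forall>x. x \<notin> carrier M \<longrightarrow> f x = \<zero>\<^bsub>R\<^esub>)"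
  by (simp add: dual_module_def)

lemma dual_apply_closed:
  assumes "cring R" "f \<in> carrier (dual_module R M)"
  shows "f x \<in> carrier R"
proof -
  interpret cring R by fact
  show ?thesis using assms(2) lin_closed[of R M "regular_module R" f x] by (cases "x \<in> carrier M") (auto simp: dual_carrier)
qed

lemma dual_module_module:
  assumes "module R M" shows "module R (dual_module R M)"
proof -
  interpret M: module R M by fact
  let ?D = "dual_module R M"
  have c: "f x \<in> carrier R" if "f \<in> carrier ?D" for f x
    using dual_apply_closed[OF M.R.is_cring that] .
  have lD: "lin R M (regular_module R) f" if "f \<in> carrier ?D" for f using that by (simp add: dual_carrier)
  have add: "f \<oplus>\<^bsub>?D\<^esub> g \<in> carrier ?D" if "f \<in> carrier ?D" "g \<in> carrier ?D" for f g
    using that c[OF that(1)] c[OF that(2)] lin_add[OF lD[OF that(1)]] lin_smult[OF lD[OF that(1)]]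
      lin_add[OF lD[OF that(2)]] lin_smult[OF lD[OF that(2)]]
    by (auto simp: dual_carrier M.r_distr M.R.a_ac intro!: linI)
  have sm: "r \<odot>\<^bsub>?D\<^esub> g \<in> carrier ?D" if "r \<in> carrier R" "g \<in> carrier ?D" for r g
    using that c[OF that(2)] lin_add[OF lD[OF that(2)]] lin_smult[OF lD[OF that(2)]]
    by (auto simp: dual_carrier M.r_distr M.R.m_lcomm intro!: linI)
  have zero: "\<zero>\<^bsub>?D\<^esub> \<in> carrier ?D" by (auto simp: dual_carrier intro!: linI)
  show ?thesis
  proof (intro moduleI abelian_groupI)
    fix x assume x: "x \<in> carrier ?D"
    show "\<exists>y\<in>carrier ?D. y \<oplus>\<^bsub>?D\<^esub> x = \<zero>\<^bsub>?D\<^esub>"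
      using x c[OF x] sm[of "\<ominus>\<^bsub>R\<^esub> \<one>\<^bsub>R\<^esub>" x]
      by (intro bexI[of _ "\<lambda>z. \<ominus>\<^bsub>R\<^esub> \<one>\<^bsub>R\<^esub> \<otimes>\<^bsub>R\<^esub> x z"]) (auto simp: M.R.l_minus M.R.l_neg)
  qed (use add sm zero c in \<open>auto simp: fun_eq_iff M.R.a_ac M.l_distr M.r_distr M.R.m_assoc M.R.is_cring\<close>)
qed

section \<open>Dual bases and finitely generated projective modules\<close>

lemma finsum_group:
  assumes "module R P" "finite I" "h \<in> I \<rightarrow> carrier P"
  shows "(\<Oplus>\<^bsub>P\<^esub>i\<in>I. h i) = (\<Oplus>\<^bsub>P\<^esub>a\<in>g ` I. \<Oplus>\<^bsub>P\<^esub>i\<in>{i \<in> I. g i = a}. h i)"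
proof -
  interpret P: module R P by fact
  have "(\<Oplus>\<^bsub>P\<^esub>i\<in>(\<Union>a\<in>g ` I. {i \<in> I. g i = a}). h i) = (\<Oplus>\<^bsub>P\<^esub>a\<in>g ` I. \<Oplus>\<^bsub>P\<^esub>i\<in>{i \<in> I. g i = a}. h i)"
    using assms(2,3) by (intro P.add.finprod_UN_disjoint) (auto simp: pairwise_def disjnt_def)
  moreover have "(\<Union>a\<in>g ` I. {i \<in> I. g i = a}) = I" by auto
  ultimately show ?thesis by simp
qed

lemma finsum_swap:
  assumes P: "module R P" and I: "finite I" and J: "finite J"
    and f: "\<And>i j. i \<in> I \<Longrightarrow> j \<in> J \<Longrightarrow> f i j \<in> carrier P"
  shows "(\<Oplus>\<^bsub>P\<^esub>i\<in>I. \<Oplus>\<^bsub>P\<^esub>j\<in>J. f i j) = (\<Oplus>\<^bsub>P\<^esub>j\<in>J. \<Oplus>\<^bsub>P\<^esub>i\<in>I. f i j)"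
  using I f
proof (induction I)
  interpret P: module R P by fact
  case empty
  then show ?case by simp
next
  interpret P: module R P by fact
  case (insert i I)
  have "(\<Oplus>\<^bsub>P\<^esub>j\<in>J. \<Oplus>\<^bsub>P\<^esub>i\<in>insert i I. f i j) = (\<Oplus>\<^bsub>P\<^esub>j\<in>J. f i j \<oplus>\<^bsub>P\<^esub> (\<Oplus>\<^bsub>P\<^esub>i\<in>I. f i j))"
    using insert by (intro P.finsum_cong') auto
  also have "\<dots> = (\<Oplus>\<^bsub>P\<^esub>j\<in>J. f i j) \<oplus>\<^bsub>P\<^esub> (\<Oplus>\<^bsub>P\<^esub>j\<in>J. \<Oplus>\<^bsub>P\<^esub>i\<in>I. f i j)"
    using insert by (intro P.finsum_addf) auto
  also have "\<dots> = (\<Oplus>\<^bsub>P\<^esub>i\<in>insert i I. \<Oplus>\<^bsub>P\<^esub>j\<in>J. f i j)"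
    using insert by (subst P.finsum_insert) auto
  finally show ?case ..
qed

text \<open>The coefficient forms embed P into the free module on the generators, and evaluating
  formal combinations is a retraction.\<close>

lemma fgp_of_dual_basis:
  assumes P: "module R P" and I: "finite I" and g: "\<And>i. i \<in> I \<Longrightarrow> g i \<in> carrier P"
    and c: "\<And>i. i \<in> I \<Longrightarrow> lin R P (regular_module R) (c i)"
    and e: "\<And>p. p \<in> carrier P \<Longrightarrow> p = (\<Oplus>\<^bsub>P\<^esub>i\<in>I. c i p \<odot>\<^bsub>P\<^esub> g i)"
  shows "finitely_generated R P" "projective R P"
proof -
  interpret P: module R P by fact
  have KR: "module R (regular_module R)" by (rule regular_module_module) (rule P.R.is_cring)
  define A where "A = g ` I"
  \<comment> \<open>The family \<open>g\<close> may repeat a value, whereas generating sets and free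
    modules are indexed by elements; coefficients of equal generators are added up.\<close>
  define c' where "c' a p = (\<Oplus>\<^bsub>R\<^esub>i\<in>{i \<in> I. g i = a}. c i p)" for a p
  have A: "finite A" "A \<subseteq> carrier P" using I g by (auto simp: A_def)
  have cc: "c i p \<in> carrier R" if "i \<in> I" "p \<in> carrier P" for i p using lin_closed[OF c[OF that(1)] that(2)] by simp
  have c'lin: "lin R P (regular_module R) (c' a)" for a
    unfolding c'_def using lin_finsum_fun[OF P KR, of "{i \<in> I. g i = a}" "\<lambda>p i. c i p"] I c by simp
  have c'c: "c' a p \<in> carrier R" if "p \<in> carrier P" for a p using lin_closed[OF c'lin that] by simp
  have e': "p = (\<Oplus>\<^bsub>P\<^esub>a\<in>A. c' a p \<odot>\<^bsub>P\<^esub> a)" if p: "p \<in> carrier P" for p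
  proof -
    have "p = (\<Oplus>\<^bsub>P\<^esub>a\<in>A. \<Oplus>\<^bsub>P\<^esub>i\<in>{i \<in> I. g i = a}. c i p \<odot>\<^bsub>P\<^esub> g i)"
      unfolding A_def using g cc p
      by (subst e[OF p], subst finsum_group[OF P I, of _ g]) auto
    also have "\<dots> = (\<Oplus>\<^bsub>P\<^esub>a\<in>A. c' a p \<odot>\<^bsub>P\<^esub> a)"
    proof (rule P.finsum_cong')
      fix a assume a: "a \<in> A"
      have l: "lin R (regular_module R) P (\<lambda>r. r \<odot>\<^bsub>P\<^esub> a)" using a A by (intro lin_smult1 P lin_id) auto
      have "c' a p \<odot>\<^bsub>P\<^esub> a = (\<Oplus>\<^bsub>P\<^esub>i\<in>{i \<in> I. g i = a}. c i p \<odot>\<^bsub>P\<^esub> a)"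
        unfolding c'_def using lin_finsum[OF KR P l, of "{i \<in> I. g i = a}" "\<lambda>i. c i p"] I cc p by auto
      also have "\<dots> = (\<Oplus>\<^bsub>P\<^esub>i\<in>{i \<in> I. g i = a}. c i p \<odot>\<^bsub>P\<^esub> g i)"
        using cc p g by (intro P.finsum_cong') auto
      finally show "(\<Oplus>\<^bsub>P\<^esub>i\<in>{i \<in> I. g i = a}. c i p \<odot>\<^bsub>P\<^esub> g i) = c' a p \<odot>\<^bsub>P\<^esub> a" ..
    qed (use A c'c p in auto)
    finally show ?thesis .
  qed
  show "finitely_generated R P"
    unfolding finitely_generated_def using A e' c'c by (intro exI[of _ A]) (auto intro!: bexI[of _ "\<lambda>a. c' a _"])
  define i where "i p = (\<lambda>x. if x \<in> A then c' x p else \<zero>\<^bsub>R\<^esub>)" for p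
  define q where "q f = (\<Oplus>\<^bsub>P\<^esub>a\<in>A. f a \<odot>\<^bsub>P\<^esub> a)" for f
  have "i \<in> linear_maps R P (free_module R A)"
    unfolding lin_def[symmetric]
    using c'c lin_add[OF c'lin] lin_smult[OF c'lin]
    by (intro linI) (auto simp: i_def free_module_carrier fun_eq_iff intro: finite_subset[OF _ A(1)])
  moreover have "q \<in> linear_maps R (free_module R A) P"
    unfolding lin_def[symmetric] q_def
  proof (intro lin_finsum_fun free_module_module P.R.is_cring P A(1) lin_smult1)
    fix a assume "a \<in> A"
    then show "a \<in> carrier P" using A by auto
    show "lin R (free_module R A) (regular_module R) (\<lambda>f. f a)"
      by (rule linI) (auto simp: free_module_carrier)
  qed
  moreover have "q (i m) = m" if "m \<in> carrier P" for m
  proof -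
    have "q (i m) = (\<Oplus>\<^bsub>P\<^esub>a\<in>A. c' a m \<odot>\<^bsub>P\<^esub> a)"
      unfolding q_def i_def using A c'c[OF that] by (intro P.finsum_cong') auto
    then show ?thesis using e'[OF that] by simp
  qed
  ultimately show "projective R P" unfolding projective_def by blast
qed

text \<open>Coordinates in the free module of which M is a retract give the forms, and images of its
  basis give the elements. Finite generation makes finitely many coordinates suffice.\<close>

lemma dual_basis_exists:
  fixes M :: "('k, 'm, 'u) module_scheme"
  assumes M: "module R M" and fg: "finitely_generated R M" and pr: "projective R M"
  obtains I :: "'m set" and n nd where "finite I" "\<And>i. i \<in> I \<Longrightarrow> n i \<in> carrier M" "\<And>i. i \<in> I \<Longrightarrow> nd i \<in> carrier (dual_module R M)"
    "\<And>m. m \<in> carrier M \<Longrightarrow> m = (\<Oplus>\<^bsub>M\<^esub>i\<in>I. nd i m \<odot>\<^bsub>M\<^esub> n i)"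
proof -
  interpret M: module R M by fact
  note cr = M.R.is_cring
  have KR: "module R (regular_module R)" by (rule regular_module_module) (rule cr)
  obtain X :: "'m set" and i p where i: "lin R M (free_module R X) i" and p: "lin R (free_module R X) M p"
    and pi: "\<And>m. m \<in> carrier M \<Longrightarrow> p (i m) = m"
    using pr unfolding projective_def lin_def by blast
  have F: "module R (free_module R X)" by (rule free_module_module) (rule cr)
  interpret F: module R "free_module R X" by (rule F)
  obtain A where A: "finite A" "A \<subseteq> carrier M"
    and Ag: "\<And>m. m \<in> carrier M \<Longrightarrow> \<exists>c \<in> A \<rightarrow> carrier R. m = (\<Oplus>\<^bsub>M\<^esub>a\<in>A. c a \<odot>\<^bsub>M\<^esub> a)"
    using fg unfolding finitely_generated_def by blast
  have ic: "i m \<in> carrier (free_module R X)" if "m \<in> carrier M" for m using lin_closed[OF i that] .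
  \<comment> \<open>Each generator has finite support, and linearity of \<open>i\<close> confines
    the support of every other element to the union of these.\<close>
  define I where "I = (\<Union>a\<in>A. {x. i a x \<noteq> \<zero>\<^bsub>R\<^esub>})"
  have I: "finite I" "I \<subseteq> X" using A ic by (auto simp: I_def free_module_carrier subset_eq)
  define evx where "evx x f = (f x :: 'k)" for x :: 'm and f
  have ev: "lin R (free_module R X) (regular_module R) (evx x)" for x
    by (rule linI) (auto simp: free_module_carrier evx_def)
  have coeff: "lin R M (regular_module R) (\<lambda>m. i m x)" for x
    using lin_compose[OF ev i] by (simp add: evx_def)
  have supp: "{x. i m x \<noteq> \<zero>\<^bsub>R\<^esub>} \<subseteq> I" if m: "m \<in> carrier M" for m
  proof -
    have "i m x = \<zero>\<^bsub>R\<^esub>" if x: "x \<notin> I" for x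
    proof -
      obtain c where c: "c \<in> A \<rightarrow> carrier R" "m = (\<Oplus>\<^bsub>M\<^esub>a\<in>A. c a \<odot>\<^bsub>M\<^esub> a)" using Ag[OF m] by blast
      have "i m x = (\<Oplus>\<^bsub>R\<^esub>a\<in>A. i (c a \<odot>\<^bsub>M\<^esub> a) x)"
        using lin_finsum[OF M KR coeff A(1), of "\<lambda>a. c a \<odot>\<^bsub>M\<^esub> a"] c A by auto
      also have "\<dots> = (\<Oplus>\<^bsub>R\<^esub>a\<in>A. \<zero>\<^bsub>R\<^esub>)"
        using A c x by (intro M.R.finsum_cong') (auto simp: lin_smult[OF coeff] I_def Pi_iff subset_eq)
      finally show ?thesis by simp
    qed
    then show ?thesis by auto
  qed
  define n where "n x = p (free_basis R x)" for x
  \<comment> \<open>Cut off outside the carrier, as membership in \<open>dual_module\<close>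
    demands.\<close>
  define nd where "nd x = (\<lambda>m. if m \<in> carrier M then i m x else \<zero>\<^bsub>R\<^esub>)" for x
  show thesis
  proof (rule that[OF I(1), of n nd])
    fix x assume "x \<in> I"
    then show "n x \<in> carrier M" unfolding n_def using I(2) by (intro lin_closed[OF p] free_basis_in cr) auto
    show "nd x \<in> carrier (dual_module R M)"
      by (auto simp: dual_carrier nd_def intro!: lin_cong[OF M _ coeff])
  next
    fix m assume m: "m \<in> carrier M"
    have b: "free_basis R x \<in> carrier (free_module R X)" "i m x \<in> carrier R" if "x \<in> I" for x
      using that I(2) ic[OF m] free_basis_in[OF cr, of x X] by (auto simp: free_module_carrier)
    have "m = p (i m)" using pi[OF m] ..
    also have "i m = (\<Oplus>\<^bsub>free_module R X\<^esub>x\<in>I. i m x \<odot>\<^bsub>free_module R X\<^esub> free_basis R x)"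
      by (rule free_module_expand[OF cr ic[OF m] I(1) supp[OF m] I(2)])
    also have "p \<dots> = (\<Oplus>\<^bsub>M\<^esub>x\<in>I. p (i m x \<odot>\<^bsub>free_module R X\<^esub> free_basis R x))"
      using b by (intro lin_finsum[OF F M p I(1)] Pi_I F.smult_closed) 
    also have "\<dots> = (\<Oplus>\<^bsub>M\<^esub>x\<in>I. nd x m \<odot>\<^bsub>M\<^esub> n x)"
      using b m lin_closed[OF p b(1)] by (intro M.finsum_cong') (auto simp: lin_smult[OF p] nd_def n_def simp del: free_module_simps)
    finally show "m = (\<Oplus>\<^bsub>M\<^esub>x\<in>I. nd x m \<odot>\<^bsub>M\<^esub> n x)" .
  qed
qed

section \<open>The dual Yetter-Drinfeld module\<close>

declare dual_module_simps [simp del]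

lemma module_finsum_cong:
  assumes "module R P" "\<And>i. i \<in> A \<Longrightarrow> f i = g i" "\<And>i. i \<in> A \<Longrightarrow> g i \<in> carrier P"
  shows "finsum P f A = finsum P g A"
proof -
  interpret P: module R P by fact
  show ?thesis using assms(2,3) by (intro P.finsum_cong') auto
qed

text \<open>Application as a constant, so that multilinearity rules can match on it.\<close>

definition ap where "ap \<phi> m = \<phi> m"

lemma same_module_refl [simp]: "same_module M M" by (simp add: same_module_def)

locale yd_dual = yd_hopf R H M
  for R :: "('k, 'z) ring_scheme" and H :: "('k, 'h, 'y) weak_hopf_scheme" and M :: "('k, 'h, 'm) yd_mod" +
  fixes I :: "'m set" and n :: "'m \<Rightarrow> 'm" and nd :: "'m \<Rightarrow> 'm \<Rightarrow> 'k"
  assumes fin_I [simp]: "finite I"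
    and n_closed [simp]: "i \<in> I \<Longrightarrow> n i \<in> carrier M"
    and nd_closed [simp]: "i \<in> I \<Longrightarrow> nd i \<in> carrier (dual_module R M)"
    and dual_basis: "m \<in> carrier M \<Longrightarrow> m = (\<Oplus>\<^bsub>M\<^esub>i\<in>I. nd i m \<odot>\<^bsub>M\<^esub> n i)"
begin

abbreviation "D0 \<equiv> dual_module R M"
abbreviation "HD \<equiv> tensor_module R H D0"
abbreviation "pHD \<equiv> pure_tensor R H D0"
abbreviation "pDM \<equiv> pure_tensor R D0 M"
abbreviation "pMD \<equiv> pure_tensor R M D0"

lemma mod_D0 [simp]: "module R D0" by (rule dual_module_module) simp

lemma ap_closed [simp]: "\<phi> \<in> carrier D0 \<Longrightarrow> ap \<phi> m \<in> carrier R"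
  unfolding ap_def by (rule dual_apply_closed) simp_all

lemma lin_ap1 [simp]:
  assumes "lin R A D0 f" shows "lin R A KR (\<lambda>x. ap (f x) m)"
  using lin_closed[OF assms] lin_add[OF assms] lin_smult[OF assms] ap_closed[of "f _" m]
  by (intro linI) (simp_all add: ap_def dual_module_simps)

lemma lin_ap2 [simp]: "\<phi> \<in> carrier D0 \<Longrightarrow> lin R A M f \<Longrightarrow> lin R A KR (\<lambda>x. ap \<phi> (f x))"
  unfolding ap_def by (rule lin_compose[of _ M]) (simp_all add: dual_carrier)

lemma D0_eqI: "\<phi> \<in> carrier D0 \<Longrightarrow> \<psi> \<in> carrier D0 \<Longrightarrow> (\<And>m. m \<in> carrier M \<Longrightarrow> ap \<phi> m = ap \<psi> m) \<Longrightarrow> \<phi> = \<psi>"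
  by (auto simp: fun_eq_iff dual_carrier ap_def) metis

lemma lin_D0I:
  assumes "module R A" "\<And>x. x \<in> carrier A \<Longrightarrow> f x \<in> carrier D0" "\<And>m. m \<in> carrier M \<Longrightarrow> lin R A KR (\<lambda>x. ap (f x) m)"
  shows "lin R A D0 f"
proof -
  interpret A: module R A by fact
  interpret D: module R D0 by simp
  note ap_lin = lin_add[OF lin_ap1[OF lin_id], simplified] lin_smult[OF lin_ap1[OF lin_id], simplified]
  show ?thesis
  proof (rule linI)
    fix x y assume xy [simp]: "x \<in> carrier A" "y \<in> carrier A"
    show "f (x \<oplus>\<^bsub>A\<^esub> y) = f x \<oplus>\<^bsub>D0\<^esub> f y"
      using lin_add[OF assms(3) xy] D.a_closed[OF assms(2)[OF xy(1)] assms(2)[OF xy(2)]]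
      by (intro D0_eqI) (simp_all add: assms(2) ap_lin)
  next
    fix r x assume rx [simp]: "r \<in> carrier R" "x \<in> carrier A"
    show "f (r \<odot>\<^bsub>A\<^esub> x) = r \<odot>\<^bsub>D0\<^esub> f x"
      using lin_smult[OF assms(3) rx] D.smult_closed[OF rx(1) assms(2)[OF rx(2)]]
      by (intro D0_eqI) (simp_all add: assms(2) ap_lin)
  qed (rule assms(2))
qed

lemma ap_finsum:
  assumes "finite J" "\<And>i. i \<in> J \<Longrightarrow> f i \<in> carrier D0"
  shows "ap (\<Oplus>\<^bsub>D0\<^esub>i\<in>J. f i) m = (\<Oplus>\<^bsub>R\<^esub>i\<in>J. ap (f i) m)"
  using lin_finsum[OF mod_D0 mod_KR lin_ap1[OF lin_id], of J f m] assms by auto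

lemma ap_smult [simp]: "r \<in> carrier R \<Longrightarrow> \<phi> \<in> carrier D0 \<Longrightarrow> ap (r \<odot>\<^bsub>D0\<^esub> \<phi>) m = r \<otimes>\<^bsub>R\<^esub> ap \<phi> m"
  by (simp add: ap_def dual_module_simps)

lemma finsum_dual_basis:
  assumes P: "module R P" and g: "lin R M P g" and m: "m \<in> carrier M"
  shows "(\<Oplus>\<^bsub>P\<^esub>i\<in>I. ap (nd i) m \<odot>\<^bsub>P\<^esub> g (n i)) = g m"
proof -
  interpret P: module R P by fact
  have [simp]: "nd i m \<in> carrier R" if "i \<in> I" for i using ap_closed[OF nd_closed[OF that], of m] by (simp add: ap_def)
  have "g m = g (\<Oplus>\<^bsub>M\<^esub>i\<in>I. nd i m \<odot>\<^bsub>M\<^esub> n i)" using dual_basis[OF m] by simp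
  also have "\<dots> = (\<Oplus>\<^bsub>P\<^esub>i\<in>I. g (nd i m \<odot>\<^bsub>M\<^esub> n i))"
    by (rule lin_finsum[OF mod_M P g]) auto
  also have "\<dots> = (\<Oplus>\<^bsub>P\<^esub>i\<in>I. ap (nd i) m \<odot>\<^bsub>P\<^esub> g (n i))"
    using lin_closed[OF g] by (intro P.finsum_cong') (auto simp: lin_smult[OF g] ap_def)
  finally show ?thesis ..
qed

lemma dual_expand:
  assumes "\<phi> \<in> carrier D0"
  shows "(\<Oplus>\<^bsub>D0\<^esub>i\<in>I. ap \<phi> (n i) \<odot>\<^bsub>D0\<^esub> nd i) = \<phi>"
proof (rule D0_eqI)
  interpret D: module R D0 by simp
  show "(\<Oplus>\<^bsub>D0\<^esub>i\<in>I. ap \<phi> (n i) \<odot>\<^bsub>D0\<^esub> nd i) \<in> carrier D0"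
    using assms by (intro D.finsum_closed) auto
  fix m assume m: "m \<in> carrier M"
  have "ap (\<Oplus>\<^bsub>D0\<^esub>i\<in>I. ap \<phi> (n i) \<odot>\<^bsub>D0\<^esub> nd i) m = (\<Oplus>\<^bsub>R\<^esub>i\<in>I. ap (ap \<phi> (n i) \<odot>\<^bsub>D0\<^esub> nd i) m)"
    using assms by (intro ap_finsum) auto
  also have "\<dots> = (\<Oplus>\<^bsub>KR\<^esub>i\<in>I. ap (nd i) m \<odot>\<^bsub>KR\<^esub> ap \<phi> (n i))"
    using assms by (simp, intro R.finsum_cong') (auto simp: R.m_comm)
  also have "\<dots> = ap \<phi> m" using assms m by (intro finsum_dual_basis) simp_all
  finally show "ap (\<Oplus>\<^bsub>D0\<^esub>i\<in>I. ap \<phi> (n i) \<odot>\<^bsub>D0\<^esub> nd i) m = ap \<phi> m" .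
qed (rule assms)

section \<open>Action and coaction on the dual\<close>

definition "dact h \<phi> = (\<lambda>m. if m \<in> carrier M then ap \<phi> (S h \<rhd> m) else \<zero>\<^bsub>R\<^esub>)"

lemma ap_dact [simp]: "m \<in> carrier M \<Longrightarrow> ap (dact h \<phi>) m = ap \<phi> (S h \<rhd> m)"
  by (simp add: dact_def ap_def)

lemma dact_closed [simp]:
  assumes "h \<in> carrier H" "\<phi> \<in> carrier D0" shows "dact h \<phi> \<in> carrier D0"
proof -
  have "lin R M KR (dact h \<phi>)"
    by (rule lin_cong[where g="\<lambda>m. ap \<phi> (S h \<rhd> m)"]) (simp_all add: dact_def assms)
  then show ?thesis by (simp add: dual_carrier) (simp add: dact_def)
qed

lemma lin_dact1 [simp]: "module R A \<Longrightarrow> lin R A H f \<Longrightarrow> \<phi> \<in> carrier D0 \<Longrightarrow> lin R A D0 (\<lambda>x. dact (f x) \<phi>)"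
  by (rule lin_D0I) (simp_all add: lin_closed)

lemma lin_dact2 [simp]: "module R A \<Longrightarrow> lin R A D0 f \<Longrightarrow> h \<in> carrier H \<Longrightarrow> lin R A D0 (\<lambda>x. dact h (f x))"
  by (rule lin_D0I) (simp_all add: lin_closed)

text \<open>\<open>dK \<phi> m\<close> is the value \<open>\<phi>\<^sub>[\<^sub>-\<^sub>1\<^sub>] \<phi>\<^sub>[\<^sub>0\<^sub>](m)\<close> the coaction on the dual has to have.\<close>

abbreviation "dK \<phi> m \<equiv> csum H m (\<lambda>a y. ap \<phi> y \<odot>\<^bsub>H\<^esub> T a)"

text \<open>The preimage of \<open>dK \<phi>\<close> under the identification of \<open>HD\<close>
  with Hom(M, H).\<close>

definition "dco \<phi> = (\<Oplus>\<^bsub>HD\<^esub>i\<in>I. pHD (dK \<phi> (n i)) (nd i))"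

lemma lin_dco [simp]: "module R A \<Longrightarrow> lin R A D0 f \<Longrightarrow> lin R A HD (\<lambda>x. dco (f x))"
  unfolding dco_def by simp

lemma dco_closed [simp]: "\<phi> \<in> carrier D0 \<Longrightarrow> dco \<phi> \<in> carrier HD"
  by (rule lin_closed[OF lin_dco[OF mod_D0 lin_id]])

abbreviation evD where "evD N m X \<equiv> sw R N D0 N X (\<lambda>a \<phi>. ap \<phi> m \<odot>\<^bsub>N\<^esub> a)"

lemma evD_dco:
  assumes [simp]: "\<phi> \<in> carrier D0" "m \<in> carrier M"
  shows "evD H m (dco \<phi>) = dK \<phi> m"
proof -
  have "evD H m (dco \<phi>) = (\<Oplus>\<^bsub>H\<^esub>i\<in>I. evD H m (pHD (dK \<phi> (n i)) (nd i)))"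
    unfolding dco_def by (rule lin_finsum[of R HD H "evD H m"]) (simp_all add: bil_def)
  also have "\<dots> = (\<Oplus>\<^bsub>H\<^esub>i\<in>I. ap (nd i) m \<odot>\<^bsub>H\<^esub> dK \<phi> (n i))"
    by (intro module_finsum_cong[of R H]) (auto simp: sw_pure bil_def)
  also have "\<dots> = dK \<phi> m"
    by (intro finsum_dual_basis) (simp_all add: bil_def)
  finally show ?thesis .
qed

text \<open>Both sides are linear in X. On a pure tensor the scalars \<phi>(n i) can be moved to the
  second factor, where they reassemble \<phi>.\<close>

lemma tensor_D_expand:
  assumes [simp]: "module R N" "X \<in> carrier (tensor_module R N D0)"
  shows "X = (\<Oplus>\<^bsub>tensor_module R N D0\<^esub>i\<in>I. pure_tensor R N D0 (evD N (n i) X) (nd i))"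
proof -
  let ?T = "tensor_module R N D0"
  interpret T: module R ?T by simp
  interpret D: module R D0 by simp
  show ?thesis
  proof (rule lin_tensor_eqI[of R N D0 ?T "\<lambda>X. X"])
    fix a \<phi> assume a [simp]: "a \<in> carrier N" and p [simp]: "\<phi> \<in> carrier D0"
    have "(\<Oplus>\<^bsub>?T\<^esub>i\<in>I. pure_tensor R N D0 (evD N (n i) (pure_tensor R N D0 a \<phi>)) (nd i))
       = (\<Oplus>\<^bsub>?T\<^esub>i\<in>I. pure_tensor R N D0 a (ap \<phi> (n i) \<odot>\<^bsub>D0\<^esub> nd i))"
      by (intro T.finsum_cong')
        (auto simp: sw_pure bil_def lin_smult[OF lin_pure1[OF _ _ lin_id]] lin_smult[OF lin_pure2[OF _ _ lin_id]]
          intro!: smult_closed')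
    also have "\<dots> = pure_tensor R N D0 a (\<Oplus>\<^bsub>D0\<^esub>i\<in>I. ap \<phi> (n i) \<odot>\<^bsub>D0\<^esub> nd i)"
      by (intro lin_finsum[symmetric, of R D0 ?T "pure_tensor R N D0 a"]) auto
    finally show "pure_tensor R N D0 a \<phi> = (\<Oplus>\<^bsub>?T\<^esub>i\<in>I. pure_tensor R N D0 (evD N (n i) (pure_tensor R N D0 a \<phi>)) (nd i))"
      by (simp add: dual_expand)
  qed (simp_all add: bil_def)
qed

lemma tensor_D_eqI:
  assumes N: "module R N" and X: "X \<in> carrier (tensor_module R N D0)" and Y: "Y \<in> carrier (tensor_module R N D0)"
    and e: "\<And>m. m \<in> carrier M \<Longrightarrow> evD N m X = evD N m Y"
  shows "X = Y"
proof -
  interpret T: module R "tensor_module R N D0" using N by simp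
  have [simp]: "ap \<phi> m \<odot>\<^bsub>N\<^esub> a \<in> carrier N" if "\<phi> \<in> carrier D0" "a \<in> carrier N" for \<phi> m a
    using N that by simp
  have "X = (\<Oplus>\<^bsub>tensor_module R N D0\<^esub>i\<in>I. pure_tensor R N D0 (evD N (n i) X) (nd i))"
    by (rule tensor_D_expand[OF N X])
  also have "\<dots> = (\<Oplus>\<^bsub>tensor_module R N D0\<^esub>i\<in>I. pure_tensor R N D0 (evD N (n i) Y) (nd i))"
    using N by (intro T.finsum_cong') (auto simp: e)
  also have "\<dots> = Y" by (rule tensor_D_expand[OF N Y, symmetric])
  finally show ?thesis .
qed

section \<open>The Yetter-Drinfeld axioms for the dual\<close>

definition D :: "('k, 'h, 'm \<Rightarrow> 'k) yd_mod" where
  "D = \<lparr>carrier = carrier D0, monoid.mult = undefined, one = undefined, zero = zero D0, add = add D0,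
    smult = smult D0, act = dact, coact = dco\<rparr>"

lemma D_simps [simp]: "carrier D = carrier D0" "act D = dact" "coact D = dco" "smult D = smult D0"
  by (simp_all add: D_def)

lemma same_D [simp]: "same_module D D0" "same_module D0 D" by (simp_all add: same_module_def D_def)

lemma mod_D [simp]: "module R D" by (rule same_module_module[OF same_D(1) mod_D0])

lemma tensor_D [simp]: "tensor_module R A D = tensor_module R A D0" "pure_tensor R A D = pure_tensor R A D0"
  "tensor_module R D A = tensor_module R D0 A" "pure_tensor R D A = pure_tensor R D0 A"
  by (rule same_module_tensor; simp)+

lemma lin_D [simp]: "lin R A D f \<longleftrightarrow> lin R A D0 f" "lin R D B g \<longleftrightarrow> lin R D0 B g"
  by (rule same_module_lin; simp)+

text \<open>Evaluated at m, the left side is the coproduct of T(m_[-1]), and the right side applies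
  T to the two components of the iterated coaction in reversed order. As T reverses coproducts too,
  coassociativity for M makes them agree.\<close>

lemma dco_coassoc:
  assumes [simp]: "\<phi> \<in> carrier D0"
  defines "Q \<equiv> tensor_module R HH D0"
  shows "sw R H D0 Q (dco \<phi>) (\<lambda>a \<psi>. pure_tensor R HH D0 (comult H a) \<psi>) =
    sw R H D0 Q (dco \<phi>) (\<lambda>a \<psi>. sw R H D0 Q (dco \<psi>) (\<lambda>b \<chi>. pure_tensor R HH D0 (pHH a b) \<chi>))"
    (is "?L = ?R")
proof (rule tensor_D_eqI[of HH])
  show "?L \<in> carrier (tensor_module R HH D0)" "?R \<in> carrier (tensor_module R HH D0)"
    unfolding Q_def by (intro sw_closed; simp)+
  fix m assume m [simp]: "m \<in> carrier M"
  have "evD HH m ?L = sw R H D0 HH (dco \<phi>) (\<lambda>a \<psi>. ap \<psi> m \<odot>\<^bsub>HH\<^esub> comult H a)"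
    unfolding Q_def by (simp add: sw_sw sw_pure bil_def)
  also have "\<dots> = comult H (evD H m (dco \<phi>))"
    by (simp add: sw_push[where g="comult H" and Q=HH and P=H] lin_smult[OF lin_comult0])
  also have "\<dots> = comult H (dK \<phi> m)" by (simp add: evD_dco)
  also have "\<dots> = csum HH m (\<lambda>a y. ap \<phi> y \<odot>\<^bsub>HH\<^esub> dsum HH (T a) pHH)"
    by (simp add: sw_push[where g="comult H" and Q=HH and P=H] lin_smult[OF lin_comult0] sw_expand)
  also have "\<dots> = csum HH m (\<lambda>a y. dsum HH a (\<lambda>b c. ap \<phi> y \<odot>\<^bsub>HH\<^esub> pHH (T c) (T b)))"
    by (simp add: comult_T bil_def smult_sw)
  also have "\<dots> = csum HH m (\<lambda>a x. csum HH x (\<lambda>b y. ap \<phi> y \<odot>\<^bsub>HH\<^esub> pHH (T b) (T a)))"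
    by (rule sweedler_coact_coassoc) (simp_all add: tril_def)
  also have "\<dots> = csum HH m (\<lambda>a x. pHH (dK \<phi> x) (T a))"
    by (simp add: sw_push[where g="\<lambda>u. pHH u (T _)" and Q=HH and P=H] lin_smult[OF lin_pure1[OF _ _ lin_id]])
  also have "\<dots> = csum HH m (\<lambda>a x. sw R H D0 HH (dco \<phi>) (\<lambda>b \<psi>. ap \<psi> x \<odot>\<^bsub>HH\<^esub> pHH b (T a)))"
    by (simp add: evD_dco[symmetric] sw_push[where g="\<lambda>u. pHH u (T _)" and Q=HH and P=H] lin_smult[OF lin_pure1[OF _ _ lin_id]])
  also have "\<dots> = sw R H D0 HH (dco \<phi>) (\<lambda>b \<psi>. csum HH m (\<lambda>a x. ap \<psi> x \<odot>\<^bsub>HH\<^esub> pHH b (T a)))"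
    by (rule sw_swap) simp_all
  also have "\<dots> = sw R H D0 HH (dco \<phi>) (\<lambda>b \<psi>. pHH b (dK \<psi> m))"
    by (simp add: sw_push[where g="pHH _" and Q=HH and P=H] lin_smult[OF lin_pure2[OF _ _ lin_id]])
  also have "\<dots> = sw R H D0 HH (dco \<phi>) (\<lambda>a \<psi>. sw R H D0 HH (dco \<psi>) (\<lambda>b \<chi>. ap \<chi> m \<odot>\<^bsub>HH\<^esub> pHH a b))"
    by (simp add: evD_dco[symmetric] sw_push[where g="pHH _" and Q=HH and P=H] lin_smult[OF lin_pure2[OF _ _ lin_id]])
  also have "\<dots> = evD HH m ?R"
    unfolding Q_def by (simp add: sw_sw sw_pure bil_def)
  finally show "evD HH m ?L = evD HH m ?R" .
qed simp

lemma dco_counit: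
  assumes [simp]: "\<phi> \<in> carrier D0"
  shows "sw R H D0 D0 (dco \<phi>) (\<lambda>a \<psi>. \<epsilon> a \<odot>\<^bsub>D0\<^esub> \<psi>) = \<phi>"
proof (rule D0_eqI)
  fix m assume m [simp]: "m \<in> carrier M"
  have "ap (sw R H D0 D0 (dco \<phi>) (\<lambda>a \<psi>. \<epsilon> a \<odot>\<^bsub>D0\<^esub> \<psi>)) m = sw R H D0 KR (dco \<phi>) (\<lambda>a \<psi>. ap \<psi> m \<otimes>\<^bsub>R\<^esub> \<epsilon> a)"
    by (simp add: sw_push[where g="\<lambda>x. ap x m" and Q=KR and P=D0] R.m_comm)
  also have "\<dots> = \<epsilon> (evD H m (dco \<phi>))"
    by (simp add: sw_push[where g="\<epsilon>" and Q=KR and P=H] lin_smult[OF lin_counit0])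
  also have "\<dots> = csum KR m (\<lambda>a y. \<epsilon> a \<odot>\<^bsub>KR\<^esub> ap \<phi> y)"
    by (simp add: evD_dco sw_push[where g="\<epsilon>" and Q=KR and P=H] lin_smult[OF lin_counit0] R.m_comm)
  also have "\<dots> = ap \<phi> m"
    by (rule sweedler_coact_counit) simp_all
  finally show "ap (sw R H D0 D0 (dco \<phi>) (\<lambda>a \<psi>. \<epsilon> a \<odot>\<^bsub>D0\<^esub> \<psi>)) m = ap \<phi> m" .
qed simp_all

lemma dK_compatibility:
  assumes [simp]: "h \<in> carrier H" "\<phi> \<in> carrier D0" "m \<in> carrier M"
  shows "dsum H h (\<lambda>a b. a \<cdot> dK \<phi> (S b \<rhd> m)) = dsum H h (\<lambda>a b. dK (dact a \<phi>) m \<cdot> b)"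
proof -
  \<comment> \<open>Here T(c) b is written as T(S(b) c), which brings the components of S(h) next to
    the coaction of m.\<close>
  have "dsum H h (\<lambda>a b. dK (dact a \<phi>) m \<cdot> b) = dsum H h (\<lambda>a b. csum H m (\<lambda>c x. ap \<phi> (S a \<rhd> x) \<odot>\<^bsub>H\<^esub> T (S b \<cdot> c)))"
    by (simp add: sw_push[where g="\<lambda>u. u \<cdot> _" and Q=H and P=H] T_mult smult_mult_left)
  also have "\<dots> = dsum H (S h) (\<lambda>a b. csum H m (\<lambda>c x. ap \<phi> (b \<rhd> x) \<odot>\<^bsub>H\<^esub> T (a \<cdot> c)))"
    by (rule comult_S[symmetric]) (simp_all add: bil_def)
  also have "\<dots> = dsum H (S h) (\<lambda>a b. csum H (a \<rhd> m) (\<lambda>c x. ap \<phi> x \<odot>\<^bsub>H\<^esub> T (c \<cdot> b)))"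
    by (rule sweedler_compatibility) (simp_all add: bil_def)
  also have "\<dots> = dsum H h (\<lambda>a b. csum H (S b \<rhd> m) (\<lambda>c x. ap \<phi> x \<odot>\<^bsub>H\<^esub> T (c \<cdot> S a)))"
    by (rule comult_S) (simp_all add: bil_def)
  also have "\<dots> = dsum H h (\<lambda>a b. a \<cdot> dK \<phi> (S b \<rhd> m))"
    by (simp add: sw_push[where g="\<lambda>u. _ \<cdot> u" and Q=H and P=H] T_mult smult_mult_right)
  finally show ?thesis ..
qed

text \<open>The evaluated form of the invariance of the dual coaction under \<Delta>(1). After the
  flip of \<Delta>(1) by S it is the same invariance for M.\<close>

lemma dK_one:
  assumes [simp]: "\<phi> \<in> carrier D0" "m \<in> carrier M"
  shows "osum H (\<lambda>a b. a \<cdot> dK \<phi> (S b \<rhd> m)) = dK \<phi> m"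
proof -
  have "osum H (\<lambda>a b. a \<cdot> dK \<phi> (S b \<rhd> m)) = osum H (\<lambda>a b. dK (dact a \<phi>) m \<cdot> b)"
    by (rule dK_compatibility) simp_all
  also have "\<dots> = osum H (\<lambda>a b. csum H m (\<lambda>c x. ap \<phi> (S a \<rhd> x) \<odot>\<^bsub>H\<^esub> T (S b \<cdot> c)))"
    by (simp add: sw_push[where g="\<lambda>u. u \<cdot> _" and Q=H and P=H] T_mult smult_mult_left)
  also have "\<dots> = osum H (\<lambda>a b. csum H m (\<lambda>c x. ap \<phi> (b \<rhd> x) \<odot>\<^bsub>H\<^esub> T (a \<cdot> c)))"
    by (rule osum_S_flip) (simp_all add: bil_def)
  also have "\<dots> = dK \<phi> m"
    by (rule coact_t) (simp_all add: bil_def)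
  finally show ?thesis .
qed

lemma evD_act_dco:
  assumes [simp]: "h \<in> carrier H" "\<phi> \<in> carrier D0" "m \<in> carrier M"
  shows "evD H m (dsum HD h (\<lambda>a b. sw R H D0 HD (dco \<phi>) (\<lambda>c \<psi>. pHD (a \<cdot> c) (dact b \<psi>)))) =
     dsum H h (\<lambda>a b. a \<cdot> dK \<phi> (S b \<rhd> m))"
proof -
  have "evD H m (dsum HD h (\<lambda>a b. sw R H D0 HD (dco \<phi>) (\<lambda>c \<psi>. pHD (a \<cdot> c) (dact b \<psi>)))) =
     dsum H h (\<lambda>a b. sw R H D0 H (dco \<phi>) (\<lambda>c \<psi>. ap \<psi> (S b \<rhd> m) \<odot>\<^bsub>H\<^esub> (a \<cdot> c)))"
    by (simp add: sw_sw sw_pure bil_def)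
  also have "\<dots> = dsum H h (\<lambda>a b. a \<cdot> evD H (S b \<rhd> m) (dco \<phi>))"
    by (simp add: sw_push[where g="\<lambda>u. _ \<cdot> u" and Q=H and P=H] smult_mult_right)
  finally show ?thesis by (simp add: evD_dco)
qed

lemma tensor_act_D:
  assumes "h \<in> carrier H" "X \<in> carrier HD"
  shows "tensor_act R H D (monoid.mult H) dact (comult H h) X =
    dsum HD h (\<lambda>a b. sw R H D0 HD X (\<lambda>c \<psi>. pHD (a \<cdot> c) (dact b \<psi>)))"
  using assms by (simp add: tensor_act_def tensor_map_def tensor_lift_dsum sw_eq_tensor_lift[of R H D0])

lemma tensor_lift_dco:
  assumes "module R P" "\<phi> \<in> carrier D0" "\<And>a b. a \<in> carrier H \<Longrightarrow> b \<in> carrier D0 \<Longrightarrow> f a b \<in> carrier P"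
  shows "tensor_lift R P f (dco \<phi>) = sw R H D0 P (dco \<phi>) f"
  using assms by (intro sw_eq_tensor_lift) auto

lemma yetter_drinfeld_D: "yetter_drinfeld R H D"
proof (intro yetter_drinfeld.intro left_hmodule.intro yetter_drinfeld_axioms.intro left_hmodule_axioms.intro)
  show "weak_bialgebra R H" by (rule weak_bialgebra_axioms)
  show "module R D" by simp
  show "coact D \<in> linear_maps R D (tensor_module R H D)"
    unfolding lin_def[symmetric] by (simp add: lin_dco[OF mod_D0 lin_id])
next
  fix h assume h: "h \<in> carrier H"
  show "act D h \<in> linear_maps R D D" unfolding lin_def[symmetric] using h by (simp add: lin_dact2[OF mod_D0 lin_id])
next
  fix \<phi> assume "\<phi> \<in> carrier D"
  then have p [simp]: "\<phi> \<in> carrier D0" by simp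
  show "(\<lambda>h. act D h \<phi>) \<in> linear_maps R H D" unfolding lin_def[symmetric] by simp
  show "act D \<one>\<^bsub>H\<^esub> \<phi> = \<phi>" by (rule D0_eqI) simp_all
  show "tensor_lift R (tensor_module R HH D) (\<lambda>a. pure_tensor R HH D (comult H a)) (coact D \<phi>) =
    tensor_lift R (tensor_module R HH D)
      (\<lambda>a x. tensor_lift R (tensor_module R HH D) (\<lambda>b. pure_tensor R HH D (pHH a b)) (coact D x)) (coact D \<phi>)"
    using dco_coassoc[OF p] by (simp add: tensor_lift_dco)
  have "tensor_lift R D (\<lambda>a. (\<odot>\<^bsub>D\<^esub>) (\<epsilon> a)) (coact D \<phi>) = sw R H D0 D0 (dco \<phi>) (\<lambda>a \<psi>. \<epsilon> a \<odot>\<^bsub>D0\<^esub> \<psi>)"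
    using sw_push[of R H D0 D D0 "\<lambda>x. x" "\<lambda>a \<psi>. \<epsilon> a \<odot>\<^bsub>D0\<^esub> \<psi>" "dco \<phi>"]
    by (simp add: tensor_lift_dco)
  then show "tensor_lift R D (\<lambda>a. (\<odot>\<^bsub>D\<^esub>) (\<epsilon> a)) (coact D \<phi>) = \<phi>" by (simp add: dco_counit)
  \<comment> \<open>Membership in the truncated product: the coaction value is its own preimage
    under multiplication by \<Delta>(1).\<close>
  have "dco \<phi> = tensor_act R H D (monoid.mult H) dact (comult H \<one>\<^bsub>H\<^esub>) (dco \<phi>)"
    by (rule tensor_D_eqI[of H]) (simp_all add: tensor_act_D evD_act_dco dK_one evD_dco)
  then show "coact D \<phi> \<in> carrier (tensor_t R H H D (\<otimes>\<^bsub>H\<^esub>) (act D))"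
    by (auto simp: tensor_t_def)
  fix h assume h [simp]: "h \<in> carrier H"
  show "tensor_act R H D (\<otimes>\<^bsub>H\<^esub>) (act D) (comult H h) (coact D \<phi>) =
    tensor_lift R (tensor_module R H D)
      (\<lambda>a b. tensor_lift R (tensor_module R H D) (\<lambda>c. pure_tensor R H D (c \<cdot> b)) (coact D (act D a \<phi>))) (comult H h)"
  proof -
    let ?R = "dsum HD h (\<lambda>a b. sw R H D0 HD (dco (dact a \<phi>)) (\<lambda>c \<psi>. pHD (c \<cdot> b) \<psi>))"
    have "evD H m ?R = dsum H h (\<lambda>a b. dK (dact a \<phi>) m \<cdot> b)" if [simp]: "m \<in> carrier M" for m
    proof -
      have "evD H m ?R = dsum H h (\<lambda>a b. sw R H D0 H (dco (dact a \<phi>)) (\<lambda>c \<psi>. ap \<psi> m \<odot>\<^bsub>H\<^esub> (c \<cdot> b)))"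
        by (simp add: sw_sw sw_pure bil_def)
      also have "\<dots> = dsum H h (\<lambda>a b. evD H m (dco (dact a \<phi>)) \<cdot> b)"
        by (simp add: sw_push[where g="\<lambda>u. u \<cdot> _" and Q=H and P=H] smult_mult_left)
      finally show ?thesis by (simp add: evD_dco)
    qed
    then have "tensor_act R H D (\<otimes>\<^bsub>H\<^esub>) dact (comult H h) (dco \<phi>) = ?R"
      by (intro tensor_D_eqI[of H]) (simp_all add: tensor_act_D evD_act_dco dK_compatibility)
    then show ?thesis by (simp add: tensor_lift_dsum tensor_lift_dco)
  qed
  fix g assume g [simp]: "g \<in> carrier H"
  show "act D (g \<cdot> h) \<phi> = act D g (act D h \<phi>)"
    by (rule D0_eqI) (simp_all add: S_mult act_mult)
qed

end

section \<open>Truncated tensor products\<close>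

text \<open>For the truncated products and for H_t, whose carriers are images of linear maps and
  whose operations are inherited.\<close>

lemma lin_image_module:
  assumes M: "module R M" and N: "module R N" and f: "lin R M N f"
    and N': "carrier N' = f ` carrier M" "zero N' = zero N" "add N' = add N" "smult N' = smult N"
  shows "module R N'"
proof -
  interpret M: module R M by fact
  interpret N: module R N by fact
  have "submodule (f ` carrier M) R N"
  proof (rule N.submoduleI)
    show "\<zero>\<^bsub>N\<^esub> \<in> f ` carrier M" 
      using lin_zero[OF M N f] imageI[OF M.zero_closed, of f] by simp
    fix a assume "a \<in> f ` carrier M"
    then obtain x where x: "x \<in> carrier M" "a = f x" by auto
    have "f ((\<ominus>\<^bsub>R\<^esub> \<one>\<^bsub>R\<^esub>) \<odot>\<^bsub>M\<^esub> x) = \<ominus>\<^bsub>N\<^esub> a"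
      using x lin_closed[OF f x(1)] by (subst lin_smult[OF f]) (simp_all add: N.smult_l_minus)
    then show "\<ominus>\<^bsub>N\<^esub> a \<in> f ` carrier M" 
      using x imageI[of "(\<ominus>\<^bsub>R\<^esub> \<one>\<^bsub>R\<^esub>) \<odot>\<^bsub>M\<^esub> x" "carrier M" f] by simp
  next
    fix a b assume "a \<in> f ` carrier M" "b \<in> f ` carrier M"
    then show "a \<oplus>\<^bsub>N\<^esub> b \<in> f ` carrier M"
      by (auto simp: lin_add[OF f, symmetric])
  next
    fix r x assume "r \<in> carrier R" "x \<in> f ` carrier M"
    then show "r \<odot>\<^bsub>N\<^esub> x \<in> f ` carrier M" by (auto simp: lin_smult[OF f, symmetric])
  qed (use lin_closed[OF f] in auto)
  then have "module R (N\<lparr>carrier := f ` carrier M\<rparr>)" by (rule submodule.submodule_is_module[OF _ N])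
  moreover have "same_module N' (N\<lparr>carrier := f ` carrier M\<rparr>)" using N' by (simp add: same_module_def)
  ultimately show ?thesis using same_module_module by blast
qed

lemma same_module_tensor_act:
  assumes "same_module M M'" "same_module N N'"
  shows "tensor_act R M N = tensor_act R M' N'" "tensor_map R M N = tensor_map R M' N'"
  using same_module_tensor[OF assms, of R] by (simp_all add: fun_eq_iff tensor_act_def tensor_map_def)

text \<open>The actions are parameters instead of record fields, which allows \<open>D0\<close> and
  \<open>U0\<close>, whose records carry no action, as factors.\<close>

locale hmodule_pair = weak_bialgebra R H
  for R :: "('k, 'z) ring_scheme" and H :: "('k, 'h, 'y) weak_bialg_scheme" +
  fixes A :: "('k, 'a, 'u) module_scheme" and B :: "('k, 'b, 'v) module_scheme" and \<alpha> \<beta>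
  assumes mod_A [simp]: "module R A" and mod_B [simp]: "module R B"
    and lin_\<alpha>1: "a \<in> carrier A \<Longrightarrow> lin R H A (\<lambda>h. \<alpha> h a)" and lin_\<alpha>2: "h \<in> carrier H \<Longrightarrow> lin R A A (\<alpha> h)"
    and lin_\<beta>1: "b \<in> carrier B \<Longrightarrow> lin R H B (\<lambda>h. \<beta> h b)" and lin_\<beta>2: "h \<in> carrier H \<Longrightarrow> lin R B B (\<beta> h)"
    and \<alpha>_mult: "\<lbrakk>g \<in> carrier H; h \<in> carrier H; a \<in> carrier A\<rbrakk> \<Longrightarrow> \<alpha> (g \<cdot> h) a = \<alpha> g (\<alpha> h a)"
    and \<beta>_mult: "\<lbrakk>g \<in> carrier H; h \<in> carrier H; b \<in> carrier B\<rbrakk> \<Longrightarrow> \<beta> (g \<cdot> h) b = \<beta> g (\<beta> h b)"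
begin

abbreviation "AB \<equiv> tensor_module R A B"
abbreviation "tact g X \<equiv> tensor_act R A B \<alpha> \<beta> (comult H g) X"
abbreviation "At \<equiv> tensor_t R H A B \<alpha> \<beta>"

lemma lin_acts [simp]:
  "lin R C H f \<Longrightarrow> a \<in> carrier A \<Longrightarrow> lin R C A (\<lambda>x. \<alpha> (f x) a)"
  "lin R C A k \<Longrightarrow> h \<in> carrier H \<Longrightarrow> lin R C A (\<lambda>x. \<alpha> h (k x))"
  "lin R C H f \<Longrightarrow> b \<in> carrier B \<Longrightarrow> lin R C B (\<lambda>x. \<beta> (f x) b)"
  "lin R C B k' \<Longrightarrow> h \<in> carrier H \<Longrightarrow> lin R C B (\<lambda>x. \<beta> h (k' x))"
  by (rule lin_compose[OF lin_\<alpha>1] lin_compose[OF lin_\<alpha>2] lin_compose[OF lin_\<beta>1] lin_compose[OF lin_\<beta>2]; assumption)+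

lemma acts_closed [simp]:
  "h \<in> carrier H \<Longrightarrow> a \<in> carrier A \<Longrightarrow> \<alpha> h a \<in> carrier A"
  "h \<in> carrier H \<Longrightarrow> b \<in> carrier B \<Longrightarrow> \<beta> h b \<in> carrier B"
  by (rule lin_closed[OF lin_\<alpha>2] lin_closed[OF lin_\<beta>2]; assumption)+

lemma tact_eq:
  "g \<in> carrier H \<Longrightarrow> X \<in> carrier AB \<Longrightarrow>
    tact g X = dsum AB g (\<lambda>p q. sw R A B AB X (\<lambda>a b. pure_tensor R A B (\<alpha> p a) (\<beta> q b)))"
  by (simp add: tensor_act_def tensor_map_def tensor_lift_dsum sw_eq_tensor_lift[of R A B])

lemma lin_tact0: "g \<in> carrier H \<Longrightarrow> lin R AB AB (tact g)"
  by (rule lin_cong[OF _ tact_eq]) (simp_all add: bil_def)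

lemma tact_closed0: "g \<in> carrier H \<Longrightarrow> X \<in> carrier AB \<Longrightarrow> tact g X \<in> carrier AB"
  by (rule lin_closed[OF lin_tact0])

lemma tact_pure:
  "g \<in> carrier H \<Longrightarrow> a \<in> carrier A \<Longrightarrow> b \<in> carrier B \<Longrightarrow>
    tact g (pure_tensor R A B a b) = dsum AB g (\<lambda>p q. pure_tensor R A B (\<alpha> p a) (\<beta> q b))"
  by (simp add: tact_eq sw_pure bil_def)

text \<open>On pure tensors this is the multiplicativity of \<Delta>.\<close>

lemma tact_tact:
  assumes [simp]: "g \<in> carrier H" "h \<in> carrier H" and X: "X \<in> carrier AB"
  shows "tact g (tact h X) = tact (g \<cdot> h) X"
proof (rule lin_tensor_eqI[OF mod_A mod_B _ _ _ _ X, of AB "\<lambda>X. tact g (tact h X)" "tact (g \<cdot> h)"])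
  show "lin R AB AB (\<lambda>X. tact g (tact h X))" by (rule lin_compose[OF lin_tact0 lin_tact0]) simp_all
  fix a b assume [simp]: "a \<in> carrier A" "b \<in> carrier B"
  have "tact g (tact h (pure_tensor R A B a b)) = dsum AB h (\<lambda>p q. tact g (pure_tensor R A B (\<alpha> p a) (\<beta> q b)))"
    by (simp add: tact_pure[of h] sw_push[where g="tact g" and P=AB and Q=AB] lin_tact0)
  also have "\<dots> = dsum AB h (\<lambda>p q. dsum AB g (\<lambda>r s. pure_tensor R A B (\<alpha> (r \<cdot> p) a) (\<beta> (s \<cdot> q) b)))"
    by (simp add: tact_pure \<alpha>_mult \<beta>_mult)
  also have "\<dots> = dsum AB g (\<lambda>r s. dsum AB h (\<lambda>p q. pure_tensor R A B (\<alpha> (r \<cdot> p) a) (\<beta> (s \<cdot> q) b)))"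
    by (rule sw_swap) simp_all
  also have "\<dots> = tact (g \<cdot> h) (pure_tensor R A B a b)"
    by (simp add: tact_pure sweedler_comult_mult bil_def)
  finally show "tact g (tact h (pure_tensor R A B a b)) = tact (g \<cdot> h) (pure_tensor R A B a b)" .
qed (simp_all add: lin_tact0)

lemma At_module [simp]: "module R At"
  by (rule lin_image_module[OF _ _ lin_tact0[OF H.one_closed]]) (simp_all add: tensor_t_def)

lemma At_simps:
  "carrier At = tact \<one>\<^bsub>H\<^esub> ` carrier AB" "add At = add AB" "zero At = zero AB" "smult At = smult AB"
  by (simp_all add: tensor_t_def)

text \<open>By \<open>tact_tact\<close> multiplication by \<Delta>(1) is idempotent, so its image
  consists of its fixed points.\<close>

lemma At_carrier: "X \<in> carrier At \<longleftrightarrow> X \<in> carrier AB \<and> tact \<one>\<^bsub>H\<^esub> X = X"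
proof
  assume "X \<in> carrier At"
  then obtain Y where "Y \<in> carrier AB" "X = tact \<one>\<^bsub>H\<^esub> Y" unfolding At_simps by blast
  then show "X \<in> carrier AB \<and> tact \<one>\<^bsub>H\<^esub> X = X" by (simp add: tact_closed0 tact_tact)
next
  assume "X \<in> carrier AB \<and> tact \<one>\<^bsub>H\<^esub> X = X"
  then show "X \<in> carrier At" unfolding At_simps by (metis imageI)
qed

lemma At_AB [simp]: "X \<in> carrier At \<Longrightarrow> X \<in> carrier AB" by (simp add: At_carrier)

lemma lin_At_AB [simp]: "lin R At AB (\<lambda>x. x)"
  by (rule linI) (simp_all, simp_all add: At_simps)

lemma lin_AtI:
  assumes "lin R C AB f" "\<And>x. x \<in> carrier C \<Longrightarrow> f x \<in> carrier At"
  shows "lin R C At f"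
  using assms(2) lin_add[OF assms(1)] lin_smult[OF assms(1)] by (intro linI) (auto simp: At_simps)

lemma tact_closed [simp]: "g \<in> carrier H \<Longrightarrow> X \<in> carrier AB \<Longrightarrow> tact g X \<in> carrier At"
  by (simp add: At_carrier tact_closed0 tact_tact)

lemma lin_tact [simp]: "g \<in> carrier H \<Longrightarrow> lin R C AB f \<Longrightarrow> lin R C At (\<lambda>x. tact g (f x))"
  by (rule lin_AtI, rule lin_compose[OF lin_tact0]) (simp_all add: lin_closed)

end

section \<open>The unit object\<close>

context weak_bialgebra
begin

abbreviation "U0 \<equiv> unit_module R H"

lemma U0_simps: "carrier U0 = et ` carrier H" "add U0 = add H" "zero U0 = zero H" "smult U0 = smult H"
  by (simp_all add: unit_module_def)

lemma U0_carrier: "z \<in> carrier U0 \<longleftrightarrow> z \<in> carrier H \<and> et z = z"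
proof
  assume "z \<in> carrier U0"
  then obtain h where "h \<in> carrier H" "z = et h" unfolding U0_simps by blast
  then show "z \<in> carrier H \<and> et z = z" by simp
next
  assume "z \<in> carrier H \<and> et z = z"
  then show "z \<in> carrier U0" unfolding U0_simps by (metis imageI)
qed

lemma U0_H [simp]: "z \<in> carrier U0 \<Longrightarrow> z \<in> carrier H"
  and U0_et [simp]: "z \<in> carrier U0 \<Longrightarrow> et z = z"
  and et_U0 [simp]: "h \<in> carrier H \<Longrightarrow> et h \<in> carrier U0"
  by (simp_all add: U0_carrier)

lemma mod_U0 [simp]: "module R U0"
  by (rule lin_image_module[OF mod_H mod_H lin_et0]) (rule U0_simps)+

lemma lin_U0_H [simp]: "lin R U0 H (\<lambda>x. x)"
  apply (rule linI)
  apply (erule U0_H)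
  apply (simp only: U0_simps)
  apply (simp only: U0_simps)
done
lemma lin_U0I:
  assumes "lin R C H f" "\<And>x. x \<in> carrier C \<Longrightarrow> f x \<in> carrier U0"
  shows "lin R C U0 f"
  apply (rule linI)
  apply (erule assms(2))
  apply (simp only: U0_simps) apply (erule (1) lin_add[OF assms(1)])
  apply (simp only: U0_simps) apply (erule (1) lin_smult[OF assms(1)])
done
lemma lin_et_U0 [simp]: "lin R C H f \<Longrightarrow> lin R C U0 (\<lambda>x. et (f x))"
  apply (rule lin_U0I)
  apply (erule lin_et) 
  apply ( rule et_U0, erule (1) lin_closed)
 done

abbreviation "U \<equiv> yd_unit R H"

lemma same_U [simp]: "same_module U U0" "same_module U0 U"
  unfolding same_module_def yd_unit_def unit_module_def by simp_all

lemma U_simps [simp]: "carrier U = carrier U0" "act U h z = et (h \<cdot> z)"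
  "coact U z = tensor_map R H U0 (\<lambda>h. h) et (comult H z)"
  unfolding yd_unit_def unit_module_def by simp_all

lemma tensor_U [simp]: "tensor_module R A U = tensor_module R A U0" "pure_tensor R A U = pure_tensor R A U0"
  "tensor_module R U A = tensor_module R U0 A" "pure_tensor R U A = pure_tensor R U0 A"
  by (rule same_module_tensor; simp)+

lemma lin_U [simp]: "lin R A U f \<longleftrightarrow> lin R A U0 f" "lin R U B g \<longleftrightarrow> lin R U0 B g"
  by (rule same_module_lin; simp)+

end

section \<open>Evaluation and coevaluation\<close>

lemma yd_tensor_same: "same_module (yd_tensor R H A B) (tensor_t R H A B (act A) (act B))"
  by (simp add: yd_tensor_def Let_def same_module_def)

lemma yd_tensor_act: "act (yd_tensor R H A B) h = tensor_act R A B (act A) (act B) (comult H h)"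
  by (simp add: yd_tensor_def Let_def)

context yd_dual
begin

interpretation DM: hmodule_pair R H D0 M dact "act M"
proof (intro hmodule_pair.intro weak_bialgebra_axioms hmodule_pair_axioms.intro)
  fix g h \<phi> assume [simp]: "g \<in> carrier H" "h \<in> carrier H" "\<phi> \<in> carrier D0"
  show "dact (g \<cdot> h) \<phi> = dact g (dact h \<phi>)" by (rule D0_eqI) (simp_all add: S_mult act_mult)
qed (simp_all add: act_mult lin_dact2[OF mod_D0 lin_id])

interpretation MD: hmodule_pair R H M D0 "act M" dact
  by (intro hmodule_pair.intro weak_bialgebra_axioms hmodule_pair_axioms.intro) (simp_all add: act_mult lin_dact2[OF mod_D0 lin_id] DM.\<alpha>_mult)

lemmas tensor_act_dual [simp] = same_module_tensor_act(1)[OF same_D(1) same_module_refl]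
  same_module_tensor_act(1)[OF same_module_refl same_D(1)]

lemma project_DM: "project_t R H D M = DM.tact \<one>\<^bsub>H\<^esub>" "project_t R H M D = MD.tact \<one>\<^bsub>H\<^esub>"
  by (simp_all add: project_t_def)

lemma tensor_t_DM: "tensor_t R H D M dact (act M) = DM.At" "tensor_t R H M D (act M) dact = MD.At"
  by (simp_all add: tensor_t_def)

abbreviation "YDM \<equiv> yd_tensor R H D M"
abbreviation "YMD \<equiv> yd_tensor R H M D"

lemma same_YDM: "same_module YDM DM.At" and same_YMD: "same_module YMD MD.At"
  using yd_tensor_same[of R H D M] yd_tensor_same[of R H M D] by (simp_all add: tensor_t_DM)

lemmas tensor_YDM [simp] =
  same_module_tensor[OF same_module_refl same_YDM] same_module_tensor[OF same_YDM same_module_refl]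
  same_module_tensor[OF same_module_refl same_YMD] same_module_tensor[OF same_YMD same_module_refl]
  same_module_lin[OF same_YDM same_module_refl] same_module_lin[OF same_module_refl same_YMD]

lemma carrier_YDM [simp]: "carrier YDM = carrier DM.At" "carrier YMD = carrier MD.At"
  using same_YDM same_YMD unfolding same_module_def by blast+

lemma YDM_act [simp]: "act YDM h = DM.tact h" "act YMD h = MD.tact h"
  by (simp_all add: yd_tensor_act)

section \<open>Evaluation\<close>

definition "ev X = sw R D0 M H X (\<lambda>\<phi> m. osum H (\<lambda>a b. ap \<phi> (a \<rhd> m) \<odot>\<^bsub>H\<^esub> b))"

lemma lin_ev0 [simp]: "lin R C DM.AB f \<Longrightarrow> lin R C H (\<lambda>x. ev (f x))"
  unfolding ev_def by (rule lin_sw1) (simp_all add: bil_def)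

lemma ev_closed [simp]: "X \<in> carrier DM.AB \<Longrightarrow> ev X \<in> carrier H"
  by (rule lin_closed[OF lin_ev0[OF lin_id]])

lemma ev_pure:
  assumes "\<phi> \<in> carrier D0" "m \<in> carrier M"
  shows "ev (pDM \<phi> m) = osum H (\<lambda>a b. ap \<phi> (a \<rhd> m) \<odot>\<^bsub>H\<^esub> b)"
  using assms unfolding ev_def by (subst sw_pure) (simp_all add: bil_def)

text \<open>In S(h1) 1_1 h2 \<otimes> 1_2 the leg 1_1 stands between the factors that should meet.
  Replacing 1_1 h2 \<otimes> 1_2 by h2 \<otimes> et(h3) removes it, S(h1) h2 becomes es(h1), and
  es(h1) \<otimes> h2 = 1_1 \<otimes> h 1_2 restores the shape of evaluation with h in
  front.\<close>

lemma ev_act: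
  assumes [simp]: "h \<in> carrier H" and X: "X \<in> carrier DM.AB"
  shows "ev (DM.tact h X) = et (h \<cdot> ev X)"
proof (rule lin_tensor_eqI[OF mod_D0 mod_M _ _ _ _ X, of H "\<lambda>X. ev (DM.tact h X)" "\<lambda>X. et (h \<cdot> ev X)"])
  fix \<phi> m assume [simp]: "\<phi> \<in> carrier D0" "m \<in> carrier M"
  have "ev (DM.tact h (pDM \<phi> m)) = dsum H h (\<lambda>p q. ev (pDM (dact p \<phi>) (q \<rhd> m)))"
    by (simp add: DM.tact_pure sw_push[where g=ev and P=DM.AB and Q=H])
  also have "\<dots> = dsum H h (\<lambda>p q. osum H (\<lambda>a b. ap \<phi> (S p \<rhd> (a \<cdot> q) \<rhd> m) \<odot>\<^bsub>H\<^esub> b))"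
    by (simp add: ev_pure act_mult)
  also have "\<dots> = dsum H h (\<lambda>p q. dsum H q (\<lambda>a b. ap \<phi> (S p \<rhd> a \<rhd> m) \<odot>\<^bsub>H\<^esub> et b))"
    by (intro sw_cong refl comult_eps_t_right[symmetric]) (simp_all add: bil_def)
  also have "\<dots> = dsum H h (\<lambda>k b. dsum H k (\<lambda>p a. ap \<phi> (S p \<rhd> a \<rhd> m) \<odot>\<^bsub>H\<^esub> et b))"
    by (rule sweedler_coassoc[symmetric]) (simp_all add: tril_def)
  also have "\<dots> = dsum H h (\<lambda>k b. ap \<phi> (es k \<rhd> m) \<odot>\<^bsub>H\<^esub> et b)"
    by (simp add: act_mult[symmetric] lin_antipode_convolution(1)[where g="\<lambda>x. ap \<phi> (x \<rhd> m) \<odot>\<^bsub>H\<^esub> et _"])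
  also have "\<dots> = osum H (\<lambda>a b. ap \<phi> (a \<rhd> m) \<odot>\<^bsub>H\<^esub> et (h \<cdot> b))"
    by (rule comult_eps_s_left) (simp_all add: bil_def)
  also have "\<dots> = et (h \<cdot> ev (pDM \<phi> m))"
    by (simp add: ev_pure sw_push[where g="\<lambda>x. et (h \<cdot> x)" and P=H and Q=H] lin_smult[OF lin_et[OF lin_mult2[OF lin_id]]])
  finally show "ev (DM.tact h (pDM \<phi> m)) = et (h \<cdot> ev (pDM \<phi> m))" .
qed (simp_all add: lin_compose[OF DM.lin_tact0 lin_id])

lemma et_ev [simp]:
  assumes "X \<in> carrier DM.AB"
  shows "et (ev X) = ev X"
proof (rule lin_tensor_eqI[OF mod_D0 mod_M _ _ _ _ assms, of H "\<lambda>X. et (ev X)" ev])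
  fix \<phi> m assume [simp]: "\<phi> \<in> carrier D0" "m \<in> carrier M"
  have "osum H (\<lambda>a b. ap \<phi> (a \<rhd> m) \<odot>\<^bsub>H\<^esub> et b) = osum H (\<lambda>a b. ap \<phi> (a \<rhd> m) \<odot>\<^bsub>H\<^esub> b)"
    by (rule osum_et(1)) (simp_all add: bil_def)
  then show "et (ev (pDM \<phi> m)) = ev (pDM \<phi> m)"
    by (simp add: ev_pure sw_push[where g=et and P=H and Q=H] lin_smult[OF lin_et0])
qed simp_all

lemma ev_U0 [simp]: "X \<in> carrier DM.AB \<Longrightarrow> ev X \<in> carrier U0" by (rule iffD2[OF U0_carrier]) simp

lemma lin_ev [simp]: "lin R C DM.AB f \<Longrightarrow> lin R C U0 (\<lambda>x. ev (f x))"
  by (rule lin_U0I, simp, rule ev_U0, erule (1) lin_closed)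

text \<open>Since \<open>ev\<close> ignores the projection, it can be computed on pure tensors even
  where these occur projected.\<close>

lemma ev_project: "X \<in> carrier DM.AB \<Longrightarrow> ev (DM.tact \<one>\<^bsub>H\<^esub> X) = ev X"
  by (simp add: ev_act)

text \<open>The right legs of \<open>\<Delta>(1)\<close> lie in \<open>H\<^sub>t\<close> only as a sum, not term by term; so a tensor in \<open>H \<otimes> H\<^sub>t\<close>
  is written with a second factor \<open>et b\<close>, where \<open>b\<close> may be any element of \<open>H\<close>.\<close>

abbreviation "HU \<equiv> tensor_module R H U0"
abbreviation "pU a b \<equiv> pure_tensor R H U0 a (et b)"
abbreviation "HT \<equiv> tensor_module R H DM.At"
abbreviation "pHT \<equiv> pure_tensor R H DM.At"

lemma coact_U: "z \<in> carrier H \<Longrightarrow> coact U z = dsum HU z pU"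
  by (simp add: tensor_map_def tensor_lift_dsum)

lemma coact_YDM:
  assumes "X \<in> carrier DM.AB"
  shows "coact YDM X = sw R D0 M HT X (\<lambda>\<phi> m. sw R H D0 HT (dco \<phi>) (\<lambda>a \<psi>. csum HT m (\<lambda>b y.
     pHT (a \<cdot> b) (DM.tact \<one>\<^bsub>H\<^esub> (pDM \<psi> y)))))"
  using assms
  by (simp add: yd_tensor_def Let_def tensor_t_DM project_DM sw_eq_tensor_lift[of R D0 M] tensor_lift_csum tensor_lift_dco)

text \<open>The coaction on the second tensor factor contributes m_[-1], that on the dual an inverse
  antipode; when both come from one iterated coaction of m, their product collapses. The leg of
  \<Delta>(1) contained in \<open>ev\<close> has to be moved out of the way before that.\<close>

lemma ev_colinear:
  assumes X: "X \<in> carrier DM.AB"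
  shows "coact U (ev X) = tensor_map R H U (\<lambda>h. h) ev (coact YDM X)"
proof -
  let ?F = "\<lambda>X. sw R D0 M HT X (\<lambda>\<phi> m. sw R H D0 HT (dco \<phi>) (\<lambda>a \<psi>. csum HT m (\<lambda>b y.
     pHT (a \<cdot> b) (DM.tact \<one>\<^bsub>H\<^esub> (pDM \<psi> y)))))"
  let ?G = "\<lambda>Y. sw R H DM.At HU Y (\<lambda>a x. pure_tensor R H U0 a (ev x))"
  have [simp]: "bil R D0 M HT (\<lambda>\<phi> m. sw R H D0 HT (dco \<phi>) (\<lambda>a \<psi>. csum HT m (\<lambda>b y.
     pHT (a \<cdot> b) (DM.tact \<one>\<^bsub>H\<^esub> (pDM \<psi> y)))))"
    by (simp add: bil_def)
  have [simp]: "lin R DM.At U0 ev" using lin_ev[OF DM.lin_At_AB] .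
  have "dsum HU (ev X) pU = ?G (?F X)"
  proof (rule lin_tensor_eqI[OF mod_D0 mod_M _ _ _ _ X, of HU "\<lambda>X. dsum HU (ev X) pU" "\<lambda>X. ?G (?F X)"])
    fix \<phi> m assume [simp]: "\<phi> \<in> carrier D0" "m \<in> carrier M"
    have "?G (?F (pDM \<phi> m)) =
        sw R H D0 HU (dco \<phi>) (\<lambda>a \<psi>. csum HU m (\<lambda>b y. pure_tensor R H U0 (a \<cdot> b) (ev (pDM \<psi> y))))"
      by (simp add: sw_pure sw_sw bil_def ev_project)
    also have "\<dots> = sw R H D0 HU (dco \<phi>) (\<lambda>a \<psi>. csum HU m (\<lambda>b y. osum HU (\<lambda>e f. ap \<psi> (e \<rhd> y) \<odot>\<^bsub>HU\<^esub> pU (a \<cdot> b) f)))"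
    proof (intro sw_cong refl)
      fix a \<psi> b y assume [simp]: "a \<in> carrier H" "\<psi> \<in> carrier D0" "b \<in> carrier H" "y \<in> carrier M"
      have "pure_tensor R H U0 (a \<cdot> b) (ev (pDM \<psi> y)) = pU (a \<cdot> b) (ev (pDM \<psi> y))" by simp
      also have "\<dots> = osum HU (\<lambda>e f. ap \<psi> (e \<rhd> y) \<odot>\<^bsub>HU\<^esub> pU (a \<cdot> b) f)"
        unfolding ev_pure[OF \<open>\<psi> \<in> carrier D0\<close> \<open>y \<in> carrier M\<close>]
        by (simp add: sw_push[where g="\<lambda>u. pU (a \<cdot> b) u" and P=H and Q=HU] lin_smult[OF lin_pure2[OF _ _ lin_et_U0[OF lin_id]]])
      finally show "pure_tensor R H U0 (a \<cdot> b) (ev (pDM \<psi> y)) = osum HU (\<lambda>e f. ap \<psi> (e \<rhd> y) \<odot>\<^bsub>HU\<^esub> pU (a \<cdot> b) f)" .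
    qed
    also have "\<dots> = csum HU m (\<lambda>b y. sw R H D0 HU (dco \<phi>) (\<lambda>a \<psi>. osum HU (\<lambda>e f. ap \<psi> (e \<rhd> y) \<odot>\<^bsub>HU\<^esub> pU (a \<cdot> b) f)))"
      by (rule sw_swap) simp_all
    also have "\<dots> = csum HU m (\<lambda>b y. osum HU (\<lambda>e f. sw R H D0 HU (dco \<phi>) (\<lambda>a \<psi>. ap \<psi> (e \<rhd> y) \<odot>\<^bsub>HU\<^esub> pU (a \<cdot> b) f)))"
      by (intro sw_cong refl sw_swap) simp_all
    also have "\<dots> = csum HU m (\<lambda>b y. osum HU (\<lambda>e f. pU (evD H (e \<rhd> y) (dco \<phi>) \<cdot> b) f))"
      by (simp add: sw_push[where g="\<lambda>u. pU (u \<cdot> _) _" and P=H and Q=HU] lin_smult[OF lin_pure1[OF _ _ lin_mult1[OF lin_id]]])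
    also have "\<dots> = csum HU m (\<lambda>b y. osum HU (\<lambda>e f. csum HU (e \<rhd> y) (\<lambda>c w. ap \<phi> w \<odot>\<^bsub>HU\<^esub> pU (T c \<cdot> b) f)))"
      by (simp add: evD_dco sw_push[where g="\<lambda>u. pU (u \<cdot> _) _" and P=H and Q=HU] lin_smult[OF lin_pure1[OF _ _ lin_mult1[OF lin_id]]])
    also have "\<dots> = osum HU (\<lambda>e f. csum HU m (\<lambda>b y. csum HU (e \<rhd> y) (\<lambda>c w. ap \<phi> w \<odot>\<^bsub>HU\<^esub> pU (T c \<cdot> b) f)))"
      by (rule sw_swap) simp_all
    \<comment> \<open>\<open>coact_osum\<close> takes \<open>e\<close> out of the argument of the
      inner coaction and makes it a right factor of m_[-1]. The two coactions are now iterated ones,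
      ready for coassociativity.\<close>
    also have "\<dots> = osum HU (\<lambda>e f. csum HU m (\<lambda>b y. csum HU y (\<lambda>c w. ap \<phi> w \<odot>\<^bsub>HU\<^esub> pU (T c \<cdot> (b \<cdot> e)) f)))"
      by (rule coact_osum) (simp_all add: tril_def bil_def)
    also have "\<dots> = osum HU (\<lambda>e f. csum HU m (\<lambda>k w. dsum HU k (\<lambda>b c. ap \<phi> w \<odot>\<^bsub>HU\<^esub> pU (T c \<cdot> b \<cdot> e) f)))"
      by (simp add: H.m_assoc, intro sw_cong refl sweedler_coact_coassoc[symmetric]) (simp_all add: tril_def)
    also have "\<dots> = osum HU (\<lambda>e f. csum HU m (\<lambda>k w. ap \<phi> w \<odot>\<^bsub>HU\<^esub> pU (T (es k) \<cdot> e) f))"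
      by (simp add: lin_antipode_inv_convolution(1)[where g="\<lambda>u. ap \<phi> _ \<odot>\<^bsub>HU\<^esub> pU (u \<cdot> _) _"])
    also have "\<dots> = osum HU (\<lambda>e f. csum HU m (\<lambda>k w. osum HU (\<lambda>p q. \<epsilon> (k \<cdot> q) \<odot>\<^bsub>HU\<^esub> (ap \<phi> w \<odot>\<^bsub>HU\<^esub> pU (T p \<cdot> e) f))))"
      by (simp add: lin_eps_expand(2)[where P=HU and g="\<lambda>u. ap \<phi> _ \<odot>\<^bsub>HU\<^esub> pU (T u \<cdot> _) _"])
    also have "\<dots> = osum HU (\<lambda>e f. osum HU (\<lambda>p q. csum HU m (\<lambda>k w. \<epsilon> (k \<cdot> q) \<odot>\<^bsub>HU\<^esub> (ap \<phi> w \<odot>\<^bsub>HU\<^esub> pU (T p \<cdot> e) f))))"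
      by (intro sw_cong refl sw_swap) simp_all
    \<comment> \<open>The counit factor consumes the coaction of m and leaves \<open>esb q\<close>
      acting on it; \<open>esb q\<close> and \<open>T p\<close> together are then \<Delta>(1)
      again.\<close>
    also have "\<dots> = osum HU (\<lambda>e f. osum HU (\<lambda>p q. ap \<phi> (esb q \<rhd> m) \<odot>\<^bsub>HU\<^esub> pU (T p \<cdot> e) f))"
      by (simp add: coact_counit_right[where g="\<lambda>w. ap \<phi> w \<odot>\<^bsub>HU\<^esub> pU _ _"])
    also have "\<dots> = osum HU (\<lambda>e f. osum HU (\<lambda>p q. ap \<phi> (p \<rhd> m) \<odot>\<^bsub>HU\<^esub> pU (q \<cdot> e) f))"
      by (intro sw_cong refl osum_esb_T) (simp_all add: bil_def)
    also have "\<dots> = osum HU (\<lambda>p q. osum HU (\<lambda>e f. ap \<phi> (p \<rhd> m) \<odot>\<^bsub>HU\<^esub> pU (q \<cdot> e) f))"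
      by (rule sw_swap) simp_all
    \<comment> \<open>The two copies of \<Delta>(1) merge into 1_1 \<otimes> \<Delta>(1_2), the
      coproduct of the value of \<open>ev\<close>.\<close>
    also have "\<dots> = osum HU (\<lambda>p q. dsum HU q (\<lambda>e f. ap \<phi> (p \<rhd> m) \<odot>\<^bsub>HU\<^esub> pU e f))"
      by (rule sweedler_one_left_split) (simp_all add: tril_def)
    also have "\<dots> = dsum HU (ev (pDM \<phi> m)) pU"
      unfolding ev_pure[OF \<open>\<phi> \<in> carrier D0\<close> \<open>m \<in> carrier M\<close>]
      by (simp add: sw_push[where g="\<lambda>u. dsum HU u pU" and P=H and Q=HU] bil_def smult_sw
        lin_smult[OF lin_sw1[OF _ _ _ lin_comult0]])
    finally show "dsum HU (ev (pDM \<phi> m)) pU = ?G (?F (pDM \<phi> m))" ..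
  qed (simp_all add: bil_def lin_compose[where g="?G" and M=HT])
  moreover have "?F X \<in> carrier HT" by simp
  moreover have "tensor_map R H U (\<lambda>h. h) ev Y = ?G Y" if "Y \<in> carrier HT" for Y
    using that by (simp add: tensor_map_def) (rule sw_eq_tensor_lift; simp)
  ultimately show ?thesis by (simp only: coact_U[OF ev_closed[OF X]] coact_YDM[OF X])
qed

lemma ev_morphism: "ev \<in> yd_morphisms R H YDM U"
  unfolding yd_morphisms_def lin_def[symmetric]
  by (auto simp: lin_ev[OF DM.lin_At_AB] ev_act ev_colinear simp del: U_simps(3))

section \<open>Coevaluation\<close>

definition "coev z = (\<Oplus>\<^bsub>MD.AB\<^esub>i\<in>I. pMD (z \<rhd> n i) (nd i))"

lemma lin_coev0 [simp]: "module R C \<Longrightarrow> lin R C H f \<Longrightarrow> lin R C MD.AB (\<lambda>x. coev (f x))"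
  unfolding coev_def by simp

lemma coev_closed0 [simp]: "z \<in> carrier H \<Longrightarrow> coev z \<in> carrier MD.AB"
  by (rule lin_closed[OF lin_coev0[OF mod_H lin_id]])

lemma sw_coev:
  assumes [simp]: "module R P" "z \<in> carrier H" and f: "bil R M D0 P f"
  shows "sw R M D0 P (coev z) f = (\<Oplus>\<^bsub>P\<^esub>i\<in>I. f (z \<rhd> n i) (nd i))"
proof -
  note [simp] = bil_closed[OF f]
  have "sw R M D0 P (coev z) f = (\<Oplus>\<^bsub>P\<^esub>i\<in>I. sw R M D0 P (pMD (z \<rhd> n i) (nd i)) f)"
    unfolding coev_def by (rule lin_finsum[of R MD.AB P "\<lambda>X. sw R M D0 P X f"]) (simp_all add: f)
  also have "\<dots> = (\<Oplus>\<^bsub>P\<^esub>i\<in>I. f (z \<rhd> n i) (nd i))"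
    by (intro module_finsum_cong[of R P]) (auto simp: sw_pure f)
  finally show ?thesis .
qed

lemma evD_coev:
  assumes [simp]: "z \<in> carrier H" "m \<in> carrier M"
  shows "evD M m (coev z) = z \<rhd> m"
proof -
  have "evD M m (coev z) = (\<Oplus>\<^bsub>M\<^esub>i\<in>I. ap (nd i) m \<odot>\<^bsub>M\<^esub> (z \<rhd> n i))"
    by (rule sw_coev) (simp_all add: bil_def)
  also have "\<dots> = z \<rhd> m" by (rule finsum_dual_basis) simp_all
  finally show ?thesis .
qed

text \<open>At m the left side is h1 z S(h2) m, because the dual factor is acted on through S; by
  \<open>et_mult\<close> this is et(hz) m.\<close>

lemma coev_act:
  assumes [simp]: "h \<in> carrier H" and z: "z \<in> carrier U0"
  shows "MD.tact h (coev z) = coev (et (h \<cdot> z))"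
proof (rule tensor_D_eqI[of M])
  fix m assume [simp]: "m \<in> carrier M"
  have [simp]: "z \<in> carrier H" using z by simp
  have "evD M m (MD.tact h (coev z)) = dsum M h (\<lambda>p q. sw R M D0 M (coev z) (\<lambda>a \<phi>. ap \<phi> (S q \<rhd> m) \<odot>\<^bsub>M\<^esub> (p \<rhd> a)))"
    by (simp add: MD.tact_eq sw_sw sw_pure bil_def)
  also have "\<dots> = dsum M h (\<lambda>p q. p \<rhd> evD M (S q \<rhd> m) (coev z))"
    by (simp add: sw_push[where g="\<lambda>u. _ \<rhd> u" and P=M and Q=M] lin_smult[OF lin_act2[OF lin_id]])
  also have "\<dots> = dsum M h (\<lambda>p q. (p \<cdot> (et z \<cdot> S q)) \<rhd> m)"
    using z by (simp add: evD_coev act_mult)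
  also have "\<dots> = et (h \<cdot> z) \<rhd> m"
    by (simp add: et_mult sw_push[where g="\<lambda>u. u \<rhd> m" and P=H and Q=M])
  also have "\<dots> = evD M m (coev (et (h \<cdot> z)))" by (simp add: evD_coev)
  finally show "evD M m (MD.tact h (coev z)) = evD M m (coev (et (h \<cdot> z)))" .
qed (use z in \<open>simp_all add: MD.tact_closed0\<close>)

lemma coev_project: "z \<in> carrier U0 \<Longrightarrow> MD.tact \<one>\<^bsub>H\<^esub> (coev z) = coev z"
  by (simp add: coev_act)

lemma coev_closed [simp]: "z \<in> carrier U0 \<Longrightarrow> coev z \<in> carrier MD.At"
  by (rule iffD2[OF MD.At_carrier]) (simp add: coev_project)

lemma lin_coev [simp]:
  assumes "module R C" "lin R C U0 f"
  shows "lin R C MD.At (\<lambda>x. coev (f x))"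
  by (rule MD.lin_AtI, rule lin_coev0[OF assms(1) lin_compose[OF lin_U0_H assms(2)]], rule coev_closed, rule lin_closed[OF assms(2)])

text \<open>Trades the coaction of the dual for that of M, at the price of a sum over the dual
  basis.\<close>

lemma sw_dco:
  assumes [simp]: "module R P" "\<phi> \<in> carrier D0" and f: "bil R H D0 P f"
  shows "sw R H D0 P (dco \<phi>) f = (\<Oplus>\<^bsub>P\<^esub>j\<in>I. csum P (n j) (\<lambda>c w. ap \<phi> w \<odot>\<^bsub>P\<^esub> f (T c) (nd j)))"
proof -
  note [simp] = bil_closed[OF f] bil_lin1[OF f]
  have "sw R H D0 P (dco \<phi>) f = (\<Oplus>\<^bsub>P\<^esub>j\<in>I. sw R H D0 P (pHD (dK \<phi> (n j)) (nd j)) f)"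
    unfolding dco_def by (rule lin_finsum[of R HD P "\<lambda>X. sw R H D0 P X f"]) (simp_all add: f)
  also have "\<dots> = (\<Oplus>\<^bsub>P\<^esub>j\<in>I. csum P (n j) (\<lambda>c w. ap \<phi> w \<odot>\<^bsub>P\<^esub> f (T c) (nd j)))"
    by (intro module_finsum_cong[of R P])
      (auto simp: sw_pure f sw_push[where g="\<lambda>u. f u _" and P=H and Q=P] lin_smult[OF bil_lin1[OF f]])
  finally show ?thesis .
qed

abbreviation "HT' \<equiv> tensor_module R H MD.At"
abbreviation "pHT' \<equiv> pure_tensor R H MD.At"

lemma coact_YMD:
  assumes "X \<in> carrier MD.AB"
  shows "coact YMD X = sw R M D0 HT' X (\<lambda>m \<phi>. csum HT' m (\<lambda>a x. sw R H D0 HT' (dco \<phi>) (\<lambda>b \<psi>.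
     pHT' (a \<cdot> b) (MD.tact \<one>\<^bsub>H\<^esub> (pMD x \<psi>)))))"
  using assms
  by (simp add: yd_tensor_def Let_def tensor_t_DM project_DM sw_eq_tensor_lift[of R M D0] tensor_lift_csum tensor_lift_dco)

text \<open>Two dual basis sums meet, \<open>i\<close> from coevaluation and \<open>j\<close> from
  the coaction of \<open>nd i\<close>. Contracting over \<open>i\<close> leaves for each
  \<open>j\<close> the expression of \<open>coact_T\<close> at \<open>n j\<close>. The other side
  reaches the same terms through \<Delta>(z) = z 1_1 \<otimes> 1_2.\<close>

lemma coev_colinear:
  assumes z: "z \<in> carrier U0"
  shows "coact YMD (coev z) = tensor_map R H YMD (\<lambda>h. h) coev (coact U z)"
proof -
  have [simp]: "z \<in> carrier H" "et z = z" using z by simp_all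
  interpret HT': module R HT' by simp
  \<comment> \<open>Hides the projection and the fixed dual factor, leaving a bilinear map to which
    \<open>coact_T\<close> applies.\<close>
  define B where "B j a x = pHT' a (MD.tact \<one>\<^bsub>H\<^esub> (pMD x (nd j)))" for j a x
  have B: "bil R H M HT' (B j)" if "j \<in> I" for j using that by (simp add: B_def bil_def)
  note [simp] = bil_rules[OF B]
  have "coact YMD (coev z) = (\<Oplus>\<^bsub>HT'\<^esub>i\<in>I. csum HT' (z \<rhd> n i) (\<lambda>a x. sw R H D0 HT' (dco (nd i)) (\<lambda>b \<psi>.
     pHT' (a \<cdot> b) (MD.tact \<one>\<^bsub>H\<^esub> (pMD x \<psi>)))))"
    by (simp add: coact_YMD) (rule sw_coev; simp add: bil_def)
  also have "\<dots> = (\<Oplus>\<^bsub>HT'\<^esub>i\<in>I. \<Oplus>\<^bsub>HT'\<^esub>j\<in>I. csum HT' (n j) (\<lambda>c w. ap (nd i) w \<odot>\<^bsub>HT'\<^esub> csum HT' (z \<rhd> n i) (\<lambda>a x. B j (a \<cdot> T c) x)))"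
  proof (intro module_finsum_cong[of R HT'])
    fix i assume [simp]: "i \<in> I"
    have "csum HT' (z \<rhd> n i) (\<lambda>a x. sw R H D0 HT' (dco (nd i)) (\<lambda>b \<psi>.
          pHT' (a \<cdot> b) (MD.tact \<one>\<^bsub>H\<^esub> (pMD x \<psi>)))) =
      csum HT' (z \<rhd> n i) (\<lambda>a x. \<Oplus>\<^bsub>HT'\<^esub>j\<in>I. csum HT' (n j) (\<lambda>c w. ap (nd i) w \<odot>\<^bsub>HT'\<^esub> B j (a \<cdot> T c) x))"
      unfolding B_def by (intro sw_cong refl sw_dco) (simp_all add: bil_def)
    also have "\<dots> = (\<Oplus>\<^bsub>HT'\<^esub>j\<in>I. csum HT' (z \<rhd> n i) (\<lambda>a x. csum HT' (n j) (\<lambda>c w. ap (nd i) w \<odot>\<^bsub>HT'\<^esub> B j (a \<cdot> T c) x)))"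
      by (rule sw_finsum) simp_all
    also have "\<dots> = (\<Oplus>\<^bsub>HT'\<^esub>j\<in>I. csum HT' (n j) (\<lambda>c w. ap (nd i) w \<odot>\<^bsub>HT'\<^esub> csum HT' (z \<rhd> n i) (\<lambda>a x. B j (a \<cdot> T c) x)))"
    proof (intro module_finsum_cong[of R HT'])
      fix j assume [simp]: "j \<in> I"
      have "csum HT' (z \<rhd> n i) (\<lambda>a x. csum HT' (n j) (\<lambda>c w. ap (nd i) w \<odot>\<^bsub>HT'\<^esub> B j (a \<cdot> T c) x)) =
        csum HT' (n j) (\<lambda>c w. csum HT' (z \<rhd> n i) (\<lambda>a x. ap (nd i) w \<odot>\<^bsub>HT'\<^esub> B j (a \<cdot> T c) x))"
        by (rule sw_swap) simp_all
      then show "csum HT' (z \<rhd> n i) (\<lambda>a x. csum HT' (n j) (\<lambda>c w. ap (nd i) w \<odot>\<^bsub>HT'\<^esub> B j (a \<cdot> T c) x)) =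
        csum HT' (n j) (\<lambda>c w. ap (nd i) w \<odot>\<^bsub>HT'\<^esub> csum HT' (z \<rhd> n i) (\<lambda>a x. B j (a \<cdot> T c) x))"
        by (simp add: smult_sw)
    qed simp_all
    finally show "csum HT' (z \<rhd> n i) (\<lambda>a x. sw R H D0 HT' (dco (nd i)) (\<lambda>b \<psi>.
          pHT' (a \<cdot> b) (MD.tact \<one>\<^bsub>H\<^esub> (pMD x \<psi>)))) =
      (\<Oplus>\<^bsub>HT'\<^esub>j\<in>I. csum HT' (n j) (\<lambda>c w. ap (nd i) w \<odot>\<^bsub>HT'\<^esub> csum HT' (z \<rhd> n i) (\<lambda>a x. B j (a \<cdot> T c) x)))" .
  qed (auto intro!: HT'.finsum_closed)
  also have "\<dots> = (\<Oplus>\<^bsub>HT'\<^esub>j\<in>I. \<Oplus>\<^bsub>HT'\<^esub>i\<in>I. csum HT' (n j) (\<lambda>c w. ap (nd i) w \<odot>\<^bsub>HT'\<^esub> csum HT' (z \<rhd> n i) (\<lambda>a x. B j (a \<cdot> T c) x)))"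
    by (rule finsum_swap[of R]) simp_all
  also have "\<dots> = (\<Oplus>\<^bsub>HT'\<^esub>j\<in>I. osum HT' (\<lambda>a b. B j (z \<cdot> a) (b \<rhd> n j)))"
  proof (intro module_finsum_cong[of R HT'])
    fix j assume [simp]: "j \<in> I"
    have "(\<Oplus>\<^bsub>HT'\<^esub>i\<in>I. csum HT' (n j) (\<lambda>c w. ap (nd i) w \<odot>\<^bsub>HT'\<^esub> csum HT' (z \<rhd> n i) (\<lambda>a x. B j (a \<cdot> T c) x))) =
      csum HT' (n j) (\<lambda>c w. \<Oplus>\<^bsub>HT'\<^esub>i\<in>I. ap (nd i) w \<odot>\<^bsub>HT'\<^esub> csum HT' (z \<rhd> n i) (\<lambda>a x. B j (a \<cdot> T c) x))"
      by (rule sw_finsum[symmetric]) simp_all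
    \<comment> \<open>The dual basis contraction: \<open>nd i\<close> at \<open>w\<close> and
      \<open>n i\<close> combine to \<open>w\<close> inside the linear expression in
      \<open>n i\<close>.\<close>
    also have "\<dots> = csum HT' (n j) (\<lambda>c w. csum HT' (z \<rhd> w) (\<lambda>a x. B j (a \<cdot> T c) x))"
      by (intro sw_cong refl finsum_dual_basis) (simp_all add: bil_def)
    also have "\<dots> = osum HT' (\<lambda>a b. B j (z \<cdot> a) (b \<rhd> n j))"
      using coact_T[of HT' z "n j" "B j"] B[of j] by simp
    finally show "(\<Oplus>\<^bsub>HT'\<^esub>i\<in>I. csum HT' (n j) (\<lambda>c w. ap (nd i) w \<odot>\<^bsub>HT'\<^esub> csum HT' (z \<rhd> n i) (\<lambda>a x. B j (a \<cdot> T c) x))) =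
      osum HT' (\<lambda>a b. B j (z \<cdot> a) (b \<rhd> n j))" .
  qed simp_all
  finally have L: "coact YMD (coev z) = (\<Oplus>\<^bsub>HT'\<^esub>j\<in>I. osum HT' (\<lambda>a b. B j (z \<cdot> a) (b \<rhd> n j)))" .
  have coev_B: "pHT' a (coev (et b)) = (\<Oplus>\<^bsub>HT'\<^esub>j\<in>I. B j a (et b \<rhd> n j))"
    if [simp]: "a \<in> carrier H" "b \<in> carrier H" for a b
  proof -
    \<comment> \<open>The projection is inserted before the sum is split, since a single summand
      need not lie in the truncated product.\<close>
    have "pHT' a (coev (et b)) = pHT' a (MD.tact \<one>\<^bsub>H\<^esub> (coev (et b)))"
      by (simp add: coev_project)
    also have "\<dots> = (\<Oplus>\<^bsub>HT'\<^esub>j\<in>I. B j a (et b \<rhd> n j))"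
      unfolding coev_def B_def
      by (rule lin_finsum[of R MD.AB HT' "\<lambda>X. pHT' a (MD.tact \<one>\<^bsub>H\<^esub> X)"]) simp_all
    finally show ?thesis .
  qed
  have "tensor_map R H YMD (\<lambda>h. h) coev (coact U z) = sw R H U0 HT' (dsum HU z pU) (\<lambda>a y. pHT' a (coev y))"
    unfolding coact_U[OF \<open>z \<in> carrier H\<close>] by (simp add: tensor_map_def) (rule sw_eq_tensor_lift; simp)
  also have "\<dots> = dsum HT' (et z) (\<lambda>a b. pHT' a (coev (et b)))"
    by (simp add: sw_sw sw_pure bil_def)
  also have "\<dots> = osum HT' (\<lambda>a b. pHT' (et z \<cdot> a) (coev (et b)))"
    by (rule comult_et(1)) (simp_all add: bil_def)
  also have "\<dots> = osum HT' (\<lambda>a b. \<Oplus>\<^bsub>HT'\<^esub>j\<in>I. B j (z \<cdot> a) (et b \<rhd> n j))"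
    by (simp add: coev_B)
  also have "\<dots> = (\<Oplus>\<^bsub>HT'\<^esub>j\<in>I. osum HT' (\<lambda>a b. B j (z \<cdot> a) (et b \<rhd> n j)))"
    by (rule sw_finsum) simp_all
  also have "\<dots> = (\<Oplus>\<^bsub>HT'\<^esub>j\<in>I. osum HT' (\<lambda>a b. B j (z \<cdot> a) (b \<rhd> n j)))"
    by (intro module_finsum_cong[of R HT'] osum_et(1)) (simp_all add: bil_def)
  finally show ?thesis using L by simp
qed

lemma coev_morphism: "coev \<in> yd_morphisms R H U YMD"
  unfolding yd_morphisms_def lin_def[symmetric]
  by (auto simp: lin_coev[OF mod_U0 lin_id] coev_act coev_colinear simp del: U_simps(3))

section \<open>The triangle identities\<close>

lemma lin_act_U [simp]: "h \<in> carrier H \<Longrightarrow> lin R U0 U0 (act U h)"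
  by (rule lin_cong[where g="\<lambda>z. et (h \<cdot> z)"]) simp_all

lemma sw_closed_KR [simp]:
  assumes "module R A" "module R B" "\<And>a b. a \<in> carrier A \<Longrightarrow> b \<in> carrier B \<Longrightarrow> f a b \<in> carrier R"
  shows "sw R A B KR X f \<in> carrier R"
  using sw_closed[of R A B KR f X] assms by simp

lemma carrier_YUM: "carrier (yd_tensor R H U M) \<subseteq> carrier (tensor_module R U0 M)"
proof -
  interpret UM: hmodule_pair R H U0 M "act U" "act M"
    by (intro hmodule_pair.intro weak_bialgebra_axioms hmodule_pair_axioms.intro)
      (simp_all add: act_mult H.m_assoc et_mult_et)
  have "carrier (yd_tensor R H U M) = carrier (tensor_t R H U M (act U) (act M))"
    using yd_tensor_same[of R H U M] by (simp add: same_module_def)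
  also have "\<dots> = carrier UM.At"
    by (simp add: tensor_t_def same_module_tensor_act(1)[OF same_U(1) same_module_refl])
  finally show ?thesis by auto
qed

lemma carrier_YDU: "carrier (yd_tensor R H D U) \<subseteq> carrier (tensor_module R D0 U0)"
proof -
  interpret DU: hmodule_pair R H D0 U0 dact "act U"
    by (intro hmodule_pair.intro weak_bialgebra_axioms hmodule_pair_axioms.intro)
      (simp_all add: DM.\<alpha>_mult H.m_assoc et_mult_et lin_dact2[OF mod_D0 lin_id])
  have "carrier (yd_tensor R H D U) = carrier (tensor_t R H D U dact (act U))"
    using yd_tensor_same[of R H D U] by (simp add: same_module_def)
  also have "\<dots> = carrier DU.At"
    by (simp add: tensor_t_def same_module_tensor_act(1)[OF same_module_refl same_U(1)])
  finally show ?thesis by auto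
qed

text \<open>Contracting the dual basis gives esb(1_2) z 1_1 m. Only the position of z separates this
  from \<open>osum_esb\<close>, and z in H_t commutes with the left leg once that is projected to
  H_s.\<close>

lemma triangle_M_pure:
  assumes [simp]: "z \<in> carrier U0" "m \<in> carrier M"
  shows "sw R M D0 M (coev z) (\<lambda>m' \<phi>. esb (ev (pDM \<phi> m)) \<rhd> m') = z \<rhd> m"
proof -
  have "sw R M D0 M (coev z) (\<lambda>m' \<phi>. esb (ev (pDM \<phi> m)) \<rhd> m') =
      (\<Oplus>\<^bsub>M\<^esub>i\<in>I. esb (ev (pDM (nd i) m)) \<rhd> z \<rhd> n i)"
    by (rule sw_coev) (simp_all add: bil_def)
  also have "\<dots> = (\<Oplus>\<^bsub>M\<^esub>i\<in>I. osum M (\<lambda>a b. ap (nd i) (a \<rhd> m) \<odot>\<^bsub>M\<^esub> (esb b \<rhd> z \<rhd> n i)))"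
    by (intro module_finsum_cong[of R M])
      (auto simp: ev_pure sw_push[where g="\<lambda>u. esb u \<rhd> _" and P=H and Q=M] lin_smult[OF lin_act1[OF lin_esb0]])
  also have "\<dots> = osum M (\<lambda>a b. \<Oplus>\<^bsub>M\<^esub>i\<in>I. ap (nd i) (a \<rhd> m) \<odot>\<^bsub>M\<^esub> (esb b \<rhd> z \<rhd> n i))"
    by (rule sw_finsum[symmetric]) simp_all
  also have "\<dots> = osum M (\<lambda>a b. esb b \<rhd> z \<rhd> a \<rhd> m)"
    by (intro sw_cong refl finsum_dual_basis) simp_all
  also have "\<dots> = osum M (\<lambda>a b. esb b \<rhd> z \<rhd> es a \<rhd> m)"
    by (rule osum_et(2)[symmetric]) (simp_all add: bil_def)
  also have "\<dots> = osum M (\<lambda>a b. esb b \<rhd> es a \<rhd> z \<rhd> m)"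
  proof (intro sw_cong refl)
    fix a b assume [simp]: "a \<in> carrier H" "b \<in> carrier H"
    have "z \<cdot> es a = es a \<cdot> z" using et_es_commute[of a z] by simp
    then have "z \<rhd> es a \<rhd> m = es a \<rhd> z \<rhd> m" by (simp add: act_mult[symmetric])
    then show "esb b \<rhd> z \<rhd> es a \<rhd> m = esb b \<rhd> es a \<rhd> z \<rhd> m" by simp
  qed
  also have "\<dots> = osum M (\<lambda>a b. esb b \<rhd> a \<rhd> z \<rhd> m)"
    by (rule osum_et(2)) (simp_all add: bil_def)
  also have "\<dots> = osum H (\<lambda>a b. esb b \<cdot> a) \<rhd> z \<rhd> m"
    by (simp add: act_mult sw_push[where g="\<lambda>u. u \<rhd> z \<rhd> m" and P=H and Q=M])
  finally show ?thesis by (simp add: osum_esb)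
qed

text \<open>At m the contraction gives \<phi>(1_1 z S(1_2) m). Again z moves past the left leg; 1_1
  S(1_2) is the unit, and \<open>S_esb\<close> recognises the remaining z as the action of
  \<open>esb z\<close> on \<phi>.\<close>

lemma triangle_D_pure:
  assumes [simp]: "z \<in> carrier U0" "\<phi> \<in> carrier D0"
  shows "sw R M D0 D0 (coev z) (\<lambda>m \<psi>. dact (ev (pDM \<phi> m)) \<psi>) = dact (esb z) \<phi>"
proof (rule D0_eqI)
  fix m assume [simp]: "m \<in> carrier M"
  have "ap (sw R M D0 D0 (coev z) (\<lambda>m \<psi>. dact (ev (pDM \<phi> m)) \<psi>)) m =
      sw R M D0 KR (coev z) (\<lambda>m' \<psi>. ap \<psi> (S (ev (pDM \<phi> m')) \<rhd> m))"
    by (simp add: sw_push[where g="\<lambda>u. ap u m" and P=D0 and Q=KR])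
  also have "\<dots> = (\<Oplus>\<^bsub>KR\<^esub>i\<in>I. ap (nd i) (S (ev (pDM \<phi> (z \<rhd> n i))) \<rhd> m))"
    by (rule sw_coev) (simp_all add: bil_def)
  also have "\<dots> = (\<Oplus>\<^bsub>KR\<^esub>i\<in>I. osum KR (\<lambda>a b. ap (nd i) (S b \<rhd> m) \<odot>\<^bsub>KR\<^esub> ap \<phi> (a \<rhd> z \<rhd> n i)))"
    by (intro module_finsum_cong[of R KR])
      (auto simp: ev_pure R.m_comm sw_push[where g="\<lambda>u. ap _ (S u \<rhd> m)" and P=H and Q=KR]
        lin_smult[OF lin_ap2[OF _ lin_act1[OF lin_S0]]])
  also have "\<dots> = osum KR (\<lambda>a b. \<Oplus>\<^bsub>KR\<^esub>i\<in>I. ap (nd i) (S b \<rhd> m) \<odot>\<^bsub>KR\<^esub> ap \<phi> (a \<rhd> z \<rhd> n i))"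
    by (rule sw_finsum[symmetric]) simp_all
  also have "\<dots> = osum KR (\<lambda>a b. ap \<phi> (a \<rhd> z \<rhd> S b \<rhd> m))"
    by (intro sw_cong refl finsum_dual_basis) simp_all
  also have "\<dots> = osum KR (\<lambda>a b. ap \<phi> (es a \<rhd> z \<rhd> S b \<rhd> m))"
    by (rule osum_et(2)[symmetric]) (simp_all add: bil_def)
  also have "\<dots> = osum KR (\<lambda>a b. ap \<phi> (z \<rhd> es a \<rhd> S b \<rhd> m))"
  proof (intro sw_cong refl)
    fix a b assume [simp]: "a \<in> carrier H" "b \<in> carrier H"
    have "z \<cdot> es a = es a \<cdot> z" using et_es_commute[of a z] by simp
    then show "ap \<phi> (es a \<rhd> z \<rhd> S b \<rhd> m) = ap \<phi> (z \<rhd> es a \<rhd> S b \<rhd> m)"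
      using act_mult[of z "es a" "S b \<rhd> m"] act_mult[of "es a" z "S b \<rhd> m"] by simp
  qed
  also have "\<dots> = osum KR (\<lambda>a b. ap \<phi> (z \<rhd> a \<rhd> S b \<rhd> m))"
    by (rule osum_et(2)) (simp_all add: bil_def)
  also have "\<dots> = ap \<phi> (z \<rhd> osum H (\<lambda>a b. a \<cdot> S b) \<rhd> m)"
    by (simp add: act_mult sw_push[where g="\<lambda>u. ap \<phi> (z \<rhd> u \<rhd> m)" and P=H and Q=KR])
  also have "\<dots> = ap (dact (esb z) \<phi>) m"
    by (simp add: S_right S_esb)
  finally show "ap (sw R M D0 D0 (coev z) (\<lambda>m \<psi>. dact (ev (pDM \<phi> m)) \<psi>)) m = ap (dact (esb z) \<phi>) m" .
qed simp_all

text \<open>The composite extends linearly to all of H_t \<otimes> M, so pure tensors suffice. The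
  projection introduced by the associativity map vanishes under \<open>ev\<close>.\<close>

lemma triangle_M:
  assumes x: "x \<in> carrier (tensor_module R U0 M)"
  shows "yd_unit_right R H M (tensor_map R M U (\<lambda>m. m) ev
      (yd_assoc R H M D M (tensor_map R YMD M coev (\<lambda>m. m) x))) = yd_unit_left R M x"
proof -
  let ?TM = "tensor_module R MD.At M" and ?MT = "tensor_module R M DM.At" and ?MU = "tensor_module R M U0"
  \<comment> \<open>\<open>A\<close>, \<open>B\<close>, \<open>C\<close>, \<open>E\<close> are the
    four factors of the composite as \<open>sw\<close> expressions: coevaluation, associativity,
    evaluation, right unit constraint.\<close>
  define A where "A x = sw R U0 M ?TM x (\<lambda>z m. pure_tensor R MD.At M (coev z) m)" for x
  define B where "B Y = sw R MD.At M ?MT Y (\<lambda>X p. sw R M D0 ?MT X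
    (\<lambda>m \<phi>. pure_tensor R M DM.At m (DM.tact \<one>\<^bsub>H\<^esub> (pDM \<phi> p))))" for Y
  define C where "C W = sw R M DM.At ?MU W (\<lambda>m w. pure_tensor R M U0 m (ev w))" for W
  define E where "E V = sw R M U0 M V (\<lambda>m z. esb z \<rhd> m)" for V
  have [simp]: "lin R DM.At U0 ev" using lin_ev[OF DM.lin_At_AB] .
  have [simp]: "lin R U0 MD.At coev" using lin_coev[OF mod_U0 lin_id] .
  have [simp]: "X \<in> carrier MD.AB" if "X \<in> carrier MD.At" for X using that by simp
  have lA: "lin R (tensor_module R U0 M) ?TM A" unfolding A_def by (simp add: bil_def)
  have lB: "lin R ?TM ?MT B" unfolding B_def by (simp add: bil_def)
  have lC: "lin R ?MT ?MU C" unfolding C_def by (simp add: bil_def)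
  have lE: "lin R ?MU M E" unfolding E_def by (simp add: bil_def)
  have eA: "tensor_map R YMD M coev (\<lambda>m. m) x = A x"
    unfolding A_def using x by (simp add: tensor_map_def) (rule sw_eq_tensor_lift; simp)
  have eB: "yd_assoc R H M D M Y = B Y" if Y: "Y \<in> carrier ?TM" for Y
  proof -
    have "yd_assoc R H M D M Y = tensor_lift R ?MT (\<lambda>X p. tensor_lift R ?MT (\<lambda>m \<phi>. pure_tensor R M DM.At m
       (DM.tact \<one>\<^bsub>H\<^esub> (pDM \<phi> p))) X) Y"
      by (simp add: yd_assoc_def Let_def project_DM)
    also have "\<dots> = B Y" unfolding B_def using Y
      by (subst sw_eq_tensor_lift[of R MD.At M]) (simp_all add: sw_eq_tensor_lift[of R M D0] cong: sw_cong)
    finally show ?thesis .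
  qed
  have eC: "tensor_map R M U (\<lambda>m. m) ev W = C W" if "W \<in> carrier ?MT" for W
    unfolding C_def using that by (simp add: tensor_map_def) (rule sw_eq_tensor_lift; simp)
  have eE: "yd_unit_right R H M V = E V" if "V \<in> carrier ?MU" for V
    unfolding E_def yd_unit_right_def using that by (rule sw_eq_tensor_lift[rotated 3]) simp_all
  have eL: "yd_unit_left R M x = sw R U0 M M x (\<lambda>z m. z \<rhd> m)"
    unfolding yd_unit_left_def using x by (rule sw_eq_tensor_lift[rotated 3]) simp_all
  have "E (C (B (A x))) = sw R U0 M M x (\<lambda>z m. z \<rhd> m)"
  proof (rule lin_tensor_eqI[OF mod_U0 mod_M _ _ _ _ x, of M "\<lambda>x. E (C (B (A x)))" "\<lambda>x. sw R U0 M M x (\<lambda>z m. z \<rhd> m)"])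
    show "lin R (tensor_module R U0 M) M (\<lambda>x. E (C (B (A x))))"
      by (rule lin_compose[OF lE lin_compose[OF lC lin_compose[OF lB lA]]])
    fix z m assume [simp]: "z \<in> carrier U0" "m \<in> carrier M"
    have "E (C (B (A (pure_tensor R U0 M z m)))) = sw R M D0 M (coev z) (\<lambda>m' \<phi>. esb (ev (pDM \<phi> m)) \<rhd> m')"
      unfolding A_def B_def C_def E_def by (simp add: sw_sw sw_pure bil_def ev_project)
    also have "\<dots> = z \<rhd> m" by (rule triangle_M_pure) simp_all
    finally show "E (C (B (A (pure_tensor R U0 M z m)))) = sw R U0 M M (pure_tensor R U0 M z m) (\<lambda>z m. z \<rhd> m)"
      by (simp add: sw_pure bil_def)
  qed (simp_all add: bil_def)
  then show ?thesis
    using lin_closed[OF lA x] lin_closed[OF lB lin_closed[OF lA x]] lin_closed[OF lC lin_closed[OF lB lin_closed[OF lA x]]]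
    by (simp only: eA eB eC eE eL)
qed

lemma triangle_D:
  assumes x: "x \<in> carrier (tensor_module R D0 U0)"
  shows "yd_unit_left R D (tensor_map R U D ev (\<lambda>d. d)
      (yd_assoc_inv R H D M D (tensor_map R D YMD (\<lambda>d. d) coev x))) = yd_unit_right R H D x"
proof -
  let ?DT = "tensor_module R D0 MD.At" and ?TD = "tensor_module R DM.At D0" and ?UD = "tensor_module R U0 D0"
  define A where "A x = sw R D0 U0 ?DT x (\<lambda>\<phi> z. pure_tensor R D0 MD.At \<phi> (coev z))" for x
  define B where "B Y = sw R D0 MD.At ?TD Y (\<lambda>\<phi> X. sw R M D0 ?TD X
    (\<lambda>m \<psi>. pure_tensor R DM.At D0 (DM.tact \<one>\<^bsub>H\<^esub> (pDM \<phi> m)) \<psi>))" for Y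
  define C where "C W = sw R DM.At D0 ?UD W (\<lambda>w \<psi>. pure_tensor R U0 D0 (ev w) \<psi>)" for W
  define E where "E V = sw R U0 D0 D0 V (\<lambda>z \<psi>. dact z \<psi>)" for V
  have [simp]: "lin R DM.At U0 ev" using lin_ev[OF DM.lin_At_AB] .
  have [simp]: "lin R U0 MD.At coev" using lin_coev[OF mod_U0 lin_id] .
  have [simp]: "lin R D0 D0 (dact h)" if "h \<in> carrier H" for h using that by (rule lin_dact2[OF mod_D0 lin_id])
  have lA: "lin R (tensor_module R D0 U0) ?DT A" unfolding A_def by (simp add: bil_def)
  have lB: "lin R ?DT ?TD B" unfolding B_def by (simp add: bil_def)
  have lC: "lin R ?TD ?UD C" unfolding C_def by (simp add: bil_def)
  have lE: "lin R ?UD D0 E" unfolding E_def by (simp add: bil_def)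
  \<comment> \<open>\<open>D\<close> and \<open>D0\<close> are different records with the same
    module structure; the identity, being linear between them, carries the sum from one to the
    other.\<close>
  have tl_D: "tensor_lift R D f X = sw R P Q D0 X f"
    if "module R P" "module R Q" "X \<in> carrier (tensor_module R P Q)" "\<And>a b. a \<in> carrier P \<Longrightarrow> b \<in> carrier Q \<Longrightarrow> f a b \<in> carrier D0"
    for f X and P :: "('k, 'a) module" and Q :: "('k, 'b) module"
  proof -
    have "tensor_lift R D f X = sw R P Q D X f" using that by (intro sw_eq_tensor_lift) simp_all
    also have "\<dots> = sw R P Q D0 X f" using that sw_push[of R P Q D D0 "\<lambda>x. x" f X] by simp
    finally show ?thesis .
  qed
  have eA: "tensor_map R D YMD (\<lambda>d. d) coev x = A x"
    unfolding A_def using x by (simp add: tensor_map_def) (rule sw_eq_tensor_lift; simp)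
  have eB: "yd_assoc_inv R H D M D Y = B Y" if Y: "Y \<in> carrier ?DT" for Y
  proof -
    have "yd_assoc_inv R H D M D Y = tensor_lift R ?TD (\<lambda>\<phi> X. tensor_lift R ?TD (\<lambda>m \<psi>. pure_tensor R DM.At D0
       (DM.tact \<one>\<^bsub>H\<^esub> (pDM \<phi> m)) \<psi>) X) Y"
      by (simp add: yd_assoc_inv_def Let_def project_DM)
    also have "\<dots> = B Y" unfolding B_def using Y
      by (subst sw_eq_tensor_lift[of R D0 MD.At]) (simp_all add: sw_eq_tensor_lift[of R M D0] cong: sw_cong)
    finally show ?thesis .
  qed
  have eC: "tensor_map R U D ev (\<lambda>d. d) W = C W" if "W \<in> carrier ?TD" for W
    unfolding C_def using that by (simp add: tensor_map_def) (rule sw_eq_tensor_lift; simp)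
  have eE: "yd_unit_left R D V = E V" if "V \<in> carrier ?UD" for V
    unfolding E_def yd_unit_left_def D_simps using that by (intro tl_D) simp_all
  have eR: "yd_unit_right R H D x = sw R D0 U0 D0 x (\<lambda>\<phi> z. dact (esb z) \<phi>)"
    unfolding yd_unit_right_def D_simps using x by (intro tl_D) simp_all
  have "E (C (B (A x))) = sw R D0 U0 D0 x (\<lambda>\<phi> z. dact (esb z) \<phi>)"
  proof (rule lin_tensor_eqI[OF mod_D0 mod_U0 _ _ _ _ x, of D0 "\<lambda>x. E (C (B (A x)))" "\<lambda>x. sw R D0 U0 D0 x (\<lambda>\<phi> z. dact (esb z) \<phi>)"])
    show "lin R (tensor_module R D0 U0) D0 (\<lambda>x. E (C (B (A x))))"
      by (rule lin_compose[OF lE lin_compose[OF lC lin_compose[OF lB lA]]])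
    fix \<phi> z assume [simp]: "\<phi> \<in> carrier D0" "z \<in> carrier U0"
    have "E (C (B (A (pure_tensor R D0 U0 \<phi> z)))) = sw R M D0 D0 (coev z) (\<lambda>m \<psi>. dact (ev (pDM \<phi> m)) \<psi>)"
      unfolding A_def B_def C_def E_def by (simp add: sw_sw sw_pure bil_def ev_project)
    also have "\<dots> = dact (esb z) \<phi>" by (rule triangle_D_pure) simp_all
    finally show "E (C (B (A (pure_tensor R D0 U0 \<phi> z)))) = sw R D0 U0 D0 (pure_tensor R D0 U0 \<phi> z) (\<lambda>\<phi> z. dact (esb z) \<phi>)"
      by (simp add: sw_pure bil_def)
  qed (simp_all add: bil_def)
  then show ?thesis
    using lin_closed[OF lA x] lin_closed[OF lB lin_closed[OF lA x]] lin_closed[OF lC lin_closed[OF lB lin_closed[OF lA x]]]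
    by (simp only: eA eB eC eE eR)
qed

lemma is_left_dual_D: "is_left_dual R H M D"
  unfolding is_left_dual_def Let_def
proof (intro bexI[OF _ ev_morphism] bexI[OF _ coev_morphism] conjI ballI)
  show "yd_unit_right R H M (tensor_map R M U (\<lambda>m. m) ev
      (yd_assoc R H M D M (tensor_map R YMD M coev (\<lambda>m. m) x))) = yd_unit_left R M x"
    if "x \<in> carrier (yd_tensor R H U M)" for x
    using that carrier_YUM by (intro triangle_M) blast
  show "yd_unit_left R D (tensor_map R U D ev (\<lambda>d. d)
      (yd_assoc_inv R H D M D (tensor_map R D YMD (\<lambda>d. d) coev x))) = yd_unit_right R H D x"
    if "x \<in> carrier (yd_tensor R H D U)" for x
    using that carrier_YDU by (intro triangle_D) blast
qed

text \<open>The roles of the dual basis are exchanged: the forms \<open>nd i\<close> generate the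
  dual, with evaluation at \<open>n i\<close> as coefficient.\<close>

lemma fgp_D: "fgp_yetter_drinfeld R H D"
proof -
  interpret D: module R D by simp
  have e: "\<phi> = (\<Oplus>\<^bsub>D\<^esub>i\<in>I. ap \<phi> (n i) \<odot>\<^bsub>D\<^esub> nd i)" if "\<phi> \<in> carrier D" for \<phi>
    using lin_finsum[of R D D0 "\<lambda>x. x" I "\<lambda>i. ap \<phi> (n i) \<odot>\<^bsub>D0\<^esub> nd i"] dual_expand[of \<phi>] that by simp
  have l: "lin R D KR (\<lambda>\<phi>. ap \<phi> (n i))" for i by simp
  show ?thesis
    using yetter_drinfeld_D fgp_of_dual_basis[of R D I nd "\<lambda>i \<phi>. ap \<phi> (n i)", OF mod_D fin_I _ l e]
    by (simp add: fgp_yetter_drinfeld_def)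
qed

end

theorem proposition5p3:
  fixes R :: "('k, 'z) ring_scheme" and H :: "('k, 'h, 'y) weak_hopf_scheme"
  assumes "weak_hopf_algebra R H"
    and "bij_betw (antipode H) (carrier H) (carrier H)"
  shows "\<forall>M :: ('k, 'h, 'm) yd_mod. fgp_yetter_drinfeld R H M \<longrightarrow>
    (\<exists>D :: ('k, 'h, 'm \<Rightarrow> 'k) yd_mod. fgp_yetter_drinfeld R H D \<and> is_left_dual R H M D)"
proof (intro allI impI)
  fix M :: "('k, 'h, 'm) yd_mod"
  assume M: "fgp_yetter_drinfeld R H M"
  then interpret M: yetter_drinfeld R H M by (simp add: fgp_yetter_drinfeld_def)
  interpret yd_hopf R H M
    by (intro yd_hopf.intro weak_hopf_bijective.intro weak_hopf_bijective_axioms.intro assms M.yetter_drinfeld_axioms)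
  show "\<exists>D :: ('k, 'h, 'm \<Rightarrow> 'k) yd_mod. fgp_yetter_drinfeld R H D \<and> is_left_dual R H M D"
  proof (rule dual_basis_exists[OF mod_M])
    show "finitely_generated R M" "projective R M" using M by (simp_all add: fgp_yetter_drinfeld_def)
    fix I :: "'m set" and n nd
    assume "finite I" "\<And>i. i \<in> I \<Longrightarrow> n i \<in> carrier M" "\<And>i. i \<in> I \<Longrightarrow> nd i \<in> carrier (dual_module R M)"
      "\<And>m. m \<in> carrier M \<Longrightarrow> m = (\<Oplus>\<^bsub>M\<^esub>i\<in>I. nd i m \<odot>\<^bsub>M\<^esub> n i)"
    then interpret yd_dual R H M I n nd
      by (intro yd_dual.intro yd_hopf_axioms yd_dual_axioms.intro)
    show ?thesis using fgp_D is_left_dual_D by blast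
  qed
qed

end
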